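(* Let $\gamma$ be the Euler–Mascheroni constant, $G$ a standard Gumbel random variable ($\mathbb{P}(G \le x) = e^{-e^{-x}}$), and $\tilde F^+_m := F^+_{T_m}$. As $m \to \infty$: (a1) If $d \ge 2$, then $\dfrac{\tilde F^+_m - (d!\,m)^{1/d}}{\ln m} \to 1 - d^{-1}$ in probability. (a2) If $d \ge 3$, then $\tilde F^+_m - \big[(d!\,m)^{1/d} + (1 - d^{-1})\ln m + \ln d - d^{-1}\ln(d!) - \gamma\big] \to G$ in law. (b1) For every $d \ge 1$, $\tilde F^+_m \sim (d!\,m)^{1/d}$ almost surely. (b2) If $d \ge 5$, then almost surely \[ \liminf_{m\to\infty} \frac{\tilde F^+_m - (d!\,m)^{1/d}}{\ln m} = 1 - d^{-1}, \qquad \limsup_{m\to\infty} \frac{\tilde F^+_m - (d!\,m)^{1/d}}{\ln m} = 1. \]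
   Context: Fix an integer $d \ge 1$. Let $X^{(1)}, X^{(2)}, \dots$ be i.i.d. random vectors in $\mathbb{R}^d$ with independent Exponential$(1)$ coordinates. For $x,y \in \mathbb{R}^d$ write $x \prec y$ if $x_j<y_j$ for all $j$, $x \le y$ if $x_j \le y_j$ for all $j$, and $x_+ := \sum_j x_j$. The record-setting region at time $n$ is $\mathrm{RS}_n := \{x \in \mathbb{R}^d : 0 \le x,\ x \not\prec X^{(i)} \text{ for all } 1 \le i \le n\}$, with frontier $F_n$ (its topological boundary relative to $[0,\infty)^d$), and $F_n^+ := \max\{x_+ : x \in F_n\}$. $X^{(k)}$ is a (Pareto) record if $X^{(k)} \not\prec X^{(i)}$ for all $1 \le i < k$, and $T_m$ is the index at which the $m$th record is set. *)

theory Defs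
  imports "HOL-Probability.Probability" "HOL-Library.Landau_Symbols"
begin

text \<open>Points of R^d are modelled as vectors of type real^'d with d = CARD('d).
  A sample path is a sequence X :: nat => real^'d, with X 1, X 2, ... the observations.\<close>

definition orthant :: "(real^'d) set" where
  "orthant = {x. \<forall>j. 0 \<le> x $ j}"

definition strict_below :: "real^'d \<Rightarrow> real^'d \<Rightarrow> bool" where
  "strict_below x y \<longleftrightarrow> (\<forall>j. x $ j < y $ j)"

definition coord_sum :: "real^'d \<Rightarrow> real" where
  "coord_sum x = (\<Sum>j\<in>UNIV. x $ j)"

definition RS :: "(nat \<Rightarrow> real^'d) \<Rightarrow> nat \<Rightarrow> (real^'d) set" where
  "RS X n = {x \<in> orthant. \<forall>i\<in>{1..n}. \<not> strict_below x (X i)}"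

definition frontier_RS :: "(nat \<Rightarrow> real^'d) \<Rightarrow> nat \<Rightarrow> (real^'d) set" where
  "frontier_RS X n = (top_of_set orthant) frontier_of (RS X n)"

definition Fplus :: "(nat \<Rightarrow> real^'d) \<Rightarrow> nat \<Rightarrow> real" where
  "Fplus X n = Sup (coord_sum ` frontier_RS X n)"

definition is_record :: "(nat \<Rightarrow> real^'d) \<Rightarrow> nat \<Rightarrow> bool" where
  "is_record X k \<longleftrightarrow> 1 \<le> k \<and> (\<forall>i\<in>{1..<k}. \<not> strict_below (X k) (X i))"

definition record_time :: "(nat \<Rightarrow> real^'d) \<Rightarrow> nat \<Rightarrow> nat" where
  "record_time X m = (LEAST k. is_record X k \<and> card {i\<in>{1..k}. is_record X i} = m)"

definition Ftilde :: "(nat \<Rightarrow> real^'d) \<Rightarrow> nat \<Rightarrow> real" where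
  "Ftilde X m = Fplus X (record_time X m)"

end

theory Submission
  imports Defs
begin

text \<open>Almost surely the frontier maximum at time \<open>n\<close> is the largest coordinate sum among the first
  \<open>n\<close> observations, a maximum of \<open>n\<close> independent Gamma(\<open>d\<close>) variables, and it increases only at
  records. So if \<open>R n\<close> counts the records up to time \<open>n\<close>, the frontier maximum at the \<open>R n\<close>-th record
  is the one at time \<open>n\<close>, and extreme value theory for the Gamma law gives the theorem once
  \<open>Z n = (d! R n)^(1/d)\<close> is located.

  The expectation of \<open>R n\<close> is the complete homogeneous polynomial of degree \<open>d\<close> in
  \<open>1, 1/2, \<dots>, 1/n\<close>, which is \<open>H^d / d! + O(H^(d-2))\<close> for the harmonic number \<open>H = harm n\<close>, and the
  variance of \<open>R n\<close> is \<open>O(H^d)\<close>. By Chebyshev's inequality \<open>Z n - H\<close> is bounded in probability for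
  \<open>d \<ge> 2\<close>, tends to 0 in probability for \<open>d \<ge> 3\<close>, and is almost surely bounded for \<open>d \<ge> 4\<close> by
  Borel--Cantelli along the times at which \<open>H\<close> passes an integer. Since \<open>H - ln n\<close> tends to
  Euler's constant, this is where the constant in (a2) comes from.\<close>

subsection \<open>Complete homogeneous polynomials of the reciprocals\<close>


text \<open>The main obstacle is the variance. Let q(x) be the probability that an observation
  dominates x. Given the values u, v of observations j < k, another observation dominates neither
  with a probability that exceeds (1 - q(u)) (1 - q(v)) by at most q(join of u and v). Up to a
  telescoping term, the covariance of the two record events is thus controlled by the mean of j
  q(join) exp(-j q(u)/2) exp(-k q(v)/2). Trading the first exponential for a power of exponent -3/2
  and integrating over u leaves j^(-1/2) q(v)^(1/2) exp(-k q(v)/2); summed over j and k this has the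
  size of the mean of min(n, 1/q), which is of order H^d. Working with H instead of ln n removes the
  term of degree d - 1 from the mean, so the bias of Z is O(1/H), while its fluctuation is O(H^(1 -
  d/2)); this produces the thresholds on d. The record time is random and depends on the frontier.
  For the limit laws it is bypassed: count and frontier are monotone in n, so comparing the count
  with m at the fixed times where H passes (d! m)^(1/d) + w or (d! m)^(1/d) - w traps the frontier
  between two maxima at fixed times.\<close>

fun hs :: "nat \<Rightarrow> nat \<Rightarrow> real" where
  "hs 0 n = 1"
| "hs (Suc d) n = (\<Sum>k=1..n. hs d k / real k)"

text \<open>This is the expectation of \<open>(1 - q)^n\<close> for a product \<open>q\<close> of \<open>d\<close> independent uniform variables, the
  probability that observation \<open>n + 1\<close> is a record.\<close>

definition alt_binom_sum :: "nat \<Rightarrow> nat \<Rightarrow> real" where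
  "alt_binom_sum d n = (\<Sum>i\<le>n. (-1) ^ i * real (n choose i) / real (Suc i) ^ d)"

lemma alt_binom_sum_0: "alt_binom_sum 0 n = (if n = 0 then 1 else 0)"
  using choose_alternating_sum[of n, where ?'a = real]
  by (cases "n = 0") (auto simp: alt_binom_sum_def)

text \<open>Absorption, \<open>(n + 1) (n choose i) = (i + 1) (n + 1 choose i + 1)\<close>, cancels
  one factor \<open>i + 1\<close> of the denominator. By Pascal's rule the resulting sum
  \<open>g\<close> grows from \<open>n\<close> to \<open>n + 1\<close> by
  \<open>alt_binom_sum d (n + 1)\<close>.\<close>

lemma alt_binom_sum_Suc:
  "real (Suc n) * alt_binom_sum (Suc d) n = (\<Sum>j\<le>n. alt_binom_sum d j)"
proof -
  define g where "g n = (\<Sum>i\<le>n. (-1) ^ i * real (Suc n choose Suc i) / real (Suc i) ^ d)" for n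
  have a: "real (Suc n) * alt_binom_sum (Suc d) n = g n" for n
  proof -
    have "real (Suc n) * ((-1) ^ i * real (n choose i) / real (Suc i) ^ Suc d)
       = (-1) ^ i * real (Suc n choose Suc i) / real (Suc i) ^ d" for i
    proof -
      have "real (Suc n) * real (n choose i) = real (Suc n choose Suc i) * real (Suc i)"
        using Suc_times_binomial_eq[of n i] by (metis of_nat_mult)
      then have "real (n choose i) / real (Suc i) * real (Suc n) = real (Suc n choose Suc i)"
        by (simp add: field_simps del: binomial_Suc_Suc of_nat_Suc)
      then show ?thesis
        by (simp add: field_simps del: binomial_Suc_Suc of_nat_Suc)
    qed
    then show ?thesis
      unfolding alt_binom_sum_def g_def by (simp only: sum_distrib_left)
  qed
  have s: "g (Suc n) = g n + alt_binom_sum d (Suc n)" for n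
  proof -
    have "g n = (\<Sum>i\<le>Suc n. (-1) ^ i * real (Suc n choose Suc i) / real (Suc i) ^ d)"
      by (simp add: g_def binomial_eq_0)
    then show ?thesis
      unfolding g_def alt_binom_sum_def
      by (simp add: sum.distrib [symmetric] algebra_simps add_divide_distrib [symmetric]
          del: sum.atMost_Suc)
  qed
  have "g n = (\<Sum>j\<le>n. alt_binom_sum d j)" for n
    by (induction n) (simp_all add: s, simp add: g_def alt_binom_sum_def)
  with a show ?thesis by simp
qed

text \<open>Both sides obey the same recursion in \<open>d\<close>: partial summation over the
  second argument, then division by \<open>n + 1\<close>. The shift from \<open>j <= n\<close> to
  \<open>1..Suc n\<close> matches the index conventions.\<close>

lemma alt_binom_sum_eq_hs: "alt_binom_sum (Suc d) n = hs d (Suc n) / real (Suc n)"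
proof (induction d arbitrary: n)
  case 0
  have "(\<Sum>j\<le>n. alt_binom_sum 0 j) = 1"
    by (induction n) (auto simp: alt_binom_sum_0)
  then show ?case using alt_binom_sum_Suc[of n 0] by (simp add: field_simps)
next
  case (Suc d)
  have "(\<Sum>j\<le>n. alt_binom_sum (Suc d) j) = (\<Sum>j=1..Suc n. hs d j / real j)"
    unfolding Suc.IH One_nat_def sum.atLeast_Suc_atMost_Suc_shift
    by (simp only: atLeast0AtMost comp_def)
  then have "real (Suc n) * alt_binom_sum (Suc (Suc d)) n = hs (Suc d) (Suc n)"
    by (simp only: alt_binom_sum_Suc hs.simps)
  then show ?case by (simp add: field_simps del: hs.simps of_nat_Suc)
qed

lemma power_diff_upper:
  fixes x y :: real
  assumes "0 \<le> y" "y \<le> x"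
  shows "x ^ n - y ^ n \<le> real n * x ^ (n - 1) * (x - y)"
proof (induction n)
  case (Suc n)
  have "y * (x ^ n - y ^ n) \<le> x * (real n * x ^ (n - 1) * (x - y))"
    using Suc assms by (intro mult_mono) (auto intro: power_mono)
  also have "\<dots> = real n * x ^ n * (x - y)" by (cases n) auto
  finally show ?case by (simp add: algebra_simps)
qed auto

lemma power_diff_lower:
  fixes x y :: real
  assumes "0 \<le> y" "y \<le> x"
  shows "real n * y ^ (n - 1) * (x - y) \<le> x ^ n - y ^ n"
proof (induction n)
  case (Suc n)
  have "real n * y ^ n * (x - y) = y * (real n * y ^ (n - 1) * (x - y))" by (cases n) auto
  also have "\<dots> \<le> y * (x ^ n - y ^ n)"
    using Suc assms by (intro mult_left_mono) auto
  finally have 1: "real n * y ^ n * (x - y) \<le> y * (x ^ n - y ^ n)" .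
  have 2: "y ^ n * (x - y) \<le> x ^ n * (x - y)"
    using assms by (intro mult_right_mono power_mono) auto
  show ?case using 1 2 by (simp add: algebra_simps)
qed auto

lemma harm_minus_one: "1 \<le> k \<Longrightarrow> harm (k - 1) = (harm k - 1 / real k :: real)"
  by (cases k) (auto simp: harm_Suc inverse_eq_divide)

lemma harm_ge_1: "1 \<le> n \<Longrightarrow> (1::real) \<le> harm n"
  using harm_mono[of 1 n, where ?'a = real] by (simp add: harm_def)

lemma sum_harm_telescope:
  assumes "0 < m"
  shows "(\<Sum>k=1..n. harm k ^ m - harm (k - 1) ^ m) = (harm n ^ m :: real)"
  using assms by (induction n) (auto simp: harm_def)

text \<open>The increments of \<open>harm\<close> are \<open>1 / k\<close>, so the sum of
  \<open>harm k ^ d / k\<close> is a Riemann sum of \<open>x ^ d\<close> with right endpoints and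
  overestimates the integral \<open>harm n ^ (d + 1) / (d + 1)\<close>.\<close>

lemma hs_ge: "harm n ^ d / fact d \<le> hs d n"
proof (induction d arbitrary: n)
  case (Suc d)
  have "harm n ^ Suc d = (\<Sum>k=1..n. harm k ^ Suc d - harm (k - 1) ^ Suc d :: real)"
    by (rule sum_harm_telescope[symmetric]) simp
  also have "\<dots> \<le> (\<Sum>k=1..n. real (Suc d) * fact d * (hs d k / real k))"
  proof (rule sum_mono)
    fix k assume k: "k \<in> {1..n}"
    have "harm k ^ Suc d - harm (k - 1) ^ Suc d
        \<le> real (Suc d) * harm k ^ d * (harm k - harm (k - 1))"
      using power_diff_upper[of "harm (k-1)" "harm k" "Suc d"] by (auto simp: harm_nonneg harm_mono)
    also have "\<dots> = real (Suc d) * (harm k ^ d / real k)" using k harm_minus_one[of k] by simp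
    also have "\<dots> \<le> real (Suc d) * (fact d * hs d k / real k)"
      using Suc.IH[of k] by (intro mult_left_mono divide_right_mono) (auto simp: field_simps)
    finally show "harm k ^ Suc d - harm (k - 1) ^ Suc d \<le> real (Suc d) * fact d * (hs d k / real k)"
      by simp
  qed
  also have "\<dots> = fact (Suc d) * hs (Suc d) n"
    by (simp add: sum_distrib_left mult.assoc)
  finally show ?case by (simp add: divide_le_eq mult.commute del: hs.simps)
qed simp

lemma sum_inverse_squares_le: "(\<Sum>k=1..n. 1 / real k ^ 2) \<le> 2"
proof (cases n)
  case (Suc n')
  have "1 \<le> n \<Longrightarrow> (\<Sum>k=1..n. 1 / real k ^ 2) \<le> 2 - 1 / real n" for n
  proof (induction n rule: dec_induct)
    case (step n)
    have "1 / real (Suc n) ^ 2 \<le> 1 / real n - 1 / real (Suc n)"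
    proof -
      have "1 / real (Suc n) ^ 2 \<le> 1 / (real n * real (Suc n))"
        using step by (intro divide_left_mono) (auto simp: power2_eq_square intro!: mult_right_mono)
      also have "\<dots> = 1 / real n - 1 / real (Suc n)" using step by (simp add: field_simps)
      finally show ?thesis .
    qed
    then show ?case using step by simp
  qed simp
  from this[of n] Suc show ?thesis by (smt (verit) divide_nonneg_nonneg le_numeral_extra(4) of_nat_0_le_iff plus_1_eq_Suc le_add1)
qed simp

text \<open>Moving from right to left endpoints costs at most
  \<open>(d + 1) * harm n ^ d / k ^ 2\<close> per term, which is summable over \<open>k\<close>, and
  the sum with left endpoints lies below the integral. The error is therefore two degrees below the
  main term.\<close>

lemma sum_harm_power_le:
  "(\<Sum>k=1..n. harm k ^ Suc d / real k) \<le> harm n ^ (d + 2) / real (d + 2) + 2 * real (Suc d) * harm n ^ d"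
proof -
  have "(\<Sum>k=1..n. harm k ^ Suc d / real k)
     \<le> (\<Sum>k=1..n. (harm k ^ (d + 2) - harm (k - 1) ^ (d + 2)) / real (d + 2)
           + real (Suc d) * harm n ^ d * (1 / real k ^ 2))"
  proof (rule sum_mono)
    fix k assume k: "k \<in> {1..n}"
    let ?x = "harm k :: real" and ?y = "harm (k - 1) :: real"
    have y: "0 \<le> ?y" "?y \<le> ?x" "?x - ?y = 1 / real k"
      using k harm_minus_one[of k] harm_nonneg[of "k - 1", where ?'a = real] by (auto simp: harm_mono)
    have "?x ^ Suc d - ?y ^ Suc d \<le> real (Suc d) * ?x ^ d * (1 / real k)"
      using power_diff_upper[of ?y ?x "Suc d"] y by simp
    also have "\<dots> \<le> real (Suc d) * harm n ^ d * (1 / real k)"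
      using k by (intro mult_right_mono mult_left_mono power_mono) (auto simp: harm_nonneg harm_mono)
    finally have "?x ^ Suc d * (1 / real k) \<le> (?y ^ Suc d + real (Suc d) * harm n ^ d * (1 / real k)) * (1 / real k)"
      by (intro mult_right_mono) auto
    also have "\<dots> = ?y ^ Suc d * (1 / real k) + real (Suc d) * harm n ^ d * (1 / real k ^ 2)"
      by (simp add: power2_eq_square add_divide_distrib distrib_right)
    also have "?y ^ Suc d * (1 / real k) \<le> (?x ^ (d + 2) - ?y ^ (d + 2)) / real (d + 2)"
    proof -
      have "real (d + 2) * (?y ^ Suc d * (1 / real k)) \<le> ?x ^ (d + 2) - ?y ^ (d + 2)"
        using power_diff_lower[OF y(1,2), of "d + 2"] unfolding y(3) by (simp add: mult.assoc)
      then show ?thesis by (subst pos_le_divide_eq) (simp_all add: mult.commute)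
    qed
    finally show "?x ^ Suc d / real k \<le> (?x ^ (d + 2) - ?y ^ (d + 2)) / real (d + 2)
           + real (Suc d) * harm n ^ d * (1 / real k ^ 2)" by simp
  qed
  also have "\<dots> = harm n ^ (d + 2) / real (d + 2)
      + real (Suc d) * harm n ^ d * (\<Sum>k=1..n. 1 / real k ^ 2)"
    using sum_harm_telescope[of "d + 2" n]
    by (simp only: sum.distrib sum_distrib_left sum_divide_distrib [symmetric])
  also have "\<dots> \<le> harm n ^ (d + 2) / real (d + 2) + real (Suc d) * harm n ^ d * 2"
    by (intro add_left_mono mult_left_mono sum_inverse_squares_le) (auto simp: harm_nonneg)
  finally show ?thesis by (simp add: algebra_simps)
qed

lemma hs_1: "hs (Suc 0) n = harm n"
  by (simp add: harm_def inverse_eq_divide)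

text \<open>The gap of two degrees between main term and error survives each summation. It keeps the
  bias of \<open>Z n\<close> at order \<open>1 / harm n\<close>; an expansion in powers of
  \<open>ln n\<close> would contain the degree in between.\<close>

lemma hs_le:
  "\<exists>C\<ge>0. \<forall>n. hs (d + 2) n \<le> harm n ^ (d + 2) / fact (d + 2) + C * harm n ^ d"
proof (induction d)
  case 0
  have "hs 2 n \<le> harm n ^ 2 / 2 + 2" for n
  proof -
    have "hs 2 n = (\<Sum>k=1..n. hs (Suc 0) k / real k)" by (simp add: numeral_2_eq_2)
    then show ?thesis using sum_harm_power_le[of 0 n] by (simp add: hs_1 power2_eq_square del: hs.simps(2))
  qed
  then show ?case by (intro exI[of _ 2]) (simp add: numeral_2_eq_2)
next
  case (Suc d)
  then obtain C where C: "0 \<le> C" "\<And>n. hs (d + 2) n \<le> harm n ^ (d + 2) / fact (d + 2) + C * harm n ^ d"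
    by auto
  have "hs (Suc d + 2) n \<le> harm n ^ (Suc d + 2) / fact (Suc d + 2)
     + (2 * real (d + 2) / fact (d + 2) + C) * harm n ^ Suc d" for n
  proof -
    have "hs (Suc d + 2) n = (\<Sum>k=1..n. hs (d + 2) k / real k)" by simp
    also have "\<dots> \<le> (\<Sum>k=1..n. harm k ^ Suc (Suc d) / real k / fact (d + 2) + C * harm n ^ d * (1 / real k))"
    proof (rule sum_mono)
      fix k assume k: "k \<in> {1..n}"
      have "hs (d + 2) k \<le> harm k ^ (d + 2) / fact (d + 2) + C * harm k ^ d" by (rule C)
      also have "\<dots> \<le> harm k ^ (d + 2) / fact (d + 2) + C * harm n ^ d"
        using k C by (intro add_left_mono mult_left_mono power_mono) (auto simp: harm_nonneg harm_mono)
      finally show "hs (d + 2) k / real k \<le> harm k ^ Suc (Suc d) / real k / fact (d + 2) + C * harm n ^ d * (1 / real k)"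
        using divide_right_mono[of _ _ "real k"] by (fastforce simp: add_divide_distrib ac_simps simp del: hs.simps fact_Suc)
    qed
    also have "\<dots> = (\<Sum>k=1..n. harm k ^ Suc (Suc d) / real k) / fact (d + 2) + C * harm n ^ d * harm n"
      unfolding sum.distrib by (simp add: sum_divide_distrib harm_def sum_distrib_left inverse_eq_divide)
    also have "\<dots> \<le> (harm n ^ (Suc d + 2) / real (Suc d + 2) + 2 * real (Suc (Suc d)) * harm n ^ Suc d) / fact (d + 2) + C * harm n ^ d * harm n"
      by (intro add_right_mono divide_right_mono sum_harm_power_le) auto
    also have "\<dots> = harm n ^ (Suc d + 2) / fact (Suc d + 2)
     + (2 * real (d + 2) / fact (d + 2) + C) * harm n ^ Suc d"
      by (simp add: add_divide_distrib algebra_simps)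
    finally show ?thesis .
  qed
  then show ?case using C(1)
    by (intro exI[of _ "2 * real (d + 2) / fact (d + 2) + C"]) auto
qed


subsection \<open>The frontier and the records of a single path\<close>

lemma coord_sum_strict_mono: "strict_below x y \<Longrightarrow> coord_sum x < coord_sum y"
  unfolding strict_below_def coord_sum_def by (rule sum_strict_mono) auto

lemma coord_sum_mono: "(\<And>j. x $ j \<le> y $ j) \<Longrightarrow> coord_sum x \<le> coord_sum y"
  unfolding coord_sum_def by (rule sum_mono) auto

lemma frontier_RS_eq:
  "frontier_RS X n = orthant \<inter> closure (RS X n) \<inter> closure (orthant - RS X n)"
proof -
  have "orthant \<inter> RS X n = RS X n" "orthant \<inter> (orthant - RS X n) = orthant - RS X n"
    by (auto simp: RS_def)
  then show ?thesis
    unfolding frontier_RS_def frontier_of_closures closure_of_subtopology by auto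
qed

text \<open>Only observations with all coordinates positive remove points from the orthant, so
  frontier points lie below one of them; the one with the largest coordinate sum is dominated by
  none and lies on the frontier itself. Positivity is not assumed for all observations, because
  \<open>F_measurable\<close> needs the value on every path, including the default
  \<open>Sup {}\<close>.\<close>

lemma Fplus_eq:
  fixes X :: "nat \<Rightarrow> real^'d"
  defines "P \<equiv> \<lambda>n. {i \<in> {1..n}. \<forall>j. 0 < X i $ j}"
  shows "Fplus X n = (if P n = {} then Sup {} else Max ((\<lambda>i. coord_sum (X i)) ` P n))"
proof -
  define D where "D = {x \<in> orthant. \<exists>i\<in>{1..n}. strict_below x (X i)}"
  have D: "orthant - RS X n = D" by (auto simp: RS_def D_def)
  have D_P: "\<exists>i\<in>P n. strict_below x (X i)" if "x \<in> D" for x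
  proof -
    from that obtain i where i: "i \<in> {1..n}" "\<And>j. x $ j < X i $ j" "\<And>j. 0 \<le> x $ j"
      unfolding D_def orthant_def strict_below_def by auto
    have "0 < X i $ j" for j using i(2,3)[of j] by linarith
    with i show ?thesis unfolding P_def strict_below_def by auto
  qed
  have fin: "finite (P n)" by (simp add: P_def)
  have le: "\<exists>i\<in>P n. \<forall>j. x $ j \<le> X i $ j" if "x \<in> closure D" for x
  proof -
    have "closed {x. \<forall>j. x $ j \<le> X i $ j}" for i
      by (intro closed_Collect_all closed_Collect_le continuous_intros)
    then have "closed (\<Union>i\<in>P n. {x. \<forall>j. x $ j \<le> X i $ j})"
      using fin by auto
    moreover have "D \<subseteq> (\<Union>i\<in>P n. {x. \<forall>j. x $ j \<le> X i $ j})"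
    proof
      fix x assume "x \<in> D"
      from D_P[OF this] show "x \<in> (\<Union>i\<in>P n. {x. \<forall>j. x $ j \<le> X i $ j})"
        unfolding strict_below_def by (auto intro: less_imp_le)
    qed
    ultimately have "closure D \<subseteq> (\<Union>i\<in>P n. {x. \<forall>j. x $ j \<le> X i $ j})"
      by (rule closure_minimal[rotated])
    with that show ?thesis by auto
  qed
  show ?thesis
  proof (cases "P n = {}")
    case True
    then have "D = {}" using D_P by blast
    then show ?thesis using True by (simp add: Fplus_def frontier_RS_eq D)
  next
    case False
    let ?M = "Max ((\<lambda>i. coord_sum (X i)) ` P n)"
    have "?M \<in> (\<lambda>i. coord_sum (X i)) ` P n" using fin False by (intro Max_in) auto
    then obtain i where i: "i \<in> P n" "coord_sum (X i) = ?M" by auto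
    have pos: "0 < X i $ j" for j using i by (auto simp: P_def)
    have orth: "X i \<in> orthant" using pos by (auto simp: orthant_def less_imp_le)
    have "X i \<in> RS X n"
    proof -
      have "\<not> strict_below (X i) (X k)" if k: "k \<in> {1..n}" for k
      proof
        assume s: "strict_below (X i) (X k)"
        then have "k \<in> P n" using pos k unfolding P_def strict_below_def
          by (auto intro: less_trans)
        then have "coord_sum (X k) \<le> ?M" using fin by (intro Max_ge) auto
        with coord_sum_strict_mono[OF s] i show False by simp
      qed
      then show ?thesis using orth by (auto simp: RS_def)
    qed
    moreover have "X i \<in> closure D"
    proof -
      \<comment> \<open>Shrinking \<open>X i\<close> towards the origin stays in the orthant and
        strictly below \<open>X i\<close>, because its coordinates are positive.\<close>
      define y where "y k = (1 - inverse (real (Suc k))) *\<^sub>R X i" for k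
      have "y k \<in> D" for k
      proof -
        have "0 \<le> 1 - inverse (real (Suc k))" "1 - inverse (real (Suc k)) < 1"
          by (simp_all add: field_simps)
        then have "0 \<le> y k $ j" "y k $ j < X i $ j" for j
          using pos[of j] unfolding y_def
          by (auto intro!: mult_nonneg_nonneg simp: less_imp_le del: of_nat_Suc)
        then have "y k \<in> orthant" "strict_below (y k) (X i)"
          by (simp_all add: orthant_def strict_below_def)
        then show ?thesis using i(1) unfolding D_def P_def by blast
      qed
      moreover have "y \<longlonglongrightarrow> (1 - 0) *\<^sub>R X i"
        unfolding y_def by (intro tendsto_intros LIMSEQ_inverse_real_of_nat)
      ultimately show ?thesis unfolding closure_sequential by auto
    qed
    ultimately have "X i \<in> frontier_RS X n"
      using orth closure_subset unfolding frontier_RS_eq D by blast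
    then have "?M \<in> coord_sum ` frontier_RS X n" using i(2) by force
    moreover have "s \<le> ?M" if "s \<in> coord_sum ` frontier_RS X n" for s
    proof -
      from that obtain x where x: "x \<in> closure D" "s = coord_sum x"
        by (auto simp: frontier_RS_eq D)
      from le[OF x(1)] obtain k where k: "k \<in> P n" "\<And>j. x $ j \<le> X k $ j" by auto
      have "s \<le> coord_sum (X k)" unfolding x by (rule coord_sum_mono) (rule k)
      also have "\<dots> \<le> ?M" using fin k(1) by (intro Max_ge) auto
      finally show ?thesis .
    qed
    ultimately have "Sup (coord_sum ` frontier_RS X n) = ?M" by (rule cSup_eq_maximum)
    with False show ?thesis by (simp add: Fplus_def)
  qed
qed

section \<open>Counting records and locating record times\<close>

definition rec_count :: "(nat \<Rightarrow> real^'d) \<Rightarrow> nat \<Rightarrow> nat" where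
  "rec_count X n = card {i \<in> {1..n}. is_record X i}"

lemma rec_count_0 [simp]: "rec_count X 0 = 0"
  by (simp add: rec_count_def)

lemma rec_count_Suc: "rec_count X (Suc n) = rec_count X n + (if is_record X (Suc n) then 1 else 0)"
proof -
  have "{i \<in> {1..Suc n}. is_record X i} = (if is_record X (Suc n) then {Suc n} else {}) \<union> {i \<in> {1..n}. is_record X i}"
    by (auto simp: le_Suc_eq)
  then show ?thesis by (simp add: rec_count_def)
qed

lemma rec_count_mono: "m \<le> n \<Longrightarrow> rec_count X m \<le> rec_count X n"
  unfolding rec_count_def by (rule card_mono) auto

text \<open>The count rises by at most one per step, so at the first time it reaches
  \<open>m\<close> it equals \<open>m\<close> and that time is a record. The bound at
  \<open>n\<close> guarantees that the \<open>LEAST\<close> in \<open>record_time\<close> is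
  attained.\<close>

lemma record_time_props:
  assumes "1 \<le> m" "m \<le> rec_count X n"
  shows "record_time X m \<le> n" "is_record X (record_time X m)" "rec_count X (record_time X m) = m"
proof -
  define k where "k = (LEAST k. m \<le> rec_count X k)"
  have k: "m \<le> rec_count X k" unfolding k_def using assms(2) by (rule LeastI)
  have kn: "k \<le> n" unfolding k_def using assms(2) by (rule Least_le)
  have "k \<noteq> 0" using k assms(1) by (intro notI) simp
  then obtain k' where k': "k = Suc k'" by (cases k) auto
  have "\<not> m \<le> rec_count X k'" unfolding k_def
    by (rule not_less_Least) (use k' in \<open>simp add: k_def\<close>)
  with k have kk: "is_record X k \<and> rec_count X k = m"
    unfolding k' rec_count_Suc by (auto split: if_splits)
  have eq: "record_time X m = (LEAST k. is_record X k \<and> rec_count X k = m)"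
    unfolding record_time_def rec_count_def ..
  show "record_time X m \<le> n" unfolding eq using Least_le[of "\<lambda>k. is_record X k \<and> rec_count X k = m", OF kk] kn by simp
  from LeastI[of "\<lambda>k. is_record X k \<and> rec_count X k = m", OF kk]
  show "is_record X (record_time X m)" "rec_count X (record_time X m) = m" unfolding eq by auto
qed

context
  fixes X :: "nat \<Rightarrow> real^'d"
  assumes pos: "\<And>i j. 1 \<le> i \<Longrightarrow> 0 < X i $ j"
begin

lemma Fplus_Max: "1 \<le> n \<Longrightarrow> Fplus X n = Max ((\<lambda>i. coord_sum (X i)) ` {1..n})"
proof -
  assume n: "1 \<le> n"
  have "{i \<in> {1..n}. \<forall>j. 0 < X i $ j} = {1..n}" using pos by auto
  then show ?thesis unfolding Fplus_eq using n by simp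
qed

lemma Fplus_le_iff: "1 \<le> n \<Longrightarrow> Fplus X n \<le> x \<longleftrightarrow> (\<forall>i\<in>{1..n}. coord_sum (X i) \<le> x)"
  by (subst Fplus_Max) auto

lemma coord_sum_le_Fplus: "i \<in> {1..n} \<Longrightarrow> coord_sum (X i) \<le> Fplus X n"
  using Fplus_le_iff[of n "Fplus X n"] by auto

lemma Fplus_mono: "1 \<le> m \<Longrightarrow> m \<le> n \<Longrightarrow> Fplus X m \<le> Fplus X n"
  by (subst Fplus_le_iff) (auto intro!: coord_sum_le_Fplus)

text \<open>An observation that is not a record is strictly below an earlier one, which has a larger
  coordinate sum. Strong induction descends in this way to an index at most
  \<open>t\<close>.\<close>

lemma Fplus_eq_of_rec_count:
  assumes "1 \<le> t" "t \<le> n" "rec_count X t = rec_count X n"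
  shows "Fplus X t = Fplus X n"
proof (rule antisym)
  have norec: "\<not> is_record X i" if "t < i" "i \<le> n" for i
  proof
    assume r: "is_record X i"
    from that obtain i' where i': "i = Suc i'" by (cases i) auto
    have "rec_count X t \<le> rec_count X i'" using that i' by (intro rec_count_mono) auto
    also have "\<dots> < rec_count X i" using r unfolding i' rec_count_Suc by simp
    also have "\<dots> \<le> rec_count X n" using that by (intro rec_count_mono)
    finally show False using assms by simp
  qed
  have "coord_sum (X i) \<le> Fplus X t" if "i \<in> {1..n}" for i
    using that
  proof (induction i rule: less_induct)
    case (less i)
    show ?case
    proof (cases "i \<le> t")
      case True
      then show ?thesis using less by (intro coord_sum_le_Fplus) auto
    next
      case False
      with norec[of i] less.prems obtain k where k: "k \<in> {1..<i}" "strict_below (X i) (X k)"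
        unfolding is_record_def by auto
      have "coord_sum (X k) \<le> Fplus X t" using k less.prems by (intro less.IH) auto
      with coord_sum_strict_mono[OF k(2)] show ?thesis by simp
    qed
  qed
  then show "Fplus X n \<le> Fplus X t" using assms by (subst Fplus_le_iff) auto
qed (use assms in \<open>auto intro: Fplus_mono\<close>)

text \<open>The record with number \<open>rec_count X n\<close> is the last one up to time
  \<open>n\<close>, and the maximum does not move after it. Observation 1 is vacuously a record, so
  this number is at least 1.\<close>

lemma Ftilde_rec_count: "1 \<le> n \<Longrightarrow> Ftilde X (rec_count X n) = Fplus X n"
proof -
  assume n: "1 \<le> n"
  have "is_record X 1" by (auto simp: is_record_def)
  then have "1 \<le> rec_count X 1" using rec_count_Suc[of X 0] by simp
  also have "\<dots> \<le> rec_count X n" using n by (rule rec_count_mono)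
  finally have r: "1 \<le> rec_count X n" .
  note p = record_time_props[OF r order.refl]
  show ?thesis unfolding Ftilde_def
    using p by (intro Fplus_eq_of_rec_count) (auto simp: is_record_def)
qed

text \<open>Comparing the count at a fixed time with \<open>m\<close> decides on which side of that
  time the \<open>m\<close>-th record lies, and the frontier maximum is monotone in time.\<close>

lemma Ftilde_le: "1 \<le> m \<Longrightarrow> m \<le> rec_count X n \<Longrightarrow> Ftilde X m \<le> Fplus X n"
  using record_time_props[of m X n] unfolding Ftilde_def
  by (intro Fplus_mono) (auto simp: is_record_def)

text \<open>Either \<open>m\<close> is the count at \<open>n\<close>, or the \<open>m\<close>-th
  record comes after \<open>n\<close>; the index \<open>n'\<close> witnesses that this record
  exists.\<close>

lemma Ftilde_ge:
  assumes "1 \<le> n" "rec_count X n \<le> m" "m \<le> rec_count X n'"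
  shows "Fplus X n \<le> Ftilde X m"
proof (cases "rec_count X n = m")
  case True
  then show ?thesis using Ftilde_rec_count[OF assms(1)] by simp
next
  case False
  with assms have m: "1 \<le> m" "rec_count X n < m" by auto
  note p = record_time_props[OF m(1) assms(3)]
  have "n \<le> record_time X m"
  proof (rule ccontr)
    assume "\<not> n \<le> record_time X m"
    then have "rec_count X (record_time X m) \<le> rec_count X n" by (intro rec_count_mono) auto
    with p m show False by simp
  qed
  then show ?thesis unfolding Ftilde_def using assms(1) by (intro Fplus_mono)
qed

end


subsection \<open>The law of one observation\<close>

lemma borel_measurable_vec_nth [measurable (raw)]:
  fixes f :: "'a \<Rightarrow> real^'d"
  assumes "f \<in> borel_measurable M"
  shows "(\<lambda>x. f x $ j) \<in> borel_measurable M"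
  by (rule measurable_compose[OF assms borel_measurable_continuous_onI]) (intro continuous_intros)

lemma borel_measurable_vec_iff:
  fixes f :: "'a \<Rightarrow> real^'d"
  shows "f \<in> borel_measurable M \<longleftrightarrow> (\<forall>j. (\<lambda>x. f x $ j) \<in> borel_measurable M)"
  unfolding borel_measurable_euclidean_space[of f] by (auto simp: Basis_vec_def inner_axis)

definition exp_law :: "real measure" where
  "exp_law = density lborel (exponential_density 1)"

lemma sets_exp_law [measurable_cong, simp]: "sets exp_law = sets borel"
  and space_exp_law [simp]: "space exp_law = UNIV"
  by (simp_all add: exp_law_def)

lemma prob_space_exp_law: "prob_space exp_law"
  unfolding exp_law_def by (rule prob_space_exponential_density) simp

text \<open>The survival function of the exponential law on the whole line; \<open>max\<close> gives
  it the value 1 at negative arguments.\<close>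

definition surv :: "real \<Rightarrow> real" where
  "surv t = exp (- max 0 t)"

lemma surv_pos: "0 < surv t" and surv_le_1: "surv t \<le> 1"
  by (auto simp: surv_def)

lemma surv_measurable [measurable]: "surv \<in> borel_measurable borel"
  unfolding surv_def by measurable

lemma surv_max: "surv (max s t) = min (surv s) (surv t)"
  by (auto simp: surv_def max_def min_def)

lemma emeasure_exp_law_greaterThan: "emeasure exp_law {t<..} = ennreal (surv t)"
proof -
  interpret prob_space exp_law by (rule prob_space_exp_law)
  have "emeasure exp_law {..t} = ennreal (erlang_CDF 0 1 t)"
    unfolding exp_law_def by (subst emeasure_erlang_density) auto
  then have "prob {..t} = erlang_CDF 0 1 t"
    by (simp add: emeasure_eq_measure)
  moreover have "prob {t<..} = 1 - prob {..t}"
    using prob_compl[of "{..t}"] by (simp add: Compl_atMost[symmetric] Compl_eq_Diff_UNIV)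
  ultimately have "prob {t<..} = surv t"
    by (auto simp: erlang_CDF_0 surv_def max_def)
  then show ?thesis by (simp add: emeasure_eq_measure)
qed

lemma nn_integral_exp_law:
  assumes [measurable]: "f \<in> borel_measurable borel"
  shows "(\<integral>\<^sup>+t. f t \<partial>exp_law) = (\<integral>\<^sup>+t. ennreal (exp (- t)) * f t * indicator {0..} t \<partial>lborel)"
  unfolding exp_law_def
  by (subst nn_integral_density) (auto intro!: nn_integral_cong simp: exponential_density_def indicator_def)

lemma nn_integral_exp_decay:
  assumes "0 < (c::real)"
  shows "(\<integral>\<^sup>+t. ennreal (exp (- c * t)) * indicator {b..} t \<partial>lborel) = ennreal (exp (- c * b) / c)"
proof -
  have "((\<lambda>t. - (exp (- c * t) / c)) \<longlongrightarrow> - (0 / c)) at_top"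
    using assms by (intro tendsto_intros filterlim_compose[OF exp_at_bot])
      (auto simp: filterlim_uminus_at_bot
         intro!: filterlim_tendsto_pos_mult_at_top[OF tendsto_const] filterlim_ident)
  then have "(\<integral>\<^sup>+t. ennreal (exp (- c * t)) * indicator {b..} t \<partial>lborel) = ennreal (- (0 / c) - (- (exp (- c * b) / c)))"
    using assms by (intro nn_integral_FTC_atLeast) (auto intro!: derivative_eq_intros)
  then show ?thesis by simp
qed

text \<open>For an exponential variable \<open>t\<close> the value \<open>surv t\<close> is uniform
  on (0, 1), so this is a moment of a uniform variable. Negative orders close to -1 occur in
  \<open>exp_moment_sum_le\<close>.\<close>

lemma surv_moment:
  assumes "-1 < r"
  shows "(\<integral>\<^sup>+t. ennreal (surv t powr r) \<partial>exp_law) = ennreal (1 / (1 + r))"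
proof -
  have "(\<integral>\<^sup>+t. ennreal (surv t powr r) \<partial>exp_law)
    = (\<integral>\<^sup>+t. ennreal (exp (- (1 + r) * t)) * indicator {0..} t \<partial>lborel)"
    by (subst nn_integral_exp_law)
       (auto intro!: nn_integral_cong simp: surv_def powr_def indicator_def ennreal_mult'[symmetric]
          exp_add[symmetric] algebra_simps)
  also have "\<dots> = ennreal (1 / (1 + r))"
    using assms by (subst nn_integral_exp_decay) auto
  finally show ?thesis .
qed

text \<open>With \<open>U = surv t\<close> uniform and \<open>a = surv s\<close>, this is the mean
  of \<open>min U a * U powr (-3/2)\<close>. Because 3/2 lies strictly between 1 and 2, the parts
  below and above \<open>a\<close> are both of order \<open>a powr (1/2)\<close>, without a
  logarithm.\<close>

lemma surv_min_moment:
  "(\<integral>\<^sup>+t. ennreal (surv (max t s) * surv t powr (-3/2)) \<partial>exp_law) \<le> ennreal (4 * surv s powr (1/2))"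
proof -
  define b where "b = max 0 s"
  have b: "0 \<le> b" "surv s = exp (- b)" by (auto simp: b_def surv_def)
  have "(\<integral>\<^sup>+t. ennreal (surv (max t s) * surv t powr (-3/2)) \<partial>exp_law)
     \<le> (\<integral>\<^sup>+t. ennreal (exp (t / 2 - b)) * indicator {0..b} t + ennreal (exp (- (1/2) * t)) * indicator {b..} t \<partial>lborel)"
  proof (subst nn_integral_exp_law, measurable, rule nn_integral_mono)
    fix t :: real
    consider "t < 0" | "0 \<le> t" "t \<le> b" | "0 \<le> t" "b < t" by linarith
    then show "ennreal (exp (- t)) * ennreal (surv (max t s) * surv t powr (-3/2)) * indicator {0..} t
      \<le> ennreal (exp (t / 2 - b)) * indicator {0..b} t + ennreal (exp (- (1/2) * t)) * indicator {b..} t"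
    proof cases
      case 2
      have "exp (- t) * (surv (max t s) * surv t powr (-3/2)) = exp (- t) * (exp (- b) * exp (3/2 * t))"
        using 2 by (auto simp: surv_def powr_def b_def max_def split: if_splits)
      also have "\<dots> = exp (t / 2 - b)" by (simp add: exp_add[symmetric] field_simps)
      finally show ?thesis using 2 by (simp add: ennreal_mult'[symmetric])
    next
      case 3
      have "exp (- t) * (surv (max t s) * surv t powr (-3/2)) = exp (- t) * (exp (- t) * exp (3/2 * t))"
        using 3 by (auto simp: surv_def powr_def b_def max_def split: if_splits)
      also have "\<dots> = exp (- (1/2) * t)" by (simp add: exp_add[symmetric] field_simps)
      finally show ?thesis using 3 by (simp add: ennreal_mult'[symmetric])
    qed auto
  qed
  also have "\<dots> = (\<integral>\<^sup>+t. ennreal (exp (t / 2 - b)) * indicator {0..b} t \<partial>lborel)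
     + (\<integral>\<^sup>+t. ennreal (exp (- (1/2) * t)) * indicator {b..} t \<partial>lborel)"
    by (rule nn_integral_add) auto
  also have "(\<integral>\<^sup>+t. ennreal (exp (t / 2 - b)) * indicator {0..b} t \<partial>lborel)
     = ennreal (2 * exp (b / 2 - b) - 2 * exp (0 / 2 - b))"
    using b by (intro nn_integral_FTC_Icc)
      (auto intro!: derivative_eq_intros simp: has_real_derivative_iff_has_vector_derivative[symmetric])
  also have "\<dots> \<le> ennreal (2 * exp (- (b / 2)))"
    by (intro ennreal_leI) simp
  also have "(\<integral>\<^sup>+t. ennreal (exp (- (1/2) * t)) * indicator {b..} t \<partial>lborel) = ennreal (2 * exp (- (b / 2)))"
    by (subst nn_integral_exp_decay) auto
  also have "ennreal (2 * exp (- (b / 2))) + ennreal (2 * exp (- (b / 2))) = ennreal (4 * surv s powr (1/2))"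
    by (simp add: b powr_def ennreal_plus[symmetric] del: ennreal_plus)
  finally show ?thesis by (simp add: add_right_mono)
qed

definition vec_law :: "(real^'d) measure" where
  "vec_law = distr (PiM UNIV (\<lambda>_. exp_law)) borel (\<lambda>f. \<chi> j. f j)"

lemma sets_vec_law [measurable_cong, simp]: "sets vec_law = sets borel"
  and space_vec_law [simp]: "space vec_law = UNIV"
  by (simp_all add: vec_law_def)

lemma vec_lambda_measurable [measurable]:
  "(\<lambda>f. \<chi> j. f j) \<in> measurable (PiM UNIV (\<lambda>_::'d::finite. exp_law)) (borel :: (real^'d) measure)"
  unfolding borel_measurable_vec_iff by measurable

lemma product_prob_space_exp_law: "product_prob_space (\<lambda>_. exp_law)"
  by (intro product_prob_spaceI prob_space_exp_law)

lemma prob_space_vec_law: "prob_space (vec_law :: (real^'d) measure)"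
  unfolding vec_law_def
  by (intro prob_space.prob_space_distr vec_lambda_measurable prob_space_PiM prob_space_exp_law)

lemma nn_integral_vec_law_prod:
  fixes g :: "'d::finite \<Rightarrow> real \<Rightarrow> ennreal"
  assumes [measurable]: "\<And>j. g j \<in> borel_measurable borel"
  shows "(\<integral>\<^sup>+x. (\<Prod>j\<in>UNIV. g j (x $ j)) \<partial>vec_law) = (\<Prod>j\<in>UNIV. \<integral>\<^sup>+t. g j t \<partial>exp_law)"
proof -
  interpret product_prob_space "\<lambda>_. exp_law" UNIV by (rule product_prob_space_exp_law)
  show ?thesis
    unfolding vec_law_def
    by (subst nn_integral_distr) (simp_all add: product_nn_integral_prod)
qed

text \<open>The probability that an observation strictly dominates \<open>x\<close>; for an observation \<open>x\<close> it is a product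
  of independent uniform variables.\<close>

definition dom_prob :: "real^'d \<Rightarrow> real" where
  "dom_prob x = (\<Prod>j\<in>UNIV. surv (x $ j))"

lemma dom_prob_pos: "0 < dom_prob x"
  by (auto simp: dom_prob_def intro!: prod_pos surv_pos)

lemma dom_prob_le_1: "dom_prob x \<le> 1"
  by (auto simp: dom_prob_def intro!: prod_le_1 surv_le_1 less_imp_le[OF surv_pos])

lemma dom_prob_measurable [measurable]: "dom_prob \<in> borel_measurable borel"
  unfolding dom_prob_def by measurable

lemma strict_below_measurable [measurable]:
  assumes [measurable]: "f \<in> borel_measurable M" "g \<in> borel_measurable M"
  shows "Measurable.pred M (\<lambda>\<omega>. strict_below (f \<omega>) (g \<omega>))"
  unfolding strict_below_def by measurable

lemma emeasure_vec_law_strict_below: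
  "emeasure vec_law {z. strict_below x z} = ennreal (dom_prob x)"
proof -
  have [measurable]: "{z. strict_below x z} \<in> sets borel" by measurable
  have "emeasure vec_law {z. strict_below x z} = (\<integral>\<^sup>+z. indicator {z. strict_below x z} z \<partial>vec_law)"
    by (subst nn_integral_indicator) auto
  also have "\<dots> = (\<integral>\<^sup>+z. (\<Prod>j\<in>UNIV. indicator {x $ j<..} (z $ j)) \<partial>vec_law)"
    by (intro nn_integral_cong) (auto simp: indicator_def strict_below_def prod_zero_iff)
  also have "\<dots> = (\<Prod>j\<in>UNIV. ennreal (surv (x $ j)))"
    by (subst nn_integral_vec_law_prod) (auto simp: emeasure_exp_law_greaterThan)
  also have "\<dots> = ennreal (dom_prob x)"
    unfolding dom_prob_def by (intro prod_ennreal) (auto intro: less_imp_le[OF surv_pos])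
  finally show ?thesis .
qed

lemma dom_prob_moment:
  assumes "-1 < r"
  shows "(\<integral>\<^sup>+x. ennreal (dom_prob x powr r) \<partial>(vec_law :: (real^'d) measure)) = ennreal ((1 / (1 + r)) ^ CARD('d))"
proof -
  have "dom_prob x powr r = (\<Prod>j\<in>UNIV. surv (x $ j) powr r)" for x :: "real^'d"
    unfolding dom_prob_def by (rule prod_powr_distrib)
  then have "(\<integral>\<^sup>+x. ennreal (dom_prob x powr r) \<partial>(vec_law :: (real^'d) measure))
    = (\<integral>\<^sup>+x. (\<Prod>j\<in>UNIV. ennreal (surv (x $ j) powr r)) \<partial>(vec_law :: (real^'d) measure))"
    by (simp add: prod_ennreal)
  also have "\<dots> = ennreal (1 / (1 + r)) ^ CARD('d)"
    by (subst nn_integral_vec_law_prod) (use assms in \<open>auto simp: surv_moment\<close>)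
  finally show ?thesis using assms by (simp add: ennreal_power)
qed

text \<open>The join of two points: an observation strictly dominates both exactly when it strictly
  dominates the join.\<close>

definition vec_max :: "real^'d \<Rightarrow> real^'d \<Rightarrow> real^'d" where
  "vec_max x y = (\<chi> j. max (x $ j) (y $ j))"

lemma vec_max_measurable [measurable]:
  assumes [measurable]: "f \<in> borel_measurable M" "g \<in> borel_measurable M"
  shows "(\<lambda>\<omega>. vec_max (f \<omega>) (g \<omega>)) \<in> borel_measurable M"
  unfolding borel_measurable_vec_iff vec_max_def by simp

lemma prod_mono_ennreal:
  fixes f g :: "'i \<Rightarrow> ennreal"
  shows "(\<And>i. i \<in> A \<Longrightarrow> f i \<le> g i) \<Longrightarrow> prod f A \<le> prod g A"
  by (induction A rule: infinite_finite_induct) (auto intro: mult_mono)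

text \<open>The integrand is a product over the coordinates, each factor being bounded by
  \<open>surv_min_moment\<close>.\<close>

lemma dom_prob_vec_max_moment:
  "(\<integral>\<^sup>+x. ennreal (dom_prob (vec_max x v) * dom_prob x powr (-3/2)) \<partial>(vec_law :: (real^'d) measure))
     \<le> ennreal (4 ^ CARD('d) * dom_prob v powr (1/2))"
proof -
  have nn: "0 \<le> surv t" for t by (rule less_imp_le[OF surv_pos])
  have "dom_prob (vec_max x v) * dom_prob x powr (-3/2)
     = (\<Prod>j\<in>UNIV. surv (max (x $ j) (v $ j)) * surv (x $ j) powr (-3/2))" for x :: "real^'d"
  proof -
    have "dom_prob x powr (-3/2) = (\<Prod>j\<in>UNIV. surv (x $ j) powr (-3/2))"
      unfolding dom_prob_def by (rule prod_powr_distrib)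
    then show ?thesis by (simp add: prod.distrib dom_prob_def vec_max_def)
  qed
  then have "(\<integral>\<^sup>+x. ennreal (dom_prob (vec_max x v) * dom_prob x powr (-3/2)) \<partial>(vec_law :: (real^'d) measure))
    = (\<integral>\<^sup>+x. (\<Prod>j\<in>UNIV. ennreal (surv (max (x $ j) (v $ j)) * surv (x $ j) powr (-3/2))) \<partial>(vec_law :: (real^'d) measure))"
    by (simp add: prod_ennreal nn)
  also have "\<dots> = (\<Prod>j\<in>UNIV. \<integral>\<^sup>+t. ennreal (surv (max t (v $ j)) * surv t powr (-3/2)) \<partial>exp_law)"
    by (rule nn_integral_vec_law_prod) measurable
  also have "\<dots> \<le> (\<Prod>j\<in>UNIV. ennreal (4 * surv (v $ j) powr (1/2)))"
    by (intro prod_mono_ennreal surv_min_moment)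
  also have "\<dots> = ennreal (\<Prod>j\<in>UNIV. 4 * surv (v $ j) powr (1/2))"
    by (intro prod_ennreal) auto
  also have "(\<Prod>j\<in>UNIV. 4 * surv (v $ j) powr (1/2)) = 4 ^ CARD('d) * dom_prob v powr (1/2)"
    unfolding dom_prob_def by (subst prod_powr_distrib) (auto simp: prod.distrib nn)
  finally show ?thesis .
qed

text \<open>The last inequality says that dominating \<open>u\<close> and dominating
  \<open>v\<close> are positively correlated; in each coordinate it is
  \<open>s * t <= min s t\<close> for numbers in the unit interval.\<close>

lemma dom_prob_vec_max:
  "dom_prob (vec_max u v) \<le> dom_prob u" "dom_prob (vec_max u v) \<le> dom_prob v"
  "dom_prob u * dom_prob v \<le> dom_prob (vec_max u v)"
proof -
  have nn: "0 \<le> surv t" for t by (rule less_imp_le[OF surv_pos])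
  show "dom_prob (vec_max u v) \<le> dom_prob u" "dom_prob (vec_max u v) \<le> dom_prob v"
    unfolding dom_prob_def vec_max_def by (intro prod_mono; simp add: surv_max nn)+
  have "surv s * surv t \<le> min (surv s) (surv t)" for s t
    using mult_left_le[of "surv t" "surv s"] mult_left_le[of "surv s" "surv t"] nn surv_le_1
    by (auto simp: mult.commute)
  then show "dom_prob u * dom_prob v \<le> dom_prob (vec_max u v)"
    unfolding dom_prob_def vec_max_def prod.distrib[symmetric]
    by (intro prod_mono) (auto simp: surv_max nn)
qed

lemma measure_not_below:
  fixes v :: "real^'d"
  shows "emeasure vec_law {z. \<not> strict_below v z} = ennreal (1 - dom_prob v)"
proof -
  interpret prob_space "vec_law :: (real^'d) measure" by (rule prob_space_vec_law)
  have [measurable]: "{z. strict_below v z} \<in> sets borel" by measurable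
  have "prob (UNIV - {z. strict_below v z}) = 1 - prob {z. strict_below v z}"
    using prob_compl[of "{z. strict_below v z}"] by simp
  also have "prob {z. strict_below v z} = dom_prob v"
    using emeasure_vec_law_strict_below[of v] less_imp_le[OF dom_prob_pos, of v]
    by (simp add: emeasure_eq_measure)
  also have "UNIV - {z. strict_below v z} = {z. \<not> strict_below v z}" by auto
  finally show ?thesis by (simp add: emeasure_eq_measure)
qed

lemma measure_not_below2:
  fixes u v :: "real^'d"
  shows "emeasure vec_law {z. \<not> strict_below u z \<and> \<not> strict_below v z}
     = ennreal (1 - dom_prob u - dom_prob v + dom_prob (vec_max u v))"
proof -
  interpret prob_space "vec_law :: (real^'d) measure" by (rule prob_space_vec_law)
  let ?U = "{z. strict_below u z}" and ?V = "{z. strict_below v z}"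
  have [measurable]: "?U \<in> sets borel" "?V \<in> sets borel" by measurable
  have q: "prob {z. strict_below x z} = dom_prob x" for x :: "real^'d"
    using emeasure_vec_law_strict_below[of x] less_imp_le[OF dom_prob_pos, of x]
    by (simp add: emeasure_eq_measure)
  have "?U \<inter> ?V = {z. strict_below (vec_max u v) z}"
    by (auto simp: strict_below_def vec_max_def)
  then have "prob (?U \<union> ?V) = dom_prob u + dom_prob v - dom_prob (vec_max u v)"
    using finite_measure_Union'[of ?U ?V] finite_measure_Diff'[of ?V ?U] by (simp add: q Int_commute)
  moreover have "prob (UNIV - (?U \<union> ?V)) = 1 - prob (?U \<union> ?V)"
    using prob_compl[of "?U \<union> ?V"] by simp
  moreover have "UNIV - (?U \<union> ?V) = {z. \<not> strict_below u z \<and> \<not> strict_below v z}" by auto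
  ultimately have "prob {z. \<not> strict_below u z \<and> \<not> strict_below v z}
      = 1 - dom_prob u - dom_prob v + dom_prob (vec_max u v)" by simp
  then show ?thesis by (simp add: emeasure_eq_measure)
qed


subsection \<open>Record probabilities\<close>

text \<open>The argument \<open>n\<close> counts the earlier observations: this is the probability
  that observation \<open>n + 1\<close> is a record. The type argument carries the
  dimension.\<close>

definition rec_prob :: "'d::finite itself \<Rightarrow> nat \<Rightarrow> real" where
  "rec_prob _ n = (\<integral>x. (1 - dom_prob (x :: real^'d)) ^ n \<partial>vec_law)"

lemma integrable_vec_law_bounded:
  fixes f :: "real^'d \<Rightarrow> real"
  assumes [measurable]: "f \<in> borel_measurable borel" and "\<And>x. 0 \<le> f x" "\<And>x. f x \<le> 1"
  shows "integrable vec_law f"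
proof -
  interpret prob_space "vec_law :: (real^'d) measure" by (rule prob_space_vec_law)
  show ?thesis using assms by (intro integrable_const_bound[where B = 1]) auto
qed

lemma one_minus_dom_prob: "0 \<le> 1 - dom_prob x" "1 - dom_prob x \<le> 1"
  using dom_prob_pos[of x] dom_prob_le_1[of x] by auto

lemma one_minus_dom_prob_power: "0 \<le> (1 - dom_prob x) ^ n" "(1 - dom_prob x) ^ n \<le> 1"
  using one_minus_dom_prob[of x] by (auto intro: power_le_one)

lemma nn_integral_rec_prob:
  "(\<integral>\<^sup>+x. ennreal ((1 - dom_prob (x :: real^'d)) ^ n) \<partial>vec_law) = ennreal (rec_prob TYPE('d) n)"
  unfolding rec_prob_def
  by (intro nn_integral_eq_integral integrable_vec_law_bounded) (auto simp: one_minus_dom_prob_power)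

lemma rec_prob_nonneg: "0 \<le> rec_prob TYPE('d::finite) n"
  and rec_prob_le_1: "rec_prob TYPE('d::finite) n \<le> 1"
proof -
  interpret prob_space "vec_law :: (real^'d) measure" by (rule prob_space_vec_law)
  show "0 \<le> rec_prob TYPE('d::finite) n"
    unfolding rec_prob_def by (intro Bochner_Integration.integral_nonneg) (auto simp: one_minus_dom_prob_power)
  show "rec_prob TYPE('d::finite) n \<le> 1"
    unfolding rec_prob_def
    by (intro integral_le_const integrable_vec_law_bounded) (auto simp: one_minus_dom_prob_power)
qed

text \<open>Integrates \<open>(1 - q) ^ n - (1 - q) ^ (n + 1) = q * (1 - q) ^ n\<close>. It
  identifies one term of the covariance bound as a difference that telescopes.\<close>

lemma rec_prob_Suc_diff:
  "(\<integral>x. dom_prob (x :: real^'d) * (1 - dom_prob x) ^ n \<partial>vec_law)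
     = rec_prob TYPE('d) n - rec_prob TYPE('d) (Suc n)"
  unfolding rec_prob_def
  by (subst Bochner_Integration.integral_diff [symmetric])
     (auto intro!: integrable_vec_law_bounded Bochner_Integration.integral_cong
       simp: one_minus_dom_prob_power one_minus_dom_prob algebra_simps simp del: power_Suc intro: power_le_one,
      simp_all add: algebra_simps)

lemma rec_prob_decreasing: "rec_prob TYPE('d::finite) (Suc n) \<le> rec_prob TYPE('d) n"
proof -
  have "0 \<le> (\<integral>x. dom_prob (x :: real^'d) * (1 - dom_prob x) ^ n \<partial>vec_law)"
    by (intro Bochner_Integration.integral_nonneg) (auto simp: one_minus_dom_prob_power less_imp_le[OF dom_prob_pos])
  then show ?thesis using rec_prob_Suc_diff[where 'd = 'd, of n] by simp
qed

text \<open>Expanding \<open>(1 - q) ^ n\<close> by the binomial theorem and inserting the moments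
  \<open>(i + 1) ^ (- d)\<close> of \<open>q\<close> gives the alternating sum already
  evaluated.\<close>

lemma rec_prob_eq_hs: "rec_prob TYPE('d::finite) n = hs (CARD('d) - 1) (Suc n) / real (Suc n)"
proof -
  have int: "(\<integral>x. dom_prob (x :: real^'d) ^ i \<partial>vec_law) = 1 / real (Suc i) ^ CARD('d)" for i
  proof -
    have "(\<integral>\<^sup>+x. ennreal (dom_prob (x :: real^'d) powr real i) \<partial>vec_law) = ennreal ((1 / (1 + real i)) ^ CARD('d))"
      by (rule dom_prob_moment) simp
    then show ?thesis
      by (intro integral_eq_nn_integral[THEN trans])
         (auto simp: powr_realpow dom_prob_pos power_one_over less_imp_le[OF dom_prob_pos] add.commute)
  qed
  have "rec_prob TYPE('d) n = (\<integral>x. (\<Sum>i\<le>n. (-1) ^ i * real (n choose i) * dom_prob (x :: real^'d) ^ i) \<partial>vec_law)"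
  proof -
    have "(1 - dom_prob x) ^ n = (\<Sum>i\<le>n. (-1) ^ i * real (n choose i) * dom_prob x ^ i)" for x :: "real^'d"
      using binomial_ring[of "- dom_prob x" 1 n]
      by (simp add: power_minus' mult_ac power_minus[of "dom_prob x"])
    then show ?thesis by (simp add: rec_prob_def)
  qed
  also have "\<dots> = (\<Sum>i\<le>n. (-1) ^ i * real (n choose i) * (1 / real (Suc i) ^ CARD('d)))"
    by (subst Bochner_Integration.integral_sum)
       (auto intro!: integrable_mult_right integrable_vec_law_bounded simp: int
         less_imp_le[OF dom_prob_pos] dom_prob_le_1 power_le_one)
  also have "\<dots> = alt_binom_sum (Suc (CARD('d) - 1)) n"
    by (simp add: alt_binom_sum_def)
  also have "\<dots> = hs (CARD('d) - 1) (Suc n) / real (Suc n)" by (rule alt_binom_sum_eq_hs)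
  finally show ?thesis .
qed

lemma sum_rec_prob: "(\<Sum>k=1..n. rec_prob TYPE('d::finite) (k - 1)) = hs CARD('d) n"
proof -
  obtain e where e: "CARD('d) = Suc e" using zero_less_card_finite[where 'a='d] by (metis Suc_pred)
  have "(\<Sum>k=1..n. rec_prob TYPE('d::finite) (k - 1)) = (\<Sum>k=1..n. hs e k / real k)"
    by (intro sum.cong) (auto simp: rec_prob_eq_hs e)
  then show ?thesis by (simp add: e)
qed

section \<open>The random sample and its record events\<close>

locale exp_sample = prob_space M for M :: "'a measure" +
  fixes X :: "nat \<Rightarrow> 'a \<Rightarrow> real^'d"
  assumes indep_coords: "indep_vars (\<lambda>_. borel) (\<lambda>p \<omega>. X (fst p) \<omega> $ snd p) ({1..} \<times> UNIV)"
    and exp_coords: "\<And>i j. 1 \<le> i \<Longrightarrow> distributed M lborel (\<lambda>\<omega>. X i \<omega> $ j) (exponential_density 1)"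
begin

lemma X_measurable: "1 \<le> i \<Longrightarrow> X i \<in> borel_measurable M"
  unfolding borel_measurable_vec_iff using distributed_measurable[OF exp_coords] by auto

lemma indep_X: "indep_vars (\<lambda>_. borel) X {1..}"
proof -
  have "indep_vars (\<lambda>i. PiM ({i} \<times> UNIV) (\<lambda>_. borel))
     (\<lambda>i \<omega>. restrict (\<lambda>p. X (fst p) \<omega> $ snd p) ({i} \<times> UNIV)) {1..}"
    by (rule indep_vars_restrict[OF indep_coords]) (auto simp: disjoint_family_on_def)
  then have "indep_vars (\<lambda>_. borel)
     (\<lambda>i \<omega>. (\<lambda>f. \<chi> j. f (i, j)) (restrict (\<lambda>p. X (fst p) \<omega> $ snd p) ({i} \<times> UNIV))) {1..}"
    by (rule indep_vars_compose2) (auto simp: borel_measurable_vec_iff)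
  moreover have "(\<lambda>f. \<chi> j. f (i, j)) (restrict (\<lambda>p. X (fst p) \<omega> $ snd p) ({i} \<times> UNIV)) = X i \<omega>" for i \<omega>
    by (simp add: vec_eq_iff)
  ultimately show ?thesis by simp
qed

lemma indep_coord: "1 \<le> i \<Longrightarrow> indep_vars (\<lambda>_. borel) (\<lambda>j \<omega>. X i \<omega> $ j) UNIV"
proof -
  assume i: "1 \<le> i"
  have "indep_vars (\<lambda>j. PiM {(i, j)} (\<lambda>_. borel))
     (\<lambda>j \<omega>. restrict (\<lambda>p. X (fst p) \<omega> $ snd p) {(i, j)}) UNIV"
    by (rule indep_vars_restrict[OF indep_coords]) (use i in \<open>auto simp: disjoint_family_on_def\<close>)
  then have "indep_vars (\<lambda>_. borel)
     (\<lambda>j \<omega>. (\<lambda>f. f (i, j)) (restrict (\<lambda>p. X (fst p) \<omega> $ snd p) {(i, j)})) UNIV"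
    by (rule indep_vars_compose2) auto
  then show ?thesis by simp
qed

lemma distr_X: "1 \<le> i \<Longrightarrow> distr M borel (X i) = vec_law"
proof -
  assume i: "1 \<le> i"
  have rv: "(\<lambda>\<omega>. X i \<omega> $ j) \<in> borel_measurable M" for j
    using X_measurable[OF i] by measurable
  have law: "distr M borel (\<lambda>\<omega>. X i \<omega> $ j) = exp_law" for j
    using distributed_distr_eq_density[OF exp_coords[OF i, of j]]
    by (simp add: exp_law_def cong: distr_cong)
  have "distr M (PiM UNIV (\<lambda>_. borel)) (\<lambda>\<omega>. \<lambda>j\<in>UNIV. X i \<omega> $ j) = PiM UNIV (\<lambda>j. distr M borel (\<lambda>\<omega>. X i \<omega> $ j))"
    using indep_vars_iff_distr_eq_PiM'[where I = UNIV and M' = "\<lambda>_. borel" and X = "\<lambda>j \<omega>. X i \<omega> $ j"] indep_coord[OF i] rv by auto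
  then have *: "PiM UNIV (\<lambda>_. exp_law) = distr M (PiM UNIV (\<lambda>_. borel)) (\<lambda>\<omega> j. X i \<omega> $ j)"
    by (simp add: law restrict_def)
  have [measurable]: "(\<lambda>f. \<chi> j. f j) \<in> measurable (PiM UNIV (\<lambda>_::'d. borel)) (borel :: (real^'d) measure)"
    unfolding borel_measurable_vec_iff by measurable
  have [measurable]: "(\<lambda>\<omega> j. X i \<omega> $ j) \<in> measurable M (PiM UNIV (\<lambda>_::'d. borel))"
    using rv by (intro measurable_PiM_single') auto
  show ?thesis
    unfolding vec_law_def * by (subst distr_distr) (auto simp: comp_def)
qed

lemma distr_PiM_X:
  assumes "K \<noteq> {}" "K \<subseteq> {1..}"
  shows "distr M (PiM K (\<lambda>_. borel)) (\<lambda>\<omega>. \<lambda>i\<in>K. X i \<omega>) = PiM K (\<lambda>_. vec_law)"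
proof -
  have "distr M (PiM K (\<lambda>_. borel)) (\<lambda>\<omega>. \<lambda>i\<in>K. X i \<omega>) = PiM K (\<lambda>i. distr M borel (X i))"
    using indep_vars_iff_distr_eq_PiM'[where I = K and M' = "\<lambda>_. borel" and X = X] indep_vars_subset[OF indep_X assms(2)] assms X_measurable
    by (auto simp: subset_eq)
  also have "\<dots> = PiM K (\<lambda>_. vec_law)"
    using assms by (intro PiM_cong) (auto simp: distr_X subset_eq)
  finally show ?thesis .
qed

text \<open>Moves an event about finitely many observations to a product measure, where coordinates
  can be integrated out one at a time.\<close>

lemma emeasure_PiM_X:
  assumes "K \<noteq> {}" "K \<subseteq> {1..}" "B \<in> sets (PiM K (\<lambda>_. vec_law))"
  shows "emeasure M {\<omega> \<in> space M. (\<lambda>i\<in>K. X i \<omega>) \<in> B} = emeasure (PiM K (\<lambda>_. vec_law)) B"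
proof -
  have [measurable]: "(\<lambda>\<omega>. \<lambda>i\<in>K. X i \<omega>) \<in> measurable M (PiM K (\<lambda>_. borel))"
    using assms X_measurable by (intro measurable_restrict) (auto simp: subset_eq)
  have "sets (PiM K (\<lambda>_. vec_law :: (real^'d) measure)) = sets (PiM K (\<lambda>_. borel))"
    by (intro sets_PiM_cong) auto
  with assms have B: "B \<in> sets (PiM K (\<lambda>_. borel))" by simp
  show ?thesis
    unfolding distr_PiM_X[OF assms(1,2), symmetric]
    by (subst emeasure_distr[OF _ B]) (auto intro!: arg_cong[where f = "emeasure M"])
qed

sublocale law: product_prob_space "\<lambda>_::nat. vec_law :: (real^'d) measure" UNIV
  by (intro product_prob_spaceI prob_space_vec_law)

lemma is_record_measurable [measurable]:
  "Measurable.pred M (\<lambda>\<omega>. is_record (\<lambda>i. X i \<omega>) k)"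
proof (cases "1 \<le> k")
  case True
  have "Measurable.pred M (\<lambda>\<omega>. strict_below (X k \<omega>) (X i \<omega>))" if "i \<in> {1..<k}" for i
    using that True X_measurable by (intro strict_below_measurable) auto
  then have "Measurable.pred M (\<lambda>\<omega>. \<forall>i\<in>{1..<k}. \<not> strict_below (X k \<omega>) (X i \<omega>))"
    by (intro pred_intros_finite) auto
  then show ?thesis by (simp add: is_record_def True)
qed (simp add: is_record_def)

definition Rec :: "nat \<Rightarrow> 'a set" where
  "Rec k = {\<omega> \<in> space M. is_record (\<lambda>i. X i \<omega>) k}"

lemma Rec_sets [measurable]: "Rec k \<in> sets M"
  unfolding Rec_def by measurable

text \<open>Given the value \<open>y\<close> of observation \<open>k\<close>, the
  \<open>k - 1\<close> earlier ones independently fail to dominate \<open>y\<close>, each with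
  probability \<open>1 - dom_prob y\<close>.\<close>

lemma prob_Rec:
  assumes "1 \<le> k"
  shows "prob (Rec k) = rec_prob TYPE('d) (k - 1)"
proof -
  let ?P = "PiM {1..k} (\<lambda>_. vec_law :: (real^'d) measure)"
  have ins: "{1..k} = insert k {1..<k}" using assms by auto
  define B where "B = {f \<in> space ?P. \<forall>i\<in>{1..<k}. \<not> strict_below (f k) (f i)}"
  have comp[measurable]: "(\<lambda>f. f i) \<in> borel_measurable ?P" if "i \<in> {1..k}" for i
    using that measurable_component_singleton[of i "{1..k}" "\<lambda>_. vec_law :: (real^'d) measure"] by simp
  have "Measurable.pred ?P (\<lambda>f. \<forall>i\<in>{1..<k}. \<not> strict_below (f k) (f i))"
    using assms by (intro pred_intros_finite pred_intros_logic strict_below_measurable comp) auto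
  then have B: "B \<in> sets ?P" unfolding B_def by measurable
  have "Rec k = {\<omega> \<in> space M. (\<lambda>i\<in>{1..k}. X i \<omega>) \<in> B}"
    using assms by (auto simp: Rec_def B_def is_record_def space_PiM)
  then have "emeasure M (Rec k) = emeasure ?P B"
    using emeasure_PiM_X[of "{1..k}" B] assms B by auto
  also have "\<dots> = (\<integral>\<^sup>+f. indicator B f \<partial>?P)" using B by simp
  also have "\<dots> = (\<integral>\<^sup>+y. (\<integral>\<^sup>+x. indicator B (x(k := y)) \<partial>(PiM {1..<k} (\<lambda>_. vec_law))) \<partial>vec_law)"
    using B unfolding ins by (intro law.product_nn_integral_insert_rev) auto
  also have "\<dots> = (\<integral>\<^sup>+y. ennreal ((1 - dom_prob (y :: real^'d)) ^ (k - 1)) \<partial>vec_law)"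
  proof (intro nn_integral_cong)
    fix y :: "real^'d"
    have [measurable]: "{z. \<not> strict_below y z} \<in> sets borel" by measurable
    have "(\<integral>\<^sup>+x. indicator B (x(k := y)) \<partial>(PiM {1..<k} (\<lambda>_. vec_law)))
      = (\<integral>\<^sup>+x. indicator (PiE {1..<k} (\<lambda>_. {z. \<not> strict_below y z})) x \<partial>(PiM {1..<k} (\<lambda>_. vec_law)))"
      by (intro nn_integral_cong)
         (use assms in \<open>auto simp: indicator_def B_def space_PiM PiE_def Pi_def extensional_def\<close>)
    also have "\<dots> = emeasure (PiM {1..<k} (\<lambda>_. vec_law)) (PiE {1..<k} (\<lambda>_. {z. \<not> strict_below y z}))"
      by (intro nn_integral_indicator sets_PiM_I_finite) auto
    also have "\<dots> = (\<Prod>i\<in>{1..<k}. ennreal (1 - dom_prob y))"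
      by (subst law.emeasure_PiM) (auto simp: measure_not_below)
    also have "\<dots> = ennreal ((1 - dom_prob y) ^ (k - 1))"
      by (simp add: ennreal_power dom_prob_le_1)
    finally show "(\<integral>\<^sup>+x. indicator B (x(k := y)) \<partial>(PiM {1..<k} (\<lambda>_. vec_law)))
       = ennreal ((1 - dom_prob y) ^ (k - 1))" .
  qed
  also have "\<dots> = ennreal (rec_prob TYPE('d) (k - 1))" by (rule nn_integral_rec_prob)
  finally show ?thesis by (simp add: emeasure_eq_measure rec_prob_nonneg)
qed

text \<open>By inclusion-exclusion, the probability that an observation strictly dominates neither
  \<open>u\<close> nor \<open>v\<close>; see \<open>measure_not_below2\<close>.\<close>

definition dom_prob_none :: "real^'d \<Rightarrow> real^'d \<Rightarrow> real" where
  "dom_prob_none u v = 1 - dom_prob u - dom_prob v + dom_prob (vec_max u v)"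

lemma dom_prob_none_bounds:
  "(1 - dom_prob u) * (1 - dom_prob v) \<le> dom_prob_none u v"
  "dom_prob_none u v \<le> 1 - (dom_prob u + dom_prob v) / 2"
  "0 \<le> dom_prob_none u v"
proof -
  show 1: "(1 - dom_prob u) * (1 - dom_prob v) \<le> dom_prob_none u v"
    using dom_prob_vec_max[where u = u and v = v] by (simp add: dom_prob_none_def algebra_simps)
  show "dom_prob_none u v \<le> 1 - (dom_prob u + dom_prob v) / 2"
    using dom_prob_vec_max[where u = u and v = v] by (simp add: dom_prob_none_def field_simps)
  show "0 \<le> dom_prob_none u v"
    using 1 mult_nonneg_nonneg[OF one_minus_dom_prob(1)[of u] one_minus_dom_prob(1)[of v]] by linarith
qed

text \<open>Given the values \<open>u\<close> and \<open>v\<close> of observations \<open>j\<close>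
  and \<open>k\<close>, the first \<open>j - 1\<close> observations must dominate neither value and
  the \<open>k - j - 1\<close> between them must not dominate \<open>v\<close>. These requirements
  are independent.\<close>

lemma prob_Rec_Int_le:
  assumes "1 \<le> j" "j < k"
  shows "ennreal (prob (Rec j \<inter> Rec k))
    \<le> (\<integral>\<^sup>+v. \<integral>\<^sup>+u. ennreal (dom_prob_none u v ^ (j - 1) * (1 - dom_prob v) ^ (k - j - 1)) \<partial>vec_law \<partial>vec_law)"
proof -
  let ?P = "PiM {1..k} (\<lambda>_. vec_law :: (real^'d) measure)"
  let ?J = "{1..<k} - {j}"
  have ins: "{1..k} = insert k (insert j ?J)" using assms by auto
  \<comment> \<open>The requirement that observation \<open>j\<close> does not dominate observation
    \<open>k\<close> is dropped. This couples \<open>u\<close> and \<open>v\<close> only through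
    \<open>dom_prob_none\<close>, and it is why the result is an inequality.\<close>
  define B where "B = {f \<in> space ?P. (\<forall>i\<in>{1..<j}. \<not> strict_below (f j) (f i)) \<and> (\<forall>i\<in>?J. \<not> strict_below (f k) (f i))}"
  have comp[measurable]: "(\<lambda>f. f i) \<in> borel_measurable ?P" if "i \<in> {1..k}" for i
    using that measurable_component_singleton[of i "{1..k}" "\<lambda>_. vec_law :: (real^'d) measure"] by simp
  have "Measurable.pred ?P (\<lambda>f. (\<forall>i\<in>{1..<j}. \<not> strict_below (f j) (f i)) \<and> (\<forall>i\<in>?J. \<not> strict_below (f k) (f i)))"
    using assms by (intro pred_intros_finite pred_intros_logic strict_below_measurable comp) auto
  then have B: "B \<in> sets ?P" unfolding B_def by measurable
  have B': "indicator B \<in> borel_measurable (PiM (insert k (insert j ?J)) (\<lambda>_. vec_law :: (real^'d) measure))"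
    using B unfolding ins by simp
  have "Rec j \<inter> Rec k \<subseteq> {\<omega> \<in> space M. (\<lambda>i\<in>{1..k}. X i \<omega>) \<in> B}"
    using assms by (auto simp: Rec_def B_def is_record_def space_PiM)
  moreover have "{\<omega> \<in> space M. (\<lambda>i\<in>{1..k}. X i \<omega>) \<in> B} \<in> sets M"
  proof -
    have "(\<lambda>\<omega>. \<lambda>i\<in>{1..k}. X i \<omega>) \<in> measurable M ?P"
      using X_measurable by (intro measurable_restrict) auto
    then show ?thesis using B by measurable
  qed
  ultimately have "ennreal (prob (Rec j \<inter> Rec k)) \<le> emeasure M {\<omega> \<in> space M. (\<lambda>i\<in>{1..k}. X i \<omega>) \<in> B}"
    by (auto simp: emeasure_eq_measure intro!: finite_measure_mono)
  also have "\<dots> = emeasure ?P B"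
    using emeasure_PiM_X[of "{1..k}" B] assms B by auto
  also have "\<dots> = (\<integral>\<^sup>+f. indicator B f \<partial>?P)" using B by simp
  also have "\<dots> = (\<integral>\<^sup>+v. (\<integral>\<^sup>+x. indicator B (x(k := v)) \<partial>(PiM (insert j ?J) (\<lambda>_. vec_law))) \<partial>vec_law)"
    unfolding ins using assms by (intro law.product_nn_integral_insert_rev B') auto
  also have "\<dots> = (\<integral>\<^sup>+v. \<integral>\<^sup>+u. (\<integral>\<^sup>+x. indicator B (x(j := u, k := v)) \<partial>(PiM ?J (\<lambda>_. vec_law))) \<partial>vec_law \<partial>vec_law)"
  proof (intro nn_integral_cong)
    fix v :: "real^'d"
    have "(\<lambda>x. x(k := v)) \<in> measurable (PiM (insert j ?J) (\<lambda>_. vec_law)) (PiM (insert k (insert j ?J)) (\<lambda>_. vec_law))"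
      by (rule measurable_fun_upd[where J = "insert j ?J"]) auto
    then have "(\<lambda>x. indicator B (x(k := v)) :: ennreal) \<in> borel_measurable (PiM (insert j ?J) (\<lambda>_. vec_law))"
      by (rule measurable_compose[OF _ B'])
    then show "(\<integral>\<^sup>+x. indicator B (x(k := v)) \<partial>(PiM (insert j ?J) (\<lambda>_. vec_law)))
       = (\<integral>\<^sup>+u. (\<integral>\<^sup>+x. indicator B (x(j := u, k := v)) \<partial>(PiM ?J (\<lambda>_. vec_law))) \<partial>vec_law)"
      by (intro law.product_nn_integral_insert_rev) auto
  qed
  also have "\<dots> = (\<integral>\<^sup>+v. \<integral>\<^sup>+u. ennreal (dom_prob_none u v ^ (j - 1) * (1 - dom_prob v) ^ (k - j - 1)) \<partial>vec_law \<partial>vec_law)"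
  proof (intro nn_integral_cong)
    fix u v :: "real^'d"
    define C where "C i = (if i < j then {z. \<not> strict_below u z \<and> \<not> strict_below v z} else {z. \<not> strict_below v z})" for i
    have [measurable]: "{z. \<not> strict_below u z \<and> \<not> strict_below v z} \<in> sets borel"
      "{z. \<not> strict_below v z} \<in> sets borel" by measurable
    then have C[measurable]: "C i \<in> sets borel" for i
      by (simp add: C_def)
    have "(\<integral>\<^sup>+x. indicator B (x(j := u, k := v)) \<partial>(PiM ?J (\<lambda>_. vec_law)))
      = (\<integral>\<^sup>+x. indicator (PiE ?J C) x \<partial>(PiM ?J (\<lambda>_. vec_law)))"
    proof (intro nn_integral_cong)
      fix x assume x: "x \<in> space (PiM ?J (\<lambda>_. vec_law :: (real^'d) measure))"
      then have sp: "x(j := u, k := v) \<in> space ?P"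
        using assms by (auto simp: space_PiM PiE_def extensional_def)
      have "x(j := u, k := v) \<in> B \<longleftrightarrow> (\<forall>i\<in>{1..<j}. \<not> strict_below u (x i)) \<and> (\<forall>i\<in>?J. \<not> strict_below v (x i))"
        unfolding B_def using sp assms by auto
      also have "\<dots> \<longleftrightarrow> (\<forall>i\<in>?J. x i \<in> C i)"
        using assms by (auto simp: C_def)
      also have "\<dots> \<longleftrightarrow> x \<in> PiE ?J C"
        using x by (auto simp: space_PiM PiE_def)
      finally show "indicator B (x(j := u, k := v)) = (indicator (PiE ?J C) x :: ennreal)"
        by (simp add: indicator_def)
    qed
    also have "\<dots> = emeasure (PiM ?J (\<lambda>_. vec_law)) (PiE ?J C)"
      by (intro nn_integral_indicator sets_PiM_I_finite) auto
    also have "\<dots> = (\<Prod>i\<in>?J. emeasure vec_law (C i))"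
      by (subst law.emeasure_PiM) auto
    also have "(\<Prod>i\<in>?J. emeasure vec_law (C i))
      = (\<Prod>i\<in>{1..<j}. emeasure vec_law (C i)) * (\<Prod>i\<in>{j<..<k}. emeasure vec_law (C i))"
    proof -
      have eq: "?J = {1..<j} \<union> {j<..<k}" using assms by auto
      show ?thesis unfolding eq by (rule prod.union_disjoint) auto
    qed
    also have "(\<Prod>i\<in>{1..<j}. emeasure vec_law (C i)) = ennreal (dom_prob_none u v ^ (j - 1))"
      by (simp add: C_def measure_not_below2 dom_prob_none_def[symmetric] ennreal_power dom_prob_none_bounds)
    also have "(\<Prod>i\<in>{j<..<k}. emeasure vec_law (C i)) = ennreal ((1 - dom_prob v) ^ (k - j - 1))"
      by (simp add: C_def measure_not_below ennreal_power dom_prob_le_1 cong: prod.cong_simp)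
    finally show "(\<integral>\<^sup>+x. indicator B (x(j := u, k := v)) \<partial>(PiM ?J (\<lambda>_. vec_law)))
      = ennreal (dom_prob_none u v ^ (j - 1) * (1 - dom_prob v) ^ (k - j - 1))"
      by (simp only: ennreal_mult[OF zero_le_power[OF dom_prob_none_bounds(3)] one_minus_dom_prob_power(1)])
  qed
  finally show ?thesis .
qed

end


subsection \<open>Covariances of the record indicators\<close>

text \<open>An exponent strictly between 1 and 2 suits both \<open>surv_min_moment\<close> and the
  later sum over \<open>j\<close>; for 3/2 the constant 1 suffices, since
  \<open>ln x <= x / 2\<close>.\<close>

lemma exp_neg_le_powr:
  assumes "0 < (x::real)"
  shows "exp (- x) \<le> x powr (-3/2)"
proof -
  have "ln (x / 2) \<le> x / 2 - 1" using assms by (intro ln_le_minus_one) auto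
  moreover have "ln 2 \<le> (2::real) - 1" by (rule ln_le_minus_one) auto
  ultimately have "3/2 * ln x \<le> x" using assms by (simp add: ln_div)
  then show ?thesis using assms by (simp add: powr_def)
qed

lemma sum_inverse_sqrt_le: "(\<Sum>j=1..n. real j powr (-1/2)) \<le> 2 * sqrt (real n)"
proof (induction n)
  case (Suc n)
  have "real (Suc n) powr (-1/2) = 1 / sqrt (real (Suc n))"
    using powr_minus_divide[of "real (Suc n)" "1/2"] powr_half_sqrt[of "real (Suc n)"] by simp
  also have "\<dots> \<le> 2 * sqrt (real (Suc n)) - 2 * sqrt (real n)"
  proof -
    have "2 * sqrt (real n) * sqrt (real (Suc n)) \<le> real n + real (Suc n)"
      using arith_geo_mean_sqrt[of "real n" "real (Suc n)"] by (simp add: real_sqrt_mult)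
    moreover have "sqrt (real (Suc n)) * sqrt (real (Suc n)) = real (Suc n)" by simp
    ultimately have "1 \<le> (2 * sqrt (real (Suc n)) - 2 * sqrt (real n)) * sqrt (real (Suc n))"
      unfolding left_diff_distrib mult.assoc by simp
    then show ?thesis by (subst pos_divide_le_eq) auto
  qed
  finally show ?case using Suc by simp
qed simp

lemma sqrt_mult_exp_le:
  assumes "0 \<le> (x::real)"
  shows "sqrt x * exp (- (x / 2)) \<le> 2 * exp (- (x / 4))"
proof -
  have "x \<le> 4 * exp (x / 2)" using exp_ge_add_one_self[of "x / 2"] assms by linarith
  also have "\<dots> = (2 * exp (x / 4))\<^sup>2" by (simp add: power2_eq_square exp_add[symmetric])
  finally have "sqrt x \<le> 2 * exp (x / 4)" by (intro real_le_lsqrt) auto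
  then have "sqrt x * exp (- (x / 2)) \<le> 2 * exp (x / 4) * exp (- (x / 2))"
    by (intro mult_right_mono) auto
  also have "\<dots> = 2 * exp (- (x / 4))" by (simp add: exp_add[symmetric] mult.assoc)
  finally show ?thesis .
qed

text \<open>The sum is at most \<open>n\<close> and, as a geometric series, at most
  \<open>4 / q\<close>; the bound is their geometric mean with weights \<open>e\<close> and
  \<open>1 - e\<close>. The second bound alone would have infinite mean when \<open>q\<close> is a
  product of uniform variables.\<close>

lemma sum_exp_le:
  assumes q: "0 < q" "q \<le> (1::real)" and e: "0 < e" "e \<le> (1::real)" and n: "1 \<le> n"
  shows "(\<Sum>k=1..n. exp (- (real k * q / 4))) \<le> 4 * real n powr e * q powr (-(1 - e))"
proof -
  let ?S = "\<Sum>k=1..n. exp (- (real k * q / 4))"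
  have S0: "0 < ?S" using n by (intro sum_pos) auto
  have "?S \<le> (\<Sum>k=1..n. 1)" using q by (intro sum_mono) auto
  then have 1: "?S \<le> real n" by simp
  have "?S \<le> 4 / q"
  proof -
    let ?r = "exp (- (q / 4))"
    have "1 + q / 4 \<le> exp (q / 4)" by (rule exp_ge_add_one_self)
    then have r: "?r * (1 + q / 4) \<le> ?r * exp (q / 4)" by (intro mult_left_mono) auto
    then have r': "?r * (q / 4) \<le> 1 - ?r" by (simp add: exp_add[symmetric] algebra_simps)
    have "?S = (\<Sum>k=1..n. ?r ^ k)" by (intro sum.cong) (simp_all add: exp_of_nat_mult[symmetric])
    also have "\<dots> = ?r * (\<Sum>k<n. ?r ^ k)"
      by (simp add: sum_distrib_left sum.atLeast1_atMost_eq)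
    finally have S: "?S = ?r * (\<Sum>k<n. ?r ^ k)" .
    have "?S * (q / 4) = (?r * (q / 4)) * (\<Sum>k<n. ?r ^ k)" unfolding S by simp
    also have "\<dots> \<le> (1 - ?r) * (\<Sum>k<n. ?r ^ k)"
      by (intro mult_right_mono r' sum_nonneg) auto
    also have "\<dots> = 1 - ?r ^ n" by (simp add: sum_gp_strict[symmetric] one_diff_power_eq)
    also have "\<dots> \<le> 1" by simp
    finally show ?thesis using q by (simp add: field_simps)
  qed
  have "?S = ?S powr e * ?S powr (1 - e)" using S0 by (simp add: powr_add[symmetric])
  also have "\<dots> \<le> real n powr e * (4 / q) powr (1 - e)"
    using 1 \<open>?S \<le> 4 / q\<close> S0 e by (intro mult_mono powr_mono2) auto
  also have "(4 / q) powr (1 - e) = 4 powr (1 - e) * q powr (-(1 - e))"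
    using powr_minus_divide[of q "1 - e"] powr_divide[of 4 q "1 - e"] q by simp
  also have "real n powr e * (4 powr (1 - e) * q powr (-(1 - e))) \<le> real n powr e * (4 powr 1 * q powr (-(1 - e)))"
    using e by (intro mult_left_mono mult_right_mono powr_mono) auto
  finally show ?thesis by (simp add: mult_ac)
qed

lemma sum_symmetric_square:
  fixes f :: "nat \<Rightarrow> nat \<Rightarrow> real"
  assumes "\<And>j k. f j k = f k j"
  shows "(\<Sum>j=1..n. \<Sum>k=1..n. f j k) = (\<Sum>k=1..n. f k k) + 2 * (\<Sum>k=1..n. \<Sum>j=1..<k. f j k)"
proof (induction n)
  case (Suc n)
  have "(\<Sum>j=1..Suc n. \<Sum>k=1..Suc n. f j k)
    = (\<Sum>j=1..n. \<Sum>k=1..n. f j k) + (\<Sum>j=1..n. f j (Suc n)) + (\<Sum>k=1..n. f (Suc n) k) + f (Suc n) (Suc n)"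
    by (simp add: sum.distrib)
  also have "(\<Sum>k=1..n. f (Suc n) k) = (\<Sum>j=1..n. f j (Suc n))" by (intro sum.cong assms) auto
  finally have *: "(\<Sum>j=1..Suc n. \<Sum>k=1..Suc n. f j k)
    = (\<Sum>j=1..n. \<Sum>k=1..n. f j k) + (\<Sum>j=1..n. f j (Suc n)) + (\<Sum>j=1..n. f j (Suc n)) + f (Suc n) (Suc n)" .
  show ?case unfolding * Suc.IH by (simp add: atLeastLessThanSuc_atLeastAtMost)
qed simp

text \<open>Summation by parts: the left side plus \<open>(\<Sum>k=1..n. p k) * p n\<close> is
  exactly the sum of the squares \<open>p k ^ 2\<close>.\<close>

lemma sum_Abel_decreasing:
  fixes p :: "nat \<Rightarrow> real"
  assumes "\<And>k. 0 \<le> p k" "\<And>k. p k \<le> 1"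
  shows "(\<Sum>k=1..n. \<Sum>j=1..<k. p j * (p (k - 1) - p k)) \<le> (\<Sum>k=1..n. p k)"
proof -
  have "(\<Sum>k=1..n. \<Sum>j=1..<k. p j * (p (k - 1) - p k)) + (\<Sum>k=1..n. p k) * p n = (\<Sum>k=1..n. p k ^ 2)"
  proof (induction n)
    case (Suc n)
    have "(\<Sum>j=1..<Suc n. p j * (p (Suc n - 1) - p (Suc n))) = (\<Sum>k=1..n. p k) * (p n - p (Suc n))"
      by (simp add: atLeastLessThanSuc_atLeastAtMost sum_distrib_right)
    then show ?case using Suc.IH by (simp add: algebra_simps power2_eq_square)
  qed simp
  moreover have "0 \<le> (\<Sum>k=1..n. p k) * p n" using assms by (intro mult_nonneg_nonneg sum_nonneg) auto
  moreover have "(\<Sum>k=1..n. p k ^ 2) \<le> (\<Sum>k=1..n. p k)"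
    using assms by (intro sum_mono) (simp add: power2_eq_square mult_left_le)
  ultimately show ?thesis by linarith
qed

text \<open>What is left of the dependence term, as an integral over the later record
  \<open>v\<close>, once the earlier record \<open>u\<close> has been integrated out.\<close>

definition exp_moment :: "'d::finite itself \<Rightarrow> nat \<Rightarrow> real" where
  "exp_moment _ k = (\<integral>v. exp (- (real k / 2 * dom_prob (v :: real^'d))) * dom_prob v powr (1/2) \<partial>vec_law)"

text \<open>Interpolating with the moment of order \<open>-(1 - e)\<close> of \<open>dom_prob\<close>, where \<open>e = 1 / harm n\<close>, loses only a
  constant because \<open>n powr e \<le> exp 1\<close>.\<close>

lemma exp_moment_sum_le:
  assumes n: "1 \<le> n"
  shows "(\<Sum>k=1..n. sqrt (real k) * exp_moment TYPE('d::finite) k) \<le> 8 * exp 1 * harm n ^ CARD('d)"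
proof -
  interpret prob_space "vec_law :: (real^'d) measure" by (rule prob_space_vec_law)
  define e :: real where "e = 1 / harm n"
  have h: "1 \<le> (harm n :: real)" using n by (rule harm_ge_1)
  have e: "0 < e" "e \<le> 1" using h n by (simp_all add: e_def divide_le_eq_1)
  have q: "0 < dom_prob v" "dom_prob v \<le> 1" for v :: "real^'d" by (rule dom_prob_pos dom_prob_le_1)+
  have bnd: "exp (- (real k / 2 * dom_prob v)) * dom_prob v powr (1/2) \<le> 1" for k and v :: "real^'d"
    using q[of v] by (intro mult_le_one) (auto intro: powr_le1)
  have int: "integrable vec_law (\<lambda>v :: real^'d. exp (- (real k / 2 * dom_prob v)) * dom_prob v powr (1/2))" for k
    by (intro integrable_vec_law_bounded bnd) auto
  have int2: "integrable vec_law (\<lambda>v :: real^'d. exp (- (real k * dom_prob v / 4)))" for k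
    by (intro integrable_vec_law_bounded) (auto simp: less_imp_le[OF q(1)])
  \<comment> \<open>The factor \<open>sqrt (k * dom_prob v)\<close> is absorbed by half of the
    exponential decay, which leaves a geometric sum in \<open>k\<close>.\<close>
  have "(\<Sum>k=1..n. sqrt (real k) * exp_moment TYPE('d) k)
     \<le> (\<Sum>k=1..n. \<integral>v. 2 * exp (- (real k * dom_prob (v :: real^'d) / 4)) \<partial>vec_law)"
  proof (rule sum_mono)
    fix k
    have "sqrt (real k) * exp_moment TYPE('d) k
      = (\<integral>v. sqrt (real k * dom_prob (v :: real^'d)) * exp (- (real k * dom_prob v / 2)) \<partial>vec_law)"
    proof -
      have "sqrt (real k) * exp_moment TYPE('d) k
        = (\<integral>v. sqrt (real k) * (exp (- (real k / 2 * dom_prob (v :: real^'d))) * dom_prob v powr (1/2)) \<partial>vec_law)"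
        by (simp add: exp_moment_def)
      also have "\<dots> = (\<integral>v. sqrt (real k * dom_prob (v :: real^'d)) * exp (- (real k * dom_prob v / 2)) \<partial>vec_law)"
        by (intro Bochner_Integration.integral_cong)
           (simp_all add: real_sqrt_mult powr_half_sqrt less_imp_le[OF q(1)])
      finally show ?thesis .
    qed
    also have "\<dots> \<le> (\<integral>v. 2 * exp (- (real k * dom_prob (v :: real^'d) / 4)) \<partial>vec_law)"
    proof (rule integral_mono)
      have "integrable vec_law (\<lambda>v :: real^'d. sqrt (real k) * (exp (- (real k / 2 * dom_prob v)) * dom_prob v powr (1/2)))"
        by (intro integrable_mult_right int)
      then show "integrable vec_law (\<lambda>v :: real^'d. sqrt (real k * dom_prob v) * exp (- (real k * dom_prob v / 2)))"
        by (simp add: real_sqrt_mult powr_half_sqrt less_imp_le[OF q(1)] mult_ac)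
      show "integrable vec_law (\<lambda>v :: real^'d. 2 * exp (- (real k * dom_prob v / 4)))"
        by (intro integrable_mult_right int2)
      show "sqrt (real k * dom_prob v) * exp (- (real k * dom_prob v / 2)) \<le> 2 * exp (- (real k * dom_prob v / 4))" for v :: "real^'d"
        by (rule sqrt_mult_exp_le) (simp add: less_imp_le[OF q(1)])
    qed
    finally show "sqrt (real k) * exp_moment TYPE('d) k \<le> (\<integral>v. 2 * exp (- (real k * dom_prob (v :: real^'d) / 4)) \<partial>vec_law)" .
  qed
  also have "\<dots> = 2 * (\<integral>v. (\<Sum>k=1..n. exp (- (real k * dom_prob (v :: real^'d) / 4))) \<partial>vec_law)"
    by (subst Bochner_Integration.integral_sum) (auto simp: int2 sum_distrib_left)
  also have "(\<integral>v. (\<Sum>k=1..n. exp (- (real k * dom_prob (v :: real^'d) / 4))) \<partial>vec_law) \<le> 4 * real n powr e * (1 / e) ^ CARD('d)"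
  proof (rule integral_real_bounded)
    have "(\<integral>\<^sup>+v. ennreal (\<Sum>k=1..n. exp (- (real k * dom_prob (v :: real^'d) / 4))) \<partial>vec_law)
      \<le> (\<integral>\<^sup>+v. ennreal (4 * real n powr e) * ennreal (dom_prob (v :: real^'d) powr (-(1 - e))) \<partial>vec_law)"
      using sum_exp_le[OF q e n]
      by (intro nn_integral_mono) (simp add: ennreal_mult'[symmetric])
    also have "\<dots> = ennreal (4 * real n powr e * (1 / e) ^ CARD('d))"
      using e by (subst nn_integral_cmult) (auto simp: dom_prob_moment ennreal_mult'[symmetric])
    finally show "(\<integral>\<^sup>+v. ennreal (\<Sum>k=1..n. exp (- (real k * dom_prob (v :: real^'d) / 4))) \<partial>vec_law) \<le> ennreal (4 * real n powr e * (1 / e) ^ CARD('d))" .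
  qed (use e in auto)
  also have "real n powr e \<le> exp 1"
  proof -
    have "ln (real n) \<le> harm n" using ln_le_harm[of n] n by (intro order_trans[OF _ ln_le_harm]) simp
    then show ?thesis using n h by (simp add: powr_def e_def field_simps)
  qed
  finally show ?thesis using e h by (simp add: e_def mult_ac)
qed

context exp_sample
begin

text \<open>The first two summands integrate to the product of the record probabilities and to a term that
  telescopes in \<open>k\<close>; only the third one reflects the dependence of the two records.\<close>

lemma dom_prob_none_power_le:
  assumes "1 \<le> j" "j < k"
  shows "dom_prob_none u v ^ (j - 1) * (1 - dom_prob v) ^ (k - j - 1)
    \<le> (1 - dom_prob u) ^ (j - 1) * (1 - dom_prob v) ^ (k - 1)
      + (1 - dom_prob u) ^ (j - 1) * (dom_prob v * (1 - dom_prob v) ^ (k - 2))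
      + exp (5/2) * real j * (dom_prob (vec_max u v) * exp (- (real j / 2 * dom_prob u))) * exp (- (real k / 2 * dom_prob v))"
proof -
  define a where "a = dom_prob u"
  define b where "b = dom_prob v"
  define A where "A = dom_prob_none u v"
  define B where "B = (1 - a) * (1 - b)"
  define s where "s = dom_prob (vec_max u v)"
  have ab: "0 < a" "a \<le> 1" "0 < b" "b \<le> 1"
    unfolding a_def b_def by (rule dom_prob_pos dom_prob_le_1)+
  have s: "0 < s" unfolding s_def by (rule dom_prob_pos)
  have A: "B \<le> A" "A \<le> 1 - (a + b) / 2" "0 \<le> A" "A - B \<le> s"
    using dom_prob_none_bounds[of u v] ab
    by (auto simp: A_def B_def a_def b_def s_def dom_prob_none_def algebra_simps)
  have B: "0 \<le> B" using ab by (simp add: B_def)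
  \<comment> \<open>\<open>B\<close> is the value that \<open>A\<close> would have if domination of
    \<open>u\<close> and of \<open>v\<close> were independent. The cost of replacing
    \<open>A\<close> by \<open>B\<close> is linear in \<open>A - B\<close>, hence in
    \<open>s\<close>.\<close>
  have "A ^ (j - 1) * (1 - b) ^ (k - j - 1) \<le> B ^ (j - 1) * (1 - b) ^ (k - j - 1)
     + real (j - 1) * A ^ (j - 1 - 1) * (A - B) * (1 - b) ^ (k - j - 1)"
    using mult_right_mono[OF power_diff_upper[OF B A(1), of "j - 1"], of "(1 - b) ^ (k - j - 1)"] ab
    by (simp add: algebra_simps)
  also have "B ^ (j - 1) * (1 - b) ^ (k - j - 1) = (1 - a) ^ (j - 1) * (1 - b) ^ (k - 2)"
  proof -
    have "j - 1 + (k - j - 1) = k - 2" using assms by simp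
    then show ?thesis by (simp only: B_def power_mult_distrib mult.assoc power_add[symmetric])
  qed
  \<comment> \<open>One factor \<open>1 - b\<close> is missing because the condition at index
    \<open>j\<close> was dropped; restoring it creates the summand that telescopes.\<close>
  also have "(1 - b) ^ (k - 2) = (1 - b) ^ (k - 1) + b * (1 - b) ^ (k - 2)"
  proof -
    have "k - 1 = Suc (k - 2)" using assms by simp
    then show ?thesis by (simp add: algebra_simps)
  qed
  also have "real (j - 1) * A ^ (j - 1 - 1) * (A - B) * (1 - b) ^ (k - j - 1)
     \<le> real j * (exp (- (real (j - 1 - 1) * ((a + b) / 2)))) * s * exp (- (real (k - j - 1) * b))"
  proof -
    have "A \<le> exp (- ((a + b) / 2))" using exp_ge_add_one_self[of "- ((a + b) / 2)"] A by linarith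
    then have "A ^ (j - 1 - 1) \<le> exp (- ((a + b) / 2)) ^ (j - 1 - 1)" using A by (intro power_mono) auto
    then have 1: "A ^ (j - 1 - 1) \<le> exp (- (real (j - 1 - 1) * ((a + b) / 2)))"
      by (simp only: exp_of_nat_mult[symmetric] mult_minus_right)
    have "1 - b \<le> exp (- b)" using exp_ge_add_one_self[of "- b"] by simp
    then have "(1 - b) ^ (k - j - 1) \<le> exp (- b) ^ (k - j - 1)" using ab by (intro power_mono) auto
    then have 2: "(1 - b) ^ (k - j - 1) \<le> exp (- (real (k - j - 1) * b))"
      by (simp only: exp_of_nat_mult[symmetric] mult_minus_right)
    show ?thesis using A ab s by (intro mult_mono 1 2) auto
  qed
  also have "\<dots> \<le> exp (5/2) * real j * (s * exp (- (real j / 2 * a))) * exp (- (real k / 2 * b))"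
  proof -
    \<comment> \<open>Rounding the exponents to \<open>j / 2\<close> and \<open>k / 2\<close> costs
      at most \<open>a + 3/2 * b\<close>, which is at most 5/2.\<close>
    have "- (real (j - 1 - 1) * ((a + b) / 2)) + - (real (k - j - 1) * b)
        \<le> 5/2 + - (real j / 2 * a) + - (real k / 2 * b)"
    proof -
      have "(real j - 2) * ((a + b) / 2) \<le> real (j - 1 - 1) * ((a + b) / 2)"
        using assms ab by (intro mult_right_mono) auto
      moreover have "(real k - real j - 1) * (b / 2) \<le> real (k - j - 1) * b"
        using assms ab by (intro mult_mono) auto
      ultimately show ?thesis using ab by (simp add: field_simps)
    qed
    then have "exp (- (real (j - 1 - 1) * ((a + b) / 2)) + - (real (k - j - 1) * b))
       \<le> exp (5/2 + - (real j / 2 * a) + - (real k / 2 * b))" by (simp only: exp_le_cancel_iff)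
    then have "exp (- (real (j - 1 - 1) * ((a + b) / 2))) * exp (- (real (k - j - 1) * b))
       \<le> exp (5/2) * exp (- (real j / 2 * a)) * exp (- (real k / 2 * b))" by (simp only: exp_add)
    then have "(real j * s) * (exp (- (real (j - 1 - 1) * ((a + b) / 2))) * exp (- (real (k - j - 1) * b)))
       \<le> (real j * s) * (exp (5/2) * exp (- (real j / 2 * a)) * exp (- (real k / 2 * b)))"
      using s by (intro mult_left_mono) auto
    then show ?thesis by (simp only: mult_ac)
  qed
  finally show ?thesis
    unfolding a_def[symmetric] b_def[symmetric] A_def[symmetric] s_def[symmetric]
    by (simp add: distrib_left)
qed

text \<open>Trading the exponential for the power -3/2 turns the integral into the one bounded by
  \<open>dom_prob_vec_max_moment\<close>.\<close>

lemma exp_dom_prob_vec_max_le: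
  assumes "1 \<le> j"
  shows "(\<integral>\<^sup>+u. ennreal (dom_prob (vec_max u v) * exp (- (real j / 2 * dom_prob u))) \<partial>(vec_law :: (real^'d) measure))
    \<le> ennreal ((real j / 2) powr (-3/2) * (4 ^ CARD('d) * dom_prob v powr (1/2)))"
proof -
  have "dom_prob (vec_max u v) * exp (- (real j / 2 * dom_prob u))
     \<le> (real j / 2) powr (-3/2) * (dom_prob (vec_max u v) * dom_prob u powr (-3/2))" for u :: "real^'d"
  proof -
    have "exp (- (real j / 2 * dom_prob u)) \<le> (real j / 2 * dom_prob u) powr (-3/2)"
      using assms dom_prob_pos[of u] by (intro exp_neg_le_powr) auto
    also have "\<dots> = (real j / 2) powr (-3/2) * dom_prob u powr (-3/2)" by (rule powr_mult)
    finally have "dom_prob (vec_max u v) * exp (- (real j / 2 * dom_prob u))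
      \<le> dom_prob (vec_max u v) * ((real j / 2) powr (-3/2) * dom_prob u powr (-3/2))"
      by (rule mult_left_mono) (rule less_imp_le[OF dom_prob_pos])
    then show ?thesis by (simp only: mult.left_commute)
  qed
  then have "(\<integral>\<^sup>+u. ennreal (dom_prob (vec_max u v) * exp (- (real j / 2 * dom_prob u))) \<partial>(vec_law :: (real^'d) measure))
    \<le> (\<integral>\<^sup>+u. ennreal ((real j / 2) powr (-3/2)) * ennreal (dom_prob (vec_max u v) * dom_prob u powr (-3/2)) \<partial>(vec_law :: (real^'d) measure))"
    by (intro nn_integral_mono) (simp only: ennreal_mult'[symmetric] powr_ge_zero ennreal_leI)
  also have "\<dots> = ennreal ((real j / 2) powr (-3/2)) * (\<integral>\<^sup>+u. ennreal (dom_prob (vec_max u v) * dom_prob u powr (-3/2)) \<partial>(vec_law :: (real^'d) measure))"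
    by (rule nn_integral_cmult) measurable
  also have "\<dots> \<le> ennreal ((real j / 2) powr (-3/2)) * ennreal (4 ^ CARD('d) * dom_prob v powr (1/2))"
    by (intro mult_left_mono dom_prob_vec_max_moment) auto
  finally show ?thesis by (simp add: ennreal_mult'[symmetric])
qed

text \<open>Shifted by one so that, for \<open>k >= 1\<close>, it is the probability of
  \<open>Rec k\<close>.\<close>

definition p :: "nat \<Rightarrow> real" where
  "p k = rec_prob TYPE('d) (k - 1)"

lemma p_bounds: "0 \<le> p k" "p k \<le> 1"
  by (simp_all add: p_def rec_prob_nonneg rec_prob_le_1)

text \<open>Integrates the three summands of \<open>dom_prob_none_power_le\<close> over
  \<open>u\<close> and \<open>v\<close>. In the last one \<open>j * (j / 2) powr (-3/2)\<close>
  gives \<open>2 powr (3/2) * j powr (-1/2)\<close>, and \<open>4 ^ CARD('d)\<close> comes from the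
  moment bound for the join.\<close>

lemma prob_Rec_Int_le_cov:
  assumes "1 \<le> j" "j < k"
  shows "prob (Rec j \<inter> Rec k) \<le> p j * p k + p j * (p (k - 1) - p k)
     + (exp (5/2) * 2 powr (3/2) * 4 ^ CARD('d)) * (real j powr (-1/2) * exp_moment TYPE('d) k)"
proof -
  interpret V: prob_space "vec_law :: (real^'d) measure" by (rule prob_space_vec_law)
  define C :: real where "C = exp (5/2) * 2 powr (3/2) * 4 ^ CARD('d)"
  have C: "0 \<le> C" by (simp add: C_def)
  have q: "0 \<le> dom_prob x" "dom_prob x \<le> 1" for x :: "real^'d"
    using dom_prob_pos[of x] dom_prob_le_1[of x] by auto
  have pw: "0 \<le> (1 - dom_prob x) ^ n" "(1 - dom_prob x) ^ n \<le> 1" for x :: "real^'d" and n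
    by (rule one_minus_dom_prob_power)+
  let ?f = "\<lambda>v :: real^'d. exp (- (real k / 2 * dom_prob v))"
  have "ennreal (prob (Rec j \<inter> Rec k))
    \<le> (\<integral>\<^sup>+v. \<integral>\<^sup>+u. ennreal (dom_prob_none u v ^ (j - 1) * (1 - dom_prob v) ^ (k - j - 1)) \<partial>vec_law \<partial>vec_law)"
    by (rule prob_Rec_Int_le[OF assms])
  also have "\<dots> \<le> (\<integral>\<^sup>+v. ennreal (p j) * (ennreal ((1 - dom_prob (v :: real^'d)) ^ (k - 1))
        + ennreal (dom_prob v * (1 - dom_prob v) ^ (k - 2)))
        + ennreal (C * real j powr (-1/2)) * ennreal (?f v * dom_prob v powr (1/2)) \<partial>vec_law)"
  proof (rule nn_integral_mono)
    fix v :: "real^'d"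
    let ?g = "ennreal ((1 - dom_prob v) ^ (k - 1)) + ennreal (dom_prob v * (1 - dom_prob v) ^ (k - 2))"
    have "(\<integral>\<^sup>+u. ennreal (dom_prob_none u v ^ (j - 1) * (1 - dom_prob v) ^ (k - j - 1)) \<partial>vec_law)
      \<le> (\<integral>\<^sup>+u. ennreal ((1 - dom_prob (u :: real^'d)) ^ (j - 1)) * ?g
          + ennreal (exp (5/2) * real j * ?f v) * ennreal (dom_prob (vec_max u v) * exp (- (real j / 2 * dom_prob u))) \<partial>vec_law)"
    proof (rule nn_integral_mono)
      fix u :: "real^'d"
      have "ennreal (dom_prob_none u v ^ (j - 1) * (1 - dom_prob v) ^ (k - j - 1))
        \<le> ennreal ((1 - dom_prob u) ^ (j - 1) * ((1 - dom_prob v) ^ (k - 1) + dom_prob v * (1 - dom_prob v) ^ (k - 2))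
          + exp (5/2) * real j * ?f v * (dom_prob (vec_max u v) * exp (- (real j / 2 * dom_prob u))))"
        using dom_prob_none_power_le[OF assms, of u v] by (intro ennreal_leI) (simp add: distrib_left mult_ac)
      also have "\<dots> = ennreal ((1 - dom_prob u) ^ (j - 1)) * ?g
          + ennreal (exp (5/2) * real j * ?f v) * ennreal (dom_prob (vec_max u v) * exp (- (real j / 2 * dom_prob u)))"
        using q pw by (simp add: ennreal_mult ennreal_plus)
      finally show "ennreal (dom_prob_none u v ^ (j - 1) * (1 - dom_prob v) ^ (k - j - 1)) \<le> \<dots>" .
    qed
    also have "\<dots> = ennreal (p j) * ?g
       + ennreal (exp (5/2) * real j * ?f v) * (\<integral>\<^sup>+u. ennreal (dom_prob (vec_max u v) * exp (- (real j / 2 * dom_prob u))) \<partial>(vec_law :: (real^'d) measure))"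
      by (subst nn_integral_add, simp, simp, subst nn_integral_multc, simp, subst nn_integral_cmult, simp)
         (simp add: nn_integral_rec_prob p_def)
    also have "\<dots> \<le> ennreal (p j) * ?g
       + ennreal (exp (5/2) * real j * ?f v) * ennreal ((real j / 2) powr (-3/2) * (4 ^ CARD('d) * dom_prob v powr (1/2)))"
      by (intro add_left_mono mult_left_mono exp_dom_prob_vec_max_le assms) auto
    also have "ennreal (exp (5/2) * real j * ?f v) * ennreal ((real j / 2) powr (-3/2) * (4 ^ CARD('d) * dom_prob v powr (1/2)))
       = ennreal (C * real j powr (-1/2)) * ennreal (?f v * dom_prob v powr (1/2))"
    proof -
      have "real j * (real j / 2) powr (-3/2) = 2 powr (3/2) * real j powr (-1/2)"
      proof -
        have "real j * (real j / 2) powr (-3/2) = 2 powr (3/2) * (real j powr 1 * real j powr (-3/2))"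
          using assms powr_minus_divide[of "2::real" "3/2"] powr_divide[of "real j" 2 "-3/2"] by simp
        also have "\<dots> = 2 powr (3/2) * real j powr (-1/2)" by (subst powr_add[symmetric]) simp
        finally show ?thesis .
      qed
      then have "exp (5/2) * real j * ?f v * ((real j / 2) powr (-3/2) * (4 ^ CARD('d) * dom_prob v powr (1/2)))
        = C * real j powr (-1/2) * (?f v * dom_prob v powr (1/2))"
        unfolding C_def by (simp add: mult_ac)
      then show ?thesis using C by (simp add: ennreal_mult'[symmetric])
    qed
    finally show "(\<integral>\<^sup>+u. ennreal (dom_prob_none u v ^ (j - 1) * (1 - dom_prob v) ^ (k - j - 1)) \<partial>vec_law)
      \<le> ennreal (p j) * ?g + ennreal (C * real j powr (-1/2)) * ennreal (?f v * dom_prob v powr (1/2))" .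
  qed
  also have "\<dots> = ennreal (p j) * (ennreal (p k) + ennreal (p (k - 1) - p k))
     + ennreal (C * real j powr (-1/2)) * ennreal (exp_moment TYPE('d) k)"
  proof -
    have "(\<integral>\<^sup>+v. ennreal (dom_prob (v :: real^'d) * (1 - dom_prob v) ^ (k - 2)) \<partial>vec_law) = ennreal (p (k - 1) - p k)"
    proof -
      have "(\<integral>\<^sup>+v. ennreal (dom_prob (v :: real^'d) * (1 - dom_prob v) ^ (k - 2)) \<partial>vec_law)
        = ennreal (\<integral>v. dom_prob (v :: real^'d) * (1 - dom_prob v) ^ (k - 2) \<partial>vec_law)"
        using q pw by (intro nn_integral_eq_integral integrable_vec_law_bounded) (auto intro: mult_le_one)
      also have "k - 1 - 1 = k - 2" "k - 1 = Suc (k - 2)" using assms by auto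
      ultimately show ?thesis unfolding rec_prob_Suc_diff p_def by simp
    qed
    moreover have "(\<integral>\<^sup>+v. ennreal (?f v * dom_prob v powr (1/2)) \<partial>vec_law) = ennreal (exp_moment TYPE('d) k)"
      unfolding exp_moment_def
      using q by (intro nn_integral_eq_integral integrable_vec_law_bounded)
        (auto intro!: mult_le_one powr_le1)
    ultimately show ?thesis
      by (subst nn_integral_add, simp, simp, subst nn_integral_cmult, simp, subst nn_integral_cmult, simp,
          subst nn_integral_add, simp, simp) (simp add: nn_integral_rec_prob p_def)
  qed
  also have "\<dots> = ennreal (p j * p k + p j * (p (k - 1) - p k) + C * real j powr (-1/2) * exp_moment TYPE('d) k)"
  proof -
    have "p k \<le> p (k - 1)"
    proof -
      have "k - 1 = Suc (k - 2)" "k - 1 - 1 = k - 2" using assms by auto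
      then show ?thesis unfolding p_def using rec_prob_decreasing[where 'd = 'd, of "k - 2"] by simp
    qed
    moreover have "0 \<le> exp_moment TYPE('d) k"
      unfolding exp_moment_def by (intro Bochner_Integration.integral_nonneg) auto
    ultimately show ?thesis
      using p_bounds[of j] p_bounds[of k] C
      by (simp add: ennreal_mult[symmetric] ennreal_plus[symmetric] distrib_left del: ennreal_plus)
         (simp add: algebra_simps)
  qed
  finally show ?thesis
    using p_bounds[of j] p_bounds[of k] p_bounds[of "k - 1"] C
    by (subst (asm) ennreal_le_iff)
       (auto simp: C_def mult_ac exp_moment_def distrib_left[symmetric]
         intro!: add_nonneg_nonneg mult_nonneg_nonneg Bochner_Integration.integral_nonneg)
qed


section \<open>Mean and mean square of the record count\<close>

definition R :: "nat \<Rightarrow> 'a \<Rightarrow> real" where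
  "R n \<omega> = real (rec_count (\<lambda>i. X i \<omega>) n)"

lemma R_eq: "\<omega> \<in> space M \<Longrightarrow> R n \<omega> = (\<Sum>k=1..n. indicator (Rec k) \<omega>)"
proof -
  assume \<omega>: "\<omega> \<in> space M"
  have "R n \<omega> = (\<Sum>k\<in>{i \<in> {1..n}. is_record (\<lambda>i. X i \<omega>) i}. 1)"
    by (simp add: R_def rec_count_def)
  also have "\<dots> = (\<Sum>k=1..n. if is_record (\<lambda>i. X i \<omega>) k then 1 else 0)"
    by (rule sum.inter_filter) simp
  also have "\<dots> = (\<Sum>k=1..n. indicator (Rec k) \<omega>)"
    using \<omega> by (intro sum.cong) (auto simp: Rec_def)
  finally show ?thesis .
qed

lemma rec_count_measurable [measurable]:
  "(\<lambda>\<omega>. rec_count (\<lambda>i. X i \<omega>) n) \<in> measurable M (count_space UNIV)"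
proof (induction n)
  case (Suc n)
  then show ?case unfolding rec_count_Suc by measurable
qed simp

lemma R_measurable [measurable]: "R n \<in> borel_measurable M"
  unfolding R_def by measurable

lemma integrable_Rec: "integrable M (\<lambda>\<omega>. indicator (Rec k) \<omega> :: real)"
  by (intro integrable_real_indicator) (auto simp: emeasure_eq_measure)

lemma integrable_Rec_Int: "integrable M (\<lambda>\<omega>. indicator (Rec j) \<omega> * indicator (Rec k) \<omega> :: real)"
  by (subst indicator_inter_arith[symmetric]) (intro integrable_real_indicator, auto simp: emeasure_eq_measure)

lemma expectation_R: "expectation (R n) = hs CARD('d) n"
proof -
  have "expectation (R n) = expectation (\<lambda>\<omega>. \<Sum>k=1..n. indicator (Rec k) \<omega>)"
    by (intro Bochner_Integration.integral_cong) (auto simp: R_eq)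
  also have "\<dots> = (\<Sum>k=1..n. prob (Rec k))"
    by (subst Bochner_Integration.integral_sum) (auto simp: integrable_Rec)
  also have "\<dots> = (\<Sum>k=1..n. rec_prob TYPE('d) (k - 1))"
    by (intro sum.cong) (auto simp: prob_Rec)
  finally show ?thesis by (simp only: sum_rec_prob)
qed

lemma integrable_R: "integrable M (R n)" and integrable_R2: "integrable M (\<lambda>\<omega>. (R n \<omega>)\<^sup>2)"
proof -
  have b: "0 \<le> R n \<omega>" "R n \<omega> \<le> real n" for \<omega>
  proof -
    have "rec_count (\<lambda>i. X i \<omega>) n \<le> card {1..n}"
      unfolding rec_count_def by (rule card_mono) auto
    then show "0 \<le> R n \<omega>" "R n \<omega> \<le> real n" by (auto simp: R_def)
  qed
  show "integrable M (R n)" using b by (intro integrable_const_bound[where B = "real n"]) auto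
  show "integrable M (\<lambda>\<omega>. (R n \<omega>)\<^sup>2)"
    using b by (intro integrable_const_bound[where B = "(real n)\<^sup>2"]) (auto intro: power_mono)
qed

lemma expectation_R2:
  "expectation (\<lambda>\<omega>. (R n \<omega>)\<^sup>2) = (\<Sum>k=1..n. p k) + 2 * (\<Sum>k=1..n. \<Sum>j=1..<k. prob (Rec j \<inter> Rec k))"
proof -
  have "expectation (\<lambda>\<omega>. (R n \<omega>)\<^sup>2)
    = expectation (\<lambda>\<omega>. \<Sum>j=1..n. \<Sum>k=1..n. indicator (Rec j) \<omega> * indicator (Rec k) \<omega>)"
    by (intro Bochner_Integration.integral_cong) (auto simp: R_eq power2_eq_square sum_product)
  also have "\<dots> = (\<Sum>j=1..n. \<Sum>k=1..n. prob (Rec j \<inter> Rec k))"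
    by (subst Bochner_Integration.integral_sum, (intro Bochner_Integration.integrable_sum integrable_Rec_Int)[],
        intro sum.cong refl, subst Bochner_Integration.integral_sum, (intro integrable_Rec_Int)[],
        intro sum.cong refl)
       (simp add: indicator_inter_arith[symmetric])
  also have "\<dots> = (\<Sum>k=1..n. prob (Rec k \<inter> Rec k)) + 2 * (\<Sum>k=1..n. \<Sum>j=1..<k. prob (Rec j \<inter> Rec k))"
    by (rule sum_symmetric_square) (simp add: Int_commute)
  also have "(\<Sum>k=1..n. prob (Rec k \<inter> Rec k)) = (\<Sum>k=1..n. p k)"
    by (intro sum.cong) (auto simp: prob_Rec p_def)
  finally show ?thesis .
qed

text \<open>The products \<open>p j * p k\<close> cancel against the squared mean. The diagonal
  contributes the mean once and the telescoping terms contribute it twice, hence the 3. In the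
  dependence terms the sum of \<open>j powr (-1/2)\<close> over \<open>j < k\<close> supplies the
  \<open>sqrt k\<close> of \<open>exp_moment_sum_le\<close>.\<close>

lemma R_second_moment_le:
  "\<exists>C\<ge>0. \<forall>n\<ge>1. expectation (\<lambda>\<omega>. (R n \<omega>)\<^sup>2) - (hs CARD('d) n)\<^sup>2
     \<le> 3 * hs CARD('d) n + C * harm n ^ CARD('d)"
proof -
  define c :: real where "c = exp (5/2) * 2 powr (3/2) * 4 ^ CARD('d)"
  have c: "0 \<le> c" by (simp add: c_def)
  have em: "0 \<le> exp_moment TYPE('d) k" for k
    unfolding exp_moment_def by (intro Bochner_Integration.integral_nonneg) auto
  have sum_p: "(\<Sum>k=1..n. p k) = hs CARD('d) n" for n
    unfolding p_def by (rule sum_rec_prob)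
  have main: "expectation (\<lambda>\<omega>. (R n \<omega>)\<^sup>2) - (hs CARD('d) n)\<^sup>2
     \<le> 3 * hs CARD('d) n + (32 * c * exp 1) * harm n ^ CARD('d)" if n: "1 \<le> n" for n
  proof -
    have "(\<Sum>k=1..n. \<Sum>j=1..<k. prob (Rec j \<inter> Rec k))
      \<le> (\<Sum>k=1..n. \<Sum>j=1..<k. p j * p k + p j * (p (k - 1) - p k) + c * (real j powr (-1/2) * exp_moment TYPE('d) k))"
      unfolding c_def by (intro sum_mono prob_Rec_Int_le_cov) auto
    also have "\<dots> = (\<Sum>k=1..n. \<Sum>j=1..<k. p j * p k) + (\<Sum>k=1..n. \<Sum>j=1..<k. p j * (p (k - 1) - p k))
       + c * (\<Sum>k=1..n. (\<Sum>j=1..<k. real j powr (-1/2)) * exp_moment TYPE('d) k)"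
      by (simp add: sum.distrib sum_distrib_left sum_distrib_right)
    also have "(\<Sum>k=1..n. \<Sum>j=1..<k. p j * (p (k - 1) - p k)) \<le> hs CARD('d) n"
      using sum_Abel_decreasing[of p n] p_bounds by (simp only: sum_p)
    also have "(\<Sum>k=1..n. (\<Sum>j=1..<k. real j powr (-1/2)) * exp_moment TYPE('d) k)
      \<le> (\<Sum>k=1..n. 2 * sqrt (real k) * exp_moment TYPE('d) k)"
    proof (intro sum_mono mult_right_mono em)
      fix k assume k: "k \<in> {1..n}"
      have "{1..<k} = {1..k - 1}" using k by auto
      then have "(\<Sum>j=1..<k. real j powr (-1/2)) \<le> 2 * sqrt (real (k - 1))"
        using sum_inverse_sqrt_le[of "k - 1"] by simp
      also have "\<dots> \<le> 2 * sqrt (real k)" by simp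
      finally show "(\<Sum>j=1..<k. real j powr (-1/2)) \<le> 2 * sqrt (real k)" .
    qed
    also have "\<dots> = 2 * (\<Sum>k=1..n. sqrt (real k) * exp_moment TYPE('d) k)"
      by (simp add: sum_distrib_left mult.assoc)
    also have "\<dots> \<le> 2 * (8 * exp 1 * harm n ^ CARD('d))"
      by (intro mult_left_mono exp_moment_sum_le n) auto
    finally have A: "(\<Sum>k=1..n. \<Sum>j=1..<k. prob (Rec j \<inter> Rec k))
      \<le> (\<Sum>k=1..n. \<Sum>j=1..<k. p j * p k) + hs CARD('d) n + c * (2 * (8 * exp 1 * harm n ^ CARD('d)))"
      using c by (simp add: mult_left_mono)
    have "(hs CARD('d) n)\<^sup>2 = (\<Sum>j=1..n. \<Sum>k=1..n. p j * p k)"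
      by (simp only: sum_p[symmetric] power2_eq_square sum_product)
    also have "\<dots> = (\<Sum>k=1..n. p k * p k) + 2 * (\<Sum>k=1..n. \<Sum>j=1..<k. p j * p k)"
      by (rule sum_symmetric_square) simp
    finally have "2 * (\<Sum>k=1..n. \<Sum>j=1..<k. p j * p k) \<le> (hs CARD('d) n)\<^sup>2"
      using sum_nonneg[of "{1..n}" "\<lambda>k. p k * p k"] p_bounds(1) by (simp add: mult_nonneg_nonneg)
    then show ?thesis using A unfolding expectation_R2 sum_p by linarith
  qed
  show ?thesis
    by (rule exI[of _ "32 * c * exp 1"]) (use main c in auto)
qed

text \<open>Variance plus squared bias: the first is of degree at most \<open>d\<close> in
  \<open>harm n\<close>, the second of degree at most \<open>2 * (d - 2)\<close>.\<close>

lemma R_mean_square: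
  "\<exists>C>0. \<forall>n\<ge>1. expectation (\<lambda>\<omega>. (R n \<omega> - harm n ^ CARD('d) / fact CARD('d))\<^sup>2)
     \<le> C * harm n ^ max CARD('d) (2 * CARD('d) - 4)"
proof -
  let ?d = "CARD('d)"
  obtain C1 where C1: "0 \<le> C1" "\<And>n. 1 \<le> n \<Longrightarrow> expectation (\<lambda>\<omega>. (R n \<omega>)\<^sup>2) - (hs ?d n)\<^sup>2
     \<le> 3 * hs ?d n + C1 * harm n ^ ?d"
    using R_second_moment_le by auto
  have dpos: "1 \<le> ?d" by (simp add: Suc_le_eq)
  \<comment> \<open>For \<open>d = 1\<close> the subtraction \<open>d - 2\<close> truncates to 0,
    and the mean is exactly \<open>harm n\<close>, so the case is separate.\<close>
  have "\<exists>C\<ge>0. \<forall>n\<ge>1. hs ?d n \<le> harm n ^ ?d / fact ?d + C * harm n ^ (?d - 2)"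
  proof (cases "?d = 1")
    case True
    then have "hs ?d n = harm n ^ ?d / fact ?d" for n using hs_1[of n] by (simp del: hs.simps)
    then show ?thesis by (intro exI[of _ 0]) auto
  next
    case False
    then have "?d = ?d - 2 + 2" using dpos by linarith
    then show ?thesis using hs_le[of "?d - 2"] by metis
  qed
  then obtain C2 where C2: "0 \<le> C2" "\<And>n. 1 \<le> n \<Longrightarrow> hs ?d n \<le> harm n ^ ?d / fact ?d + C2 * harm n ^ (?d - 2)"
    by auto
  define C where "C = 3 * (1 + C2) + C1 + C2\<^sup>2 + 1"
  have "expectation (\<lambda>\<omega>. (R n \<omega> - harm n ^ ?d / fact ?d)\<^sup>2) \<le> C * harm n ^ max ?d (2 * ?d - 4)"
    if n: "1 \<le> n" for n
  proof -
    let ?h = "harm n :: real" and ?b = "max ?d (2 * ?d - 4)"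
    define c where "c = ?h ^ ?d / fact ?d"
    have h: "1 \<le> ?h" using n by (rule harm_ge_1)
    have "expectation (\<lambda>\<omega>. (R n \<omega> - c)\<^sup>2) = expectation (\<lambda>\<omega>. (R n \<omega>)\<^sup>2) - 2 * c * hs ?d n + c\<^sup>2"
    proof -
      have "expectation (\<lambda>\<omega>. (R n \<omega> - c)\<^sup>2) = expectation (\<lambda>\<omega>. (R n \<omega>)\<^sup>2 - 2 * c * R n \<omega> + c\<^sup>2)"
        by (intro Bochner_Integration.integral_cong) (auto simp: power2_diff)
      then show ?thesis
        using integrable_R[of n] integrable_R2[of n] by (simp add: expectation_R prob_space)
    qed
    also have "\<dots> = (expectation (\<lambda>\<omega>. (R n \<omega>)\<^sup>2) - (hs ?d n)\<^sup>2) + (hs ?d n - c)\<^sup>2"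
      by (simp add: power2_diff)
    also have "(hs ?d n - c)\<^sup>2 \<le> (C2 * ?h ^ (?d - 2))\<^sup>2"
      using C2(2)[OF n] hs_ge[of n ?d] by (intro power_mono) (auto simp: c_def)
    also have "\<dots> = C2\<^sup>2 * ?h ^ (2 * ?d - 4)"
    proof -
      have "(?h ^ (?d - 2))\<^sup>2 = ?h ^ ((?d - 2) * 2)" by (rule power_mult[symmetric])
      also have "(?d - 2) * 2 = 2 * ?d - 4" by simp
      finally show ?thesis by (simp only: power_mult_distrib)
    qed
    also have "expectation (\<lambda>\<omega>. (R n \<omega>)\<^sup>2) - (hs ?d n)\<^sup>2 \<le> 3 * hs ?d n + C1 * ?h ^ ?d"
      by (rule C1(2)[OF n])
    also have "hs ?d n \<le> (1 + C2) * ?h ^ ?d"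
    proof -
      have "?h ^ ?d / fact ?d \<le> ?h ^ ?d / 1" using h by (intro divide_left_mono) (auto simp: fact_ge_1)
      moreover have "C2 * ?h ^ (?d - 2) \<le> C2 * ?h ^ ?d" using h C2 by (intro mult_left_mono power_increasing) auto
      ultimately show ?thesis using C2(2)[OF n] by (simp add: distrib_right)
    qed
    finally have "expectation (\<lambda>\<omega>. (R n \<omega> - c)\<^sup>2) \<le> (3 * (1 + C2) + C1) * ?h ^ ?d + C2\<^sup>2 * ?h ^ (2 * ?d - 4)"
      by (simp add: algebra_simps)
    also have "\<dots> \<le> (3 * (1 + C2) + C1) * ?h ^ ?b + C2\<^sup>2 * ?h ^ ?b"
      using h C1 C2 by (intro add_mono mult_left_mono power_increasing) auto
    also have "\<dots> \<le> C * ?h ^ ?b" using h by (simp add: C_def algebra_simps)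
    finally show ?thesis by (simp add: c_def)
  qed
  moreover have "0 < C"
    unfolding C_def using C1 C2 by (intro add_nonneg_pos add_nonneg_nonneg) auto
  ultimately show ?thesis by auto
qed

lemma prob_R_deviation:
  "\<exists>C>0. \<forall>n\<ge>1. \<forall>t>0. \<P>(\<omega> in M. t \<le> \<bar>R n \<omega> - harm n ^ CARD('d) / fact CARD('d)\<bar>)
     \<le> C * harm n ^ max CARD('d) (2 * CARD('d) - 4) / t\<^sup>2"
proof -
  obtain C where C: "0 < C" "\<And>n. 1 \<le> n \<Longrightarrow> expectation (\<lambda>\<omega>. (R n \<omega> - harm n ^ CARD('d) / fact CARD('d))\<^sup>2)
     \<le> C * harm n ^ max CARD('d) (2 * CARD('d) - 4)"
    using R_mean_square by auto
  have "\<P>(\<omega> in M. t \<le> \<bar>R n \<omega> - harm n ^ CARD('d) / fact CARD('d)\<bar>)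
     \<le> C * harm n ^ max CARD('d) (2 * CARD('d) - 4) / t\<^sup>2" if "1 \<le> n" "0 < t" for n t
  proof -
    let ?c = "harm n ^ CARD('d) / fact CARD('d) :: real"
    have "integrable M (\<lambda>\<omega>. (R n \<omega> - c)\<^sup>2)" for c
    proof -
      have "integrable M (\<lambda>\<omega>. (R n \<omega>)\<^sup>2 - 2 * c * R n \<omega> + c\<^sup>2)"
        by (intro Bochner_Integration.integrable_add Bochner_Integration.integrable_diff integrable_mult_right integrable_R integrable_R2) simp
      moreover have "(R n \<omega> - c)\<^sup>2 = (R n \<omega>)\<^sup>2 - 2 * c * R n \<omega> + c\<^sup>2" for \<omega>
        by (simp add: power2_diff)
      ultimately show ?thesis by (simp only:)
    qed
    note int = this[of ?c]
    have "{\<omega> \<in> space M. t \<le> \<bar>R n \<omega> - ?c\<bar>} = {\<omega> \<in> space M. t\<^sup>2 \<le> (R n \<omega> - ?c)\<^sup>2}"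
      using \<open>0 < t\<close> abs_le_square_iff[of t] by auto
    then have "\<P>(\<omega> in M. t \<le> \<bar>R n \<omega> - ?c\<bar>) \<le> expectation (\<lambda>\<omega>. (R n \<omega> - ?c)\<^sup>2) / t\<^sup>2"
      using integral_Markov_inequality_measure[OF int, of "{}" "t\<^sup>2"] \<open>0 < t\<close> by simp
    also have "\<dots> \<le> C * harm n ^ max CARD('d) (2 * CARD('d) - 4) / t\<^sup>2"
      by (intro divide_right_mono C that) auto
    finally show ?thesis .
  qed
  then show ?thesis using C(1) by blast
qed

end


subsection \<open>Concentration of the record count\<close>

text \<open>The inverse of \<open>h ^ d / fact d\<close>, the leading term of the mean count; it
  translates counts to the scale of \<open>harm n\<close>.\<close>

definition root_scale :: "nat \<Rightarrow> real \<Rightarrow> real" where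
  "root_scale d x = (fact d * x) powr (1 / real d)"

lemma root_scale_nonneg: "0 \<le> root_scale d x"
  by (simp add: root_scale_def)

lemma root_scale_power:
  assumes "0 \<le> x" "0 < d"
  shows "root_scale d x ^ d = fact d * x"
proof (cases "x = 0")
  case False
  with assms have x: "0 < fact d * x" by simp
  then have "root_scale d x ^ d = ((fact d * x) powr (1 / real d)) powr real d"
    unfolding root_scale_def by (intro powr_realpow[symmetric]) (use False in auto)
  also have "\<dots> = fact d * x" using x assms(2) by (simp add: powr_powr)
  finally show ?thesis .
qed (use assms in \<open>simp add: root_scale_def\<close>)

lemma root_scale_mono: "0 \<le> x \<Longrightarrow> x \<le> y \<Longrightarrow> root_scale d x \<le> root_scale d y"
  unfolding root_scale_def by (intro powr_mono2) auto

text \<open>For nonnegative \<open>z\<close> and \<open>h\<close>, the difference of the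
  \<open>d\<close>-th powers is at least \<open>\<bar>z - h\<bar> * h ^ (d - 1)\<close> whichever is
  larger, so no linearisation around \<open>h\<close> is involved.\<close>

lemma root_scale_deviation:
  assumes r: "0 \<le> r" and d: "0 < d" and h: "0 < h" and w: "w \<le> \<bar>root_scale d r - h\<bar>"
  shows "w * h ^ (d - 1) / fact d \<le> \<bar>r - h ^ d / fact d\<bar>"
proof -
  define z where "z = root_scale d r"
  have z: "0 \<le> z" by (simp add: z_def root_scale_nonneg)
  have zd: "z ^ d = fact d * r" unfolding z_def by (rule root_scale_power[OF r d])
  obtain e where e: "d = Suc e" using d by (cases d) auto
  have "w * h ^ (d - 1) \<le> \<bar>z ^ d - h ^ d\<bar>"
  proof (cases "h \<le> z")
    case True
    have "w * h ^ e \<le> (z - h) * h ^ e"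
      using w True h by (intro mult_right_mono) (auto simp: z_def)
    also have "\<dots> \<le> z * z ^ e - h * h ^ e"
      using mult_left_mono[OF power_mono[OF True, of e] z] h by (simp add: algebra_simps)
    finally show ?thesis using True h by (simp add: e)
  next
    case False
    have "w * h ^ e \<le> (h - z) * h ^ e"
      using w False h by (intro mult_right_mono) (auto simp: z_def)
    also have "\<dots> \<le> h * h ^ e - z * z ^ e"
      using mult_left_mono[OF power_mono[of z h e] z] False z by (simp add: algebra_simps)
    finally show ?thesis using False h by (simp add: e)
  qed
  also have "\<bar>z ^ d - h ^ d\<bar> = fact d * \<bar>r - h ^ d / fact d\<bar>"
  proof -
    have "z ^ d - h ^ d = fact d * (r - h ^ d / fact d)" by (simp add: zd right_diff_distrib)
    then show ?thesis by (simp add: abs_mult)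
  qed
  finally show ?thesis by (simp add: divide_le_eq mult.commute)
qed

lemma divide_le_inverse_aux:
  fixes a b c D :: real
  assumes "a * b \<le> D" "0 < b" "0 < c" "0 < D"
  shows "a / (c * D) \<le> 1 / (c * b)"
proof -
  have "a * b / (c * D * b) \<le> D / (c * D * b)" using assms by (intro divide_right_mono) auto
  then show ?thesis using assms by simp
qed

definition harm_index :: "real \<Rightarrow> nat" where
  "harm_index x = (LEAST n. 1 \<le> n \<and> x \<le> harm n)"

lemma harm_index:
  shows "1 \<le> harm_index x" and "x \<le> harm (harm_index x)"
    and "1 \<le> n \<Longrightarrow> x \<le> harm n \<Longrightarrow> harm_index x \<le> n"
proof -
  have "eventually (\<lambda>n. x \<le> (harm n :: real)) sequentially"
    using harm_at_top by (auto simp: filterlim_at_top)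
  then have "eventually (\<lambda>n. 1 \<le> n \<and> x \<le> (harm n :: real)) sequentially"
    using eventually_ge_at_top[of 1] by eventually_elim auto
  then have "\<exists>n. 1 \<le> n \<and> x \<le> (harm n :: real)"
    using eventually_happens'[OF sequentially_bot] by blast
  from LeastI_ex[OF this] show "1 \<le> harm_index x" "x \<le> harm (harm_index x)"
    unfolding harm_index_def by auto
  show "1 \<le> n \<Longrightarrow> x \<le> harm n \<Longrightarrow> harm_index x \<le> n"
    unfolding harm_index_def by (rule Least_le) simp
qed

lemma harm_le: "harm n \<le> (real n)"
proof (induction n)
  case (Suc n)
  have "inverse (real (Suc n)) \<le> 1" by (simp add: field_simps)
  then show ?case using Suc by (simp add: harm_Suc)
qed (simp add: harm_def)

text \<open>The overshoot is at most the last increment \<open>1 / n\<close>, and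
  \<open>n >= harm n >= x\<close>.\<close>

lemma harm_harm_index_le:
  assumes "1 \<le> x"
  shows "harm (harm_index x) \<le> x + 1 / x"
proof (cases "harm_index x = 1")
  case True
  then show ?thesis using assms by (simp add: harm_def add_increasing2)
next
  case False
  define n where "n = harm_index x"
  have n: "2 \<le> n" using False harm_index(1)[of x] unfolding n_def by linarith
  have "\<not> x \<le> harm (n - 1)"
    using harm_index(3)[of "n - 1" x] n unfolding n_def by linarith
  moreover have "harm n = harm (n - 1) + 1 / real n"
    using harm_minus_one[of n] n by simp
  moreover have "x \<le> real n" using harm_index(2)[of x] harm_le[of n] unfolding n_def by linarith
  then have "1 / real n \<le> 1 / x" using assms by (intro divide_left_mono) auto
  ultimately show ?thesis unfolding n_def by linarith
qed

lemma harm_harm_index_le_Suc: "1 \<le> x \<Longrightarrow> harm (harm_index x) \<le> x + 1"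
  by (rule order_trans[OF harm_harm_index_le]) (auto simp: divide_le_eq_1)

text \<open>Encloses an arbitrary time between the sampling times of two consecutive integer levels;
  monotone quantities controlled at the sampling times are then controlled everywhere.\<close>

lemma harm_index_floor:
  assumes n: "1 \<le> n"
  defines "k \<equiv> nat \<lfloor>harm n :: real\<rfloor>"
  shows "1 \<le> k" "real k \<le> harm n" "harm n < real (Suc k)"
    "harm_index (real k) \<le> n" "n \<le> harm_index (real (Suc k))"
proof -
  have h: "1 \<le> (harm n :: real)" using n by (rule harm_ge_1)
  then show k: "1 \<le> k" "real k \<le> harm n" "harm n < real (Suc k)" unfolding k_def by linarith+
  show "harm_index (real k) \<le> n" using n k by (intro harm_index) auto
  show "n \<le> harm_index (real (Suc k))"
  proof (rule ccontr)
    assume "\<not> n \<le> harm_index (real (Suc k))"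
    then have "harm (harm_index (real (Suc k))) \<le> (harm n :: real)" by (intro harm_mono) auto
    with harm_index(2)[of "real (Suc k)"] k show False by linarith
  qed
qed

lemma filterlim_harm_index: "filterlim f at_top F \<Longrightarrow> filterlim (\<lambda>x. harm_index (f x)) at_top F"
  unfolding filterlim_at_top
proof safe
  fix n :: nat
  assume "\<forall>Z. \<forall>\<^sub>F x in F. Z \<le> f x"
  then have "\<forall>\<^sub>F x in F. real n \<le> f x" by blast
  then show "\<forall>\<^sub>F x in F. n \<le> harm_index (f x)"
  proof eventually_elim
    case (elim x)
    then have "real n \<le> real (harm_index (f x))"
      using harm_index(2)[of "f x"] harm_le[of "harm_index (f x)"] by linarith
    then show ?case by simp
  qed
qed

context exp_sample
begin

definition Z :: "nat \<Rightarrow> 'a \<Rightarrow> real" where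
  "Z n \<omega> = root_scale CARD('d) (R n \<omega>)"

lemma Z_measurable [measurable]: "Z n \<in> borel_measurable M"
  unfolding Z_def root_scale_def by measurable

lemma Z_mono: "m \<le> n \<Longrightarrow> Z m \<omega> \<le> Z n \<omega>"
  unfolding Z_def R_def by (intro root_scale_mono) (auto intro: rec_count_mono)

text \<open>A deviation \<open>w\<close> of \<open>Z n\<close> forces a deviation of order
  \<open>w * harm n ^ (d - 1)\<close> of \<open>R n\<close>; its square in Chebyshev's inequality
  gives the exponent \<open>2 * d - 2\<close>.\<close>

lemma prob_Z_deviation:
  "\<exists>C>0. \<forall>n\<ge>1. \<forall>w>0. \<P>(\<omega> in M. w \<le> \<bar>Z n \<omega> - harm n\<bar>)
     \<le> C * (harm n ^ max CARD('d) (2 * CARD('d) - 4) / (w\<^sup>2 * harm n ^ (2 * CARD('d) - 2)))"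
proof -
  let ?d = "CARD('d)"
  let ?b = "max ?d (2 * ?d - 4)"
  obtain C where C: "0 < C" "\<And>n t. 1 \<le> n \<Longrightarrow> 0 < t \<Longrightarrow>
     \<P>(\<omega> in M. t \<le> \<bar>R n \<omega> - harm n ^ ?d / fact ?d\<bar>) \<le> C * harm n ^ ?b / t\<^sup>2"
    using prob_R_deviation by blast
  have "\<P>(\<omega> in M. w \<le> \<bar>Z n \<omega> - harm n\<bar>)
     \<le> (C * (fact ?d)\<^sup>2) * (harm n ^ ?b / (w\<^sup>2 * harm n ^ (2 * ?d - 2)))" if n: "1 \<le> n" and w: "0 < w" for n w
  proof -
    let ?t = "w * harm n ^ (?d - 1) / fact ?d :: real"
    have h: "0 < (harm n :: real)" using n by simp
    have "{\<omega> \<in> space M. w \<le> \<bar>Z n \<omega> - harm n\<bar>} \<subseteq> {\<omega> \<in> space M. ?t \<le> \<bar>R n \<omega> - harm n ^ ?d / fact ?d\<bar>}"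
    proof safe
      fix \<omega> assume "\<omega> \<in> space M" "w \<le> \<bar>Z n \<omega> - harm n\<bar>"
      then show "?t \<le> \<bar>R n \<omega> - harm n ^ ?d / fact ?d\<bar>"
        using h unfolding Z_def by (intro root_scale_deviation) (auto simp: R_def)
    qed
    then have "\<P>(\<omega> in M. w \<le> \<bar>Z n \<omega> - harm n\<bar>)
       \<le> \<P>(\<omega> in M. ?t \<le> \<bar>R n \<omega> - harm n ^ ?d / fact ?d\<bar>)"
      by (intro finite_measure_mono) auto
    also have "\<dots> \<le> C * harm n ^ ?b / ?t\<^sup>2" using w h by (intro C n) auto
    also have "?t\<^sup>2 = w\<^sup>2 * harm n ^ (2 * ?d - 2) / (fact ?d)\<^sup>2"
    proof -
      have "(harm n ^ (?d - 1))\<^sup>2 = (harm n :: real) ^ ((?d - 1) * 2)" by (rule power_mult[symmetric])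
      also have "(?d - 1) * 2 = 2 * ?d - 2" by simp
      finally show ?thesis by (simp only: power_mult_distrib power_divide)
    qed
    finally show ?thesis by (simp add: mult.commute mult.left_commute)
  qed
  then show ?thesis using C(1) by (intro exI[of _ "C * (fact ?d)\<^sup>2"]) auto
qed

text \<open>The admissible \<open>e\<close> are those up to \<open>min (d - 2) 2\<close>: only 0 for
  \<open>d = 2\<close>, up to 1 for \<open>d = 3\<close>, and up to 2, which is summable over
  integer levels of \<open>harm\<close>, from \<open>d = 4\<close> on.\<close>

lemma prob_Z_deviation_inverse_power:
  assumes "max CARD('d) (2 * CARD('d) - 4) + e \<le> 2 * CARD('d) - 2"
  shows "\<exists>C>0. \<forall>n\<ge>1. \<forall>w>0. \<P>(\<omega> in M. w \<le> \<bar>Z n \<omega> - harm n\<bar>) \<le> C / (w\<^sup>2 * harm n ^ e)"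
proof -
  let ?b = "max CARD('d) (2 * CARD('d) - 4)" and ?D = "2 * CARD('d) - 2"
  obtain C where C: "0 < C" "\<And>n w. 1 \<le> n \<Longrightarrow> 0 < w \<Longrightarrow> \<P>(\<omega> in M. w \<le> \<bar>Z n \<omega> - harm n\<bar>)
     \<le> C * (harm n ^ ?b / (w\<^sup>2 * harm n ^ ?D))"
    using prob_Z_deviation by blast
  have "\<P>(\<omega> in M. w \<le> \<bar>Z n \<omega> - harm n\<bar>) \<le> C / (w\<^sup>2 * harm n ^ e)" if n: "1 \<le> n" and w: "0 < w" for n w
  proof -
    have h: "1 \<le> (harm n :: real)" using n by (rule harm_ge_1)
    have "(harm n :: real) ^ (?b + e) \<le> harm n ^ ?D" using h assms by (intro power_increasing)
    then have "harm n ^ ?b * harm n ^ e \<le> (harm n :: real) ^ ?D" by (simp only: power_add)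
    then have "harm n ^ ?b / (w\<^sup>2 * harm n ^ ?D) \<le> 1 / (w\<^sup>2 * (harm n :: real) ^ e)"
      by (intro divide_le_inverse_aux mult_pos_pos zero_less_power) (use n w in auto)
    then have "C * (harm n ^ ?b / (w\<^sup>2 * harm n ^ ?D)) \<le> C * (1 / (w\<^sup>2 * (harm n :: real) ^ e))"
      using C(1) by (intro mult_left_mono) auto
    then show ?thesis using C(2)[OF n w] by simp
  qed
  then show ?thesis using C(1) by blast
qed

text \<open>Measuring the deviation relative to \<open>harm n\<close> gains a factor
  \<open>harm n ^ 2\<close>, so a negative power remains for every \<open>d\<close>, including
  \<open>d = 1\<close>.\<close>

lemma prob_Z_relative_deviation:
  "\<exists>C>0. \<forall>n\<ge>1. \<forall>w>0. \<P>(\<omega> in M. w * harm n \<le> \<bar>Z n \<omega> - harm n\<bar>) \<le> C / (w\<^sup>2 * harm n)"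
proof -
  let ?b = "max CARD('d) (2 * CARD('d) - 4)" and ?D = "2 * CARD('d) - 2"
  have d: "1 \<le> CARD('d)" by (simp add: Suc_le_eq)
  obtain C where C: "0 < C" "\<And>n w. 1 \<le> n \<Longrightarrow> 0 < w \<Longrightarrow> \<P>(\<omega> in M. w \<le> \<bar>Z n \<omega> - harm n\<bar>)
     \<le> C * (harm n ^ ?b / (w\<^sup>2 * harm n ^ ?D))"
    using prob_Z_deviation by blast
  have "\<P>(\<omega> in M. w * harm n \<le> \<bar>Z n \<omega> - harm n\<bar>) \<le> C / (w\<^sup>2 * harm n)" if n: "1 \<le> n" and w: "0 < w" for n w
  proof -
    have h: "1 \<le> (harm n :: real)" using n by (rule harm_ge_1)
    have "(harm n :: real) ^ (?b + 1) \<le> harm n ^ (?D + 2)" using h d by (intro power_increasing) auto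
    then have "harm n ^ ?b * harm n \<le> (harm n)\<^sup>2 * (harm n :: real) ^ ?D" by (simp add: power_add mult_ac power2_eq_square)
    then have "harm n ^ ?b / (w\<^sup>2 * ((harm n)\<^sup>2 * harm n ^ ?D)) \<le> 1 / (w\<^sup>2 * (harm n :: real))"
      by (intro divide_le_inverse_aux mult_pos_pos zero_less_power) (use n w in auto)
    then have "harm n ^ ?b / ((w * harm n)\<^sup>2 * harm n ^ ?D) \<le> 1 / (w\<^sup>2 * (harm n :: real))"
      by (simp only: power_mult_distrib mult.assoc)
    then have "C * (harm n ^ ?b / ((w * harm n)\<^sup>2 * harm n ^ ?D)) \<le> C * (1 / (w\<^sup>2 * (harm n :: real)))"
      using C(1) by (intro mult_left_mono) auto
    moreover have "0 < w * harm n" using w h n by (intro mult_pos_pos) auto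
    ultimately show ?thesis using C(2)[OF n, of "w * harm n"] by simp
  qed
  then show ?thesis using C(1) by blast
qed

lemma borel_cantelli_AE:
  assumes "\<And>k. {\<omega> \<in> space M. P k \<omega>} \<in> sets M"
    and "\<forall>\<^sub>F k in sequentially. \<P>(\<omega> in M. P k \<omega>) \<le> f k" "summable f"
  shows "AE \<omega> in M. \<forall>\<^sub>F k in sequentially. \<not> P k \<omega>"
proof -
  have "summable (\<lambda>k. \<P>(\<omega> in M. P k \<omega>))"
    by (rule summable_comparison_test_ev[OF _ assms(3)]) (use assms(2) in simp)
  then have "AE \<omega> in M. \<forall>\<^sub>F k in sequentially. \<omega> \<in> space M - {\<omega> \<in> space M. P k \<omega>}"
    using assms(1) by (intro borel_cantelli_AE1) (auto simp: emeasure_eq_measure)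
  then show ?thesis
    by (rule AE_mp) (auto elim: eventually_mono)
qed

text \<open>The relative bound decays only like \<open>1 / harm n\<close>, so the sampling is
  sparse: at level \<open>k ^ 4\<close> with tolerance \<open>1 / k\<close> the probabilities are of
  order \<open>k ^ (-2)\<close>. Consecutive levels have ratio tending to 1, so monotonicity of
  \<open>Z\<close> fills the gaps.\<close>

lemma AE_Z_asymp: "AE \<omega> in M. (\<lambda>n. Z n \<omega> / harm n) \<longlonglongrightarrow> 1"
proof -
  define N where "N k = harm_index (real k ^ 4)" for k :: nat
  obtain C where C: "0 < C" "\<And>n w. 1 \<le> n \<Longrightarrow> 0 < w \<Longrightarrow>
     \<P>(\<omega> in M. w * harm n \<le> \<bar>Z n \<omega> - harm n\<bar>) \<le> C / (w\<^sup>2 * harm n)"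
    using prob_Z_relative_deviation by blast
  have N1: "1 \<le> N k" for k unfolding N_def by (rule harm_index)
  have "AE \<omega> in M. \<forall>\<^sub>F k in sequentially. \<not> (1 / real k * harm (N k) \<le> \<bar>Z (N k) \<omega> - harm (N k)\<bar>)"
  proof (rule borel_cantelli_AE[where f = "\<lambda>k. C * inverse (real k ^ 2)"])
    show "\<forall>\<^sub>F k in sequentially. \<P>(\<omega> in M. 1 / real k * harm (N k) \<le> \<bar>Z (N k) \<omega> - harm (N k)\<bar>) \<le> C * inverse (real k ^ 2)"
      using eventually_ge_at_top[of 1]
    proof eventually_elim
      case (elim k)
      have "\<P>(\<omega> in M. 1 / real k * harm (N k) \<le> \<bar>Z (N k) \<omega> - harm (N k)\<bar>) \<le> C / ((1 / real k)\<^sup>2 * harm (N k))"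
        using elim by (intro C(2) N1) auto
      also have "\<dots> \<le> C / ((1 / real k)\<^sup>2 * real k ^ 4)"
        using elim C(1) harm_index(2)[of "real k ^ 4"] N1[of k] unfolding N_def
        by (intro divide_left_mono mult_left_mono mult_pos_pos) auto
      also have "\<dots> = C * inverse (real k ^ 2)"
        using elim by (simp add: field_simps power_divide)
      finally show ?case .
    qed
    show "summable (\<lambda>k. C * inverse (real k ^ 2))"
      by (intro summable_mult inverse_power_summable) simp
  qed measurable
  then show ?thesis
  proof (rule AE_mp, intro AE_I2 impI)
    fix \<omega>
    assume "\<forall>\<^sub>F k in sequentially. \<not> (1 / real k * harm (N k) \<le> \<bar>Z (N k) \<omega> - harm (N k)\<bar>)"
    then obtain K where K: "\<And>k. K \<le> k \<Longrightarrow> \<bar>Z (N k) \<omega> - harm (N k)\<bar> < harm (N k) / real k"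
      by (auto simp: eventually_sequentially not_le)
    define k where "k n = nat \<lfloor>sqrt (sqrt (harm n))\<rfloor>" for n
    have k_top: "filterlim k sequentially sequentially"
      unfolding k_def
      by (intro filterlim_compose[OF filterlim_nat_sequentially] filterlim_compose[OF filterlim_floor_sequentially]
            filterlim_compose[OF sqrt_at_top] harm_at_top)
    have "\<forall>\<^sub>F n in sequentially. norm (Z n \<omega> / harm n - 1) \<le> 25 * (1 / real (k n))"
      using k_top[unfolded filterlim_at_top, rule_format, of "max K 1"] eventually_ge_at_top[of 1]
    proof eventually_elim
      case (elim n)
      define a where "a = real (k n)"
      let ?y = "sqrt (sqrt (harm n))"
      have kn: "K \<le> k n" "1 \<le> a" using elim by (auto simp: a_def)
      have h: "1 \<le> (harm n :: real)" using elim by (intro harm_ge_1) auto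
      have "?y ^ 4 = (?y\<^sup>2)\<^sup>2" by (simp add: power_mult[symmetric])
      then have y4: "?y ^ 4 = harm n" using h by simp
      have "0 \<le> ?y" using h by simp
      then have "a \<le> ?y" "?y < a + 1" unfolding a_def k_def by linarith+
      then have "a ^ 4 \<le> ?y ^ 4" "?y ^ 4 < (a + 1) ^ 4"
        using h kn(2) by (intro power_mono power_strict_mono; simp)+
      then have h4: "a ^ 4 \<le> harm n" "harm n < (a + 1) ^ 4" unfolding y4 by auto
      have S: "real (Suc (k n)) = a + 1" by (simp add: a_def)
      have N: "a ^ 4 \<le> harm (N (k n))" "harm (N (Suc (k n))) \<le> (a + 1) ^ 4 + 1" "(a + 1) ^ 4 \<le> harm (N (Suc (k n)))"
        using harm_index(2)[of "a ^ 4"] harm_index(2)[of "(a + 1) ^ 4"] harm_harm_index_le_Suc[of "(a + 1) ^ 4"] kn(2)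
        unfolding N_def S by (auto simp: a_def one_le_power)
      have n1: "N (k n) \<le> n" unfolding N_def using elim h4 by (intro harm_index) (auto simp: a_def)
      have n2: "n \<le> N (Suc (k n))"
      proof (rule ccontr)
        assume "\<not> n \<le> N (Suc (k n))"
        then have "harm (N (Suc (k n))) \<le> (harm n :: real)" by (intro harm_mono) auto
        with N h4 show False by linarith
      qed
      have a3: "a \<le> a ^ 3" "a\<^sup>2 \<le> a ^ 3" "1 \<le> a ^ 3"
        using power_increasing[of 1 3 a] power_increasing[of 2 3 a] kn(2) by (auto simp: one_le_power)
      have "Z n \<omega> \<le> Z (N (Suc (k n))) \<omega>" by (rule Z_mono[OF n2])
      also have "\<dots> \<le> harm (N (Suc (k n))) * (1 + 1 / (a + 1))"
        using K[of "Suc (k n)"] kn(1) unfolding S by (simp add: algebra_simps)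
      also have "\<dots> \<le> ((a + 1) ^ 4 + 1) * (1 + 1 / (a + 1))"
        using N(2) kn(2) by (intro mult_right_mono) auto
      also have "\<dots> = (a + 1) ^ 4 + 1 + (a + 1) ^ 3 + 1 / (a + 1)"
        using kn(2) by (simp add: field_simps power_numeral_reduce)
      also have "\<dots> \<le> (a + 1) ^ 4 + 1 + (a + 1) ^ 3 + 1" using kn(2) by simp
      \<comment> \<open>The terms below degree 4 are
        \<open>5 * a ^ 3 + 9 * a ^ 2 + 7 * a + 4\<close>, with coefficient sum 25, and
        \<open>a >= 1\<close>.\<close>
      also have "\<dots> \<le> a ^ 4 + 25 * a ^ 3"
        using a3 by (simp add: field_simps power_numeral_reduce)
      finally have hi: "Z n \<omega> - harm n \<le> 25 * a ^ 3" using h4 by linarith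
      have "a ^ 4 - a ^ 3 = a ^ 4 * (1 - 1 / a)" using kn(2) by (simp add: field_simps power_numeral_reduce)
      also have "\<dots> \<le> harm (N (k n)) * (1 - 1 / a)" using N(1) kn(2) by (intro mult_right_mono) auto
      also have "\<dots> \<le> Z (N (k n)) \<omega>" using K[OF kn(1)] by (simp add: a_def algebra_simps)
      also have "\<dots> \<le> Z n \<omega>" by (rule Z_mono[OF n1])
      finally have "harm n - Z n \<omega> \<le> (a + 1) ^ 4 - a ^ 4 + a ^ 3" using h4 by linarith
      also have "\<dots> \<le> 25 * a ^ 3" using a3 by (simp add: field_simps power_numeral_reduce)
      finally have "\<bar>Z n \<omega> - harm n\<bar> \<le> 25 * a ^ 3" using hi by linarith
      also have "\<dots> = 25 * (1 / a) * a ^ 4" using kn(2) by (simp add: power_numeral_reduce)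
      also have "\<dots> \<le> 25 * (1 / a) * harm n" using h4 kn(2) by (intro mult_left_mono) auto
      finally have le: "\<bar>Z n \<omega> - harm n\<bar> / harm n \<le> 25 * (1 / a)" using h elim by (simp add: pos_divide_le_eq)
      have "Z n \<omega> / harm n - 1 = (Z n \<omega> - harm n) / harm n" using h elim by (simp add: diff_divide_distrib)
      then have "\<bar>Z n \<omega> / harm n - 1\<bar> = \<bar>Z n \<omega> - harm n\<bar> / harm n" by (simp only: abs_divide abs_harm)
      also note le
      finally show ?case unfolding a_def real_norm_def .
    qed
    moreover have "(\<lambda>n. 25 * (1 / real (k n))) \<longlonglongrightarrow> 25 * 0"
      by (intro tendsto_mult tendsto_const filterlim_compose[OF lim_1_over_n k_top])
    then have "(\<lambda>n. 25 * (1 / real (k n))) \<longlonglongrightarrow> 0" by (simp only: mult_zero_right)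
    ultimately have "(\<lambda>n. Z n \<omega> / harm n - 1) \<longlonglongrightarrow> 0" by (rule Lim_null_comparison)
    then show "(\<lambda>n. Z n \<omega> / harm n) \<longlonglongrightarrow> 1" by (rule LIM_zero_cancel)
  qed
qed

text \<open>Exponent 2 makes the deviation probabilities summable along integer levels of
  \<open>harm\<close>. Of the bound 3, a part 1 is the deviation at a sampling time and 2 is the
  distance from \<open>harm n\<close> to the next sampled value.\<close>

lemma AE_Z_bounded_deviation:
  assumes "4 \<le> CARD('d)"
  shows "AE \<omega> in M. \<forall>\<^sub>F n in sequentially. \<bar>Z n \<omega> - harm n\<bar> \<le> 3"
proof -
  define N where "N k = harm_index (real k)" for k :: nat
  have "\<exists>C>0. \<forall>n\<ge>1. \<forall>w>0. \<P>(\<omega> in M. w \<le> \<bar>Z n \<omega> - harm n\<bar>) \<le> C / (w\<^sup>2 * harm n ^ 2)"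
    using assms by (intro prob_Z_deviation_inverse_power) auto
  then obtain C where C: "0 < C" "\<And>n w. 1 \<le> n \<Longrightarrow> 0 < w \<Longrightarrow>
     \<P>(\<omega> in M. w \<le> \<bar>Z n \<omega> - harm n\<bar>) \<le> C / (w\<^sup>2 * harm n ^ 2)"
    by blast
  have N1: "1 \<le> N k" for k unfolding N_def by (rule harm_index)
  have "AE \<omega> in M. \<forall>\<^sub>F k in sequentially. \<not> (1 \<le> \<bar>Z (N k) \<omega> - harm (N k)\<bar>)"
  proof (rule borel_cantelli_AE[where f = "\<lambda>k. C * inverse (real k ^ 2)"])
    show "\<forall>\<^sub>F k in sequentially. \<P>(\<omega> in M. 1 \<le> \<bar>Z (N k) \<omega> - harm (N k)\<bar>) \<le> C * inverse (real k ^ 2)"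
      using eventually_ge_at_top[of 1]
    proof eventually_elim
      case (elim k)
      have "\<P>(\<omega> in M. 1 \<le> \<bar>Z (N k) \<omega> - harm (N k)\<bar>) \<le> C / (1\<^sup>2 * harm (N k) ^ 2)"
        using elim by (intro C(2) N1) auto
      also have "\<dots> \<le> C / (real k ^ 2)"
        using elim C(1) harm_index(2)[of "real k"] N1[of k] unfolding N_def
        by (simp, intro divide_left_mono mult_pos_pos power_mono) auto
      finally show ?case by (simp add: field_simps)
    qed
    show "summable (\<lambda>k. C * inverse (real k ^ 2))"
      by (intro summable_mult inverse_power_summable) simp
  qed measurable
  then show ?thesis
  proof (rule AE_mp, intro AE_I2 impI)
    fix \<omega>
    assume "\<forall>\<^sub>F k in sequentially. \<not> (1 \<le> \<bar>Z (N k) \<omega> - harm (N k)\<bar>)"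
    then obtain K where K: "\<And>k. K \<le> k \<Longrightarrow> \<bar>Z (N k) \<omega> - harm (N k)\<bar> < 1"
      by (auto simp: eventually_sequentially not_le)
    have "\<forall>\<^sub>F n in sequentially. real (max K 1) \<le> harm n"
      using harm_at_top by (simp add: filterlim_at_top)
    then show "\<forall>\<^sub>F n in sequentially. \<bar>Z n \<omega> - harm n\<bar> \<le> 3"
      using eventually_ge_at_top[of 1]
    proof eventually_elim
      case (elim n)
      define k where "k = nat \<lfloor>harm n :: real\<rfloor>"
      note k = harm_index_floor[OF elim(2), folded k_def, folded N_def]
      have "K \<le> k" using elim(1) k(3) by simp
      have "real k \<le> harm (N k)" "harm (N (Suc k)) \<le> real (Suc k) + 1"
        unfolding N_def by (intro harm_index harm_harm_index_le_Suc; simp)+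
      then show ?case
        using Z_mono[OF k(4), of \<omega>] Z_mono[OF k(5), of \<omega>] K[of k] K[of "Suc k"] \<open>K \<le> k\<close> k(2,3) by linarith
    qed
  qed
qed

end


subsection \<open>Maxima of Gamma variables\<close>

text \<open>For \<open>x >= 0\<close> and \<open>d >= 1\<close>, the survival function of the Gamma
  law with shape \<open>d\<close>, written as the probability that a Poisson variable of mean
  \<open>x\<close> is below \<open>d\<close>.\<close>

definition gamma_tail :: "nat \<Rightarrow> real \<Rightarrow> real" where
  "gamma_tail d x = (\<Sum>i<d. x ^ i / fact i) * exp (- x)"

lemma gamma_tail_ge:
  assumes "0 \<le> x" "1 \<le> d"
  shows "x ^ (d - 1) / fact (d - 1) * exp (- x) \<le> gamma_tail d x"
proof -
  have "x ^ (d - 1) / fact (d - 1) \<le> (\<Sum>i<d. x ^ i / fact i)"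
    using assms by (intro member_le_sum) auto
  then show ?thesis unfolding gamma_tail_def by (intro mult_right_mono) auto
qed

lemma gamma_tail_nonneg: "0 \<le> x \<Longrightarrow> 0 \<le> gamma_tail d x"
  unfolding gamma_tail_def by (intro mult_nonneg_nonneg sum_nonneg) auto

lemma gamma_tail_le:
  assumes "1 \<le> x" "1 \<le> d"
  shows "gamma_tail d x \<le> real d * x ^ (d - 1) * exp (- x)"
proof -
  have "(\<Sum>i<d. x ^ i / fact i) \<le> (\<Sum>i<d. x ^ (d - 1))"
  proof (rule sum_mono)
    fix i assume "i \<in> {..<d}"
    have "x ^ i / fact i \<le> x ^ i / 1"
      using assms by (intro divide_left_mono) (auto simp: fact_ge_1)
    also have "\<dots> \<le> x ^ (d - 1)"
      using assms \<open>i \<in> {..<d}\<close> by (simp, intro power_increasing) auto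
    finally show "x ^ i / fact i \<le> x ^ (d - 1)" .
  qed
  then show ?thesis unfolding gamma_tail_def by (intro mult_right_mono) auto
qed

lemma gamma_tail_le_refined:
  assumes "1 \<le> x" "1 \<le> d"
  shows "gamma_tail d x \<le> x ^ (d - 1) / fact (d - 1) * exp (- x) * (1 + real d * fact (d - 1) / x)"
proof -
  obtain e where e: "d = Suc e" using assms by (cases d) auto
  have "(\<Sum>i<e. x ^ i / fact i) \<le> (\<Sum>i<e. x ^ e / x)"
  proof (rule sum_mono)
    fix i assume i: "i \<in> {..<e}"
    have "x ^ i / fact i \<le> x ^ i / 1"
      using assms by (intro divide_left_mono) (auto simp: fact_ge_1)
    also have "\<dots> \<le> x ^ (e - 1)" using assms i by (simp, intro power_increasing) auto
    also have "\<dots> = x ^ e / x" using assms i by (cases e) auto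
    finally show "x ^ i / fact i \<le> x ^ e / x" .
  qed
  also have "\<dots> = real e * (x ^ e / x)" by simp
  also have "\<dots> \<le> real d * (x ^ e / x)" using assms by (intro mult_right_mono) (auto simp: e)
  finally have "(\<Sum>i<d. x ^ i / fact i) \<le> x ^ e / fact e + real d * (x ^ e / x)" by (simp add: e)
  also have "\<dots> = x ^ e / fact e * (1 + real d * fact e / x)" by (simp add: field_simps)
  finally have "(\<Sum>i<d. x ^ i / fact i) * exp (- x) \<le> x ^ e / fact e * (1 + real d * fact e / x) * exp (- x)"
    by (rule mult_right_mono) simp
  then show ?thesis by (simp only: gamma_tail_def e diff_Suc_1 mult_ac)
qed

lemma gamma_tail_asymp:
  assumes d: "1 \<le> d" and x: "filterlim x at_top F"
  shows "((\<lambda>m. gamma_tail d (x m) / (x m ^ (d - 1) / fact (d - 1) * exp (- x m))) \<longlongrightarrow> 1) F"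
proof (rule tendsto_sandwich[where f = "\<lambda>_. 1" and h = "\<lambda>m. 1 + real d * fact (d - 1) / x m"])
  have ev: "\<forall>\<^sub>F m in F. 1 \<le> x m" using x by (simp add: filterlim_at_top)
  show "\<forall>\<^sub>F m in F. 1 \<le> gamma_tail d (x m) / (x m ^ (d - 1) / fact (d - 1) * exp (- x m))"
    using ev
  proof eventually_elim
    case (elim m)
    then have "0 < x m ^ (d - 1) / fact (d - 1) * exp (- x m)" by (intro mult_pos_pos divide_pos_pos) auto
    then show ?case using gamma_tail_ge[of "x m" d] d elim by (subst pos_le_divide_eq) auto
  qed
  show "\<forall>\<^sub>F m in F. gamma_tail d (x m) / (x m ^ (d - 1) / fact (d - 1) * exp (- x m)) \<le> 1 + real d * fact (d - 1) / x m"
    using ev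
  proof eventually_elim
    case (elim m)
    then have "0 < x m ^ (d - 1) / fact (d - 1) * exp (- x m)" by (intro mult_pos_pos divide_pos_pos) auto
    then show ?case using gamma_tail_le_refined[of "x m" d] d elim
      by (subst pos_divide_le_eq) (auto simp: mult.commute)
  qed
  have "((\<lambda>m. 1 + real d * fact (d - 1) * inverse (x m)) \<longlongrightarrow> 1 + real d * fact (d - 1) * 0) F"
    by (intro tendsto_intros tendsto_inverse_0_at_top x)
  then show "((\<lambda>m. 1 + real d * fact (d - 1) / x m) \<longlongrightarrow> 1) F" by (simp add: divide_inverse)
qed simp

text \<open>Convergence of \<open>n * t\<close> forces \<open>t\<close> to 0 as \<open>n\<close>
  grows, and \<open>(1 - t) ^ n\<close> lies between \<open>exp (- (n * t / (1 - t)))\<close> and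
  \<open>exp (- (n * t))\<close>.\<close>

lemma power_one_minus_tendsto_exp:
  fixes t :: "'b \<Rightarrow> real" and n :: "'b \<Rightarrow> nat"
  assumes nt: "((\<lambda>m. real (n m) * t m) \<longlongrightarrow> a) F" and n: "filterlim n at_top F"
  shows "((\<lambda>m. (1 - t m) ^ n m) \<longlongrightarrow> exp (- a)) F"
proof -
  have rn: "filterlim (\<lambda>m. real (n m)) at_top F"
    by (rule filterlim_compose[OF filterlim_real_sequentially n])
  have "((\<lambda>m. (real (n m) * t m) * inverse (real (n m))) \<longlongrightarrow> a * 0) F"
    by (intro tendsto_mult nt tendsto_inverse_0_at_top rn)
  moreover have "\<forall>\<^sub>F m in F. (real (n m) * t m) * inverse (real (n m)) = t m"
    using n[unfolded filterlim_at_top, rule_format, of 1] by eventually_elim auto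
  ultimately have t: "(t \<longlongrightarrow> 0) F" by (simp add: tendsto_cong)
  have ev: "\<forall>\<^sub>F m in F. t m < 1" using order_tendstoD(2)[OF t, of 1] by simp
  show ?thesis
  proof (rule tendsto_sandwich)
    show "\<forall>\<^sub>F m in F. exp (- (real (n m) * t m / (1 - t m))) \<le> (1 - t m) ^ n m"
      using ev
    proof eventually_elim
      case (elim m)
      have "1 / (1 - t m) = 1 + t m / (1 - t m)" using elim by (simp add: field_simps)
      also have "\<dots> \<le> exp (t m / (1 - t m))" by (rule exp_ge_add_one_self)
      finally have "1 \<le> exp (t m / (1 - t m)) * (1 - t m)" using elim by (simp add: field_simps)
      then have "exp (- (t m / (1 - t m))) * 1 \<le> exp (- (t m / (1 - t m))) * (exp (t m / (1 - t m)) * (1 - t m))"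
        by (intro mult_left_mono) auto
      then have "exp (- (t m / (1 - t m))) \<le> 1 - t m"
        by (simp add: mult.assoc[symmetric] exp_add[symmetric])
      then have "exp (- (t m / (1 - t m))) ^ n m \<le> (1 - t m) ^ n m" by (intro power_mono) auto
      then show ?case by (simp add: exp_of_nat_mult[symmetric])
    qed
    show "\<forall>\<^sub>F m in F. (1 - t m) ^ n m \<le> exp (- (real (n m) * t m))"
      using ev
    proof eventually_elim
      case (elim m)
      have "(1 - t m) ^ n m \<le> exp (- t m) ^ n m"
        using elim exp_ge_add_one_self[of "- t m"] by (intro power_mono) auto
      then show ?case by (simp add: exp_of_nat_mult[symmetric])
    qed
    have "((\<lambda>m. exp (- (real (n m) * t m / (1 - t m)))) \<longlongrightarrow> exp (- (a / (1 - 0)))) F"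
      by (intro tendsto_intros nt t) simp
    then show "((\<lambda>m. exp (- (real (n m) * t m / (1 - t m)))) \<longlongrightarrow> exp (- a)) F" by simp
    show "((\<lambda>m. exp (- (real (n m) * t m))) \<longlongrightarrow> exp (- a)) F" by (intro tendsto_intros nt)
  qed
qed

text \<open>\<open>n * gamma_tail d x\<close> behaves like
  \<open>n * x ^ (d - 1) * exp (- x) / fact (d - 1)\<close>. As \<open>x\<close> is asymptotic to
  \<open>ln n\<close>, the power may be replaced by \<open>(ln n) ^ (d - 1)\<close>, which the
  centring cancels, leaving \<open>exp (- y)\<close>.\<close>

lemma gamma_tail_gumbel:
  fixes n :: "'b \<Rightarrow> nat" and x :: "'b \<Rightarrow> real"
  assumes d: "1 \<le> d" and n: "filterlim n at_top F"
    and x: "((\<lambda>m. x m - (ln (real (n m)) + real (d - 1) * ln (ln (real (n m))) - ln (fact (d - 1)))) \<longlongrightarrow> y) F"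
  shows "((\<lambda>m. (1 - gamma_tail d (x m)) ^ n m) \<longlongrightarrow> exp (- exp (- y))) F"
    and "filterlim x at_top F"
proof -
  define L where "L m = ln (real (n m))" for m
  define e where "e m = x m - (L m + real (d - 1) * ln (L m) - ln (fact (d - 1)))" for m
  have e: "(e \<longlongrightarrow> y) F" using x unfolding e_def L_def .
  have L: "filterlim L at_top F"
    unfolding L_def by (intro filterlim_compose[OF ln_at_top] filterlim_compose[OF filterlim_real_sequentially n])
  have lnL: "((\<lambda>m. ln (L m) / L m) \<longlongrightarrow> 0) F" by (rule filterlim_compose[OF ln_x_over_x_tendsto_0 L])
  have iL: "((\<lambda>m. inverse (L m)) \<longlongrightarrow> 0) F" by (rule tendsto_inverse_0_at_top[OF L])
  have "((\<lambda>m. 1 + real (d - 1) * (ln (L m) / L m) - ln (fact (d - 1)) * inverse (L m) + e m * inverse (L m))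
     \<longlongrightarrow> 1 + real (d - 1) * 0 - ln (fact (d - 1)) * 0 + y * 0) F"
    by (intro tendsto_intros lnL iL e)
  moreover have evL: "\<forall>\<^sub>F m in F. 1 \<le> L m" using L by (simp add: filterlim_at_top)
  then have "\<forall>\<^sub>F m in F. 1 + real (d - 1) * (ln (L m) / L m) - ln (fact (d - 1)) * inverse (L m) + e m * inverse (L m) = x m / L m"
    by eventually_elim (simp add: e_def field_simps)
  ultimately have xL: "((\<lambda>m. x m / L m) \<longlongrightarrow> 1) F" by (simp add: tendsto_cong)
  show xt: "filterlim x at_top F"
  proof -
    have "filterlim (\<lambda>m. x m / L m * L m) at_top F"
      by (rule filterlim_tendsto_pos_mult_at_top[OF xL _ L]) simp
    moreover have "\<forall>\<^sub>F m in F. x m / L m * L m = x m" using evL by eventually_elim auto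
    ultimately show ?thesis by (simp add: filterlim_cong cong: filterlim_cong)
  qed
  show "((\<lambda>m. (1 - gamma_tail d (x m)) ^ n m) \<longlongrightarrow> exp (- exp (- y))) F"
  proof (rule power_one_minus_tendsto_exp[OF _ n])
    have "((\<lambda>m. exp (- e m) * (x m / L m) ^ (d - 1) * (gamma_tail d (x m) / (x m ^ (d - 1) / fact (d - 1) * exp (- x m))))
       \<longlongrightarrow> exp (- y) * 1 ^ (d - 1) * 1) F"
      by (intro tendsto_intros e xL gamma_tail_asymp d xt)
    moreover have "\<forall>\<^sub>F m in F. exp (- e m) * (x m / L m) ^ (d - 1) * (gamma_tail d (x m) / (x m ^ (d - 1) / fact (d - 1) * exp (- x m)))
       = real (n m) * gamma_tail d (x m)"
      using evL xt[unfolded filterlim_at_top, rule_format, of 1] n[unfolded filterlim_at_top, rule_format, of 1]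
    proof eventually_elim
      case (elim m)
      have "exp (- e m) = exp (- x m) * exp (L m) * exp (real (d - 1) * ln (L m)) * exp (- ln (fact (d - 1)))"
        unfolding e_def by (simp add: exp_add[symmetric] exp_diff[symmetric])
      also have "exp (L m) = real (n m)" using elim by (simp add: L_def)
      also have "exp (real (d - 1) * ln (L m)) = L m ^ (d - 1)" using elim by (simp only: exp_of_nat_mult) simp
      also have "exp (- ln (fact (d - 1) :: real)) = 1 / fact (d - 1)" by (subst exp_minus, subst exp_ln) (auto simp: inverse_eq_divide)
      finally have ee: "exp (- e m) = exp (- x m) * real (n m) * L m ^ (d - 1) * (1 / fact (d - 1))" .
      have "x m \<noteq> 0" "L m \<noteq> 0" using elim by auto
      then show ?case unfolding ee by (simp add: power_divide field_simps)
    qed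
    ultimately show "((\<lambda>m. real (n m) * gamma_tail d (x m)) \<longlongrightarrow> exp (- y)) F"
      by (simp add: tendsto_cong)
  qed
qed

lemma harm_le_ln: "1 \<le> n \<Longrightarrow> harm n \<le> 1 + ln (real n)"
proof -
  assume n: "1 \<le> n"
  have "harm (Suc (n - 1)) - ln (real (Suc (n - 1))) \<le> harm (Suc 0) - ln (real (Suc 0))"
    using decseq_harm_diff_ln by (rule decseqD) simp
  then show ?thesis using n by (simp add: harm_def)
qed

lemma le_exp_harm: "1 \<le> n \<Longrightarrow> real n \<le> exp (harm n)"
proof -
  assume n: "1 \<le> n"
  have "ln (real n) \<le> harm n" using n by (intro order_trans[OF _ ln_le_harm]) simp
  then have "exp (ln (real n)) \<le> exp (harm n)" by (simp only: exp_le_cancel_iff)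
  then show ?thesis using n by simp
qed

lemma exp_harm_le: "1 \<le> n \<Longrightarrow> exp (harm n) \<le> exp 1 * real n"
proof -
  assume n: "1 \<le> n"
  have "exp (harm n) \<le> exp (1 + ln (real n))" using harm_le_ln[OF n] by (simp only: exp_le_cancel_iff)
  then show ?thesis using n by (simp add: exp_add)
qed

lemma exp_neg_le_power_inverse:
  assumes "0 < (z::real)" "0 < p"
  shows "exp (- z) \<le> (p / z) powr p"
proof -
  have "z / p \<le> exp (z / p)" using exp_ge_add_one_self[of "z / p"] by linarith
  then have "(z / p) powr p \<le> exp (z / p) powr p" using assms by (intro powr_mono2) auto
  also have "\<dots> = exp z" using assms by (simp add: powr_def)
  finally have "exp (- z) * (z / p) powr p \<le> exp (- z) * exp z" by (intro mult_left_mono) auto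
  then have "exp (- z) * (z / p) powr p \<le> 1" by (simp add: exp_add[symmetric])
  then have "exp (- z) \<le> 1 / (z / p) powr p" using assms by (subst pos_le_divide_eq) auto
  also have "\<dots> = (p / z) powr p" using assms by (simp add: powr_divide)
  finally show ?thesis .
qed

lemma summable_exp_neg_powr:
  assumes "0 < c" "0 < e"
  shows "summable (\<lambda>k. exp (- (c * real k powr e)))"
proof (rule summable_comparison_test_ev)
  define p where "p = 2 / e"
  show "summable (\<lambda>k. (p / c) powr p * inverse (real k ^ 2))"
    by (intro summable_mult inverse_power_summable) simp
  show "\<forall>\<^sub>F k in sequentially. norm (exp (- (c * real k powr e))) \<le> (p / c) powr p * inverse (real k ^ 2)"
    using eventually_ge_at_top[of 1]
  proof eventually_elim
    case (elim k)
    have p: "0 < p" using assms by (simp add: p_def)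
    have "exp (- (c * real k powr e)) \<le> (p / (c * real k powr e)) powr p"
      using elim assms p by (intro exp_neg_le_power_inverse) auto
    also have "\<dots> = (p / c) powr p / (real k powr e) powr p"
      using elim assms p by (simp add: powr_divide powr_mult)
    also have "(real k powr e) powr p = real k powr 2" using assms by (simp add: powr_powr p_def)
    also have "real k powr 2 = real k ^ 2" using elim by (simp add: powr_numeral)
    finally show ?case by (simp add: divide_inverse)
  qed
qed

text \<open>On \<open>[1, \<infinity>)\<close> the logarithm has slope at most 1. Negative
  \<open>\<theta>\<close> occurs for \<open>d = 1\<close> in \<open>AE_F_lower\<close>.\<close>

lemma add_ln_mono:
  assumes "1 \<le> a" "a \<le> b" "-1 \<le> (\<theta>::real)"
  shows "a + \<theta> * ln a \<le> b + \<theta> * ln b"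
proof -
  have "0 \<le> ln b - ln a" using assms by simp
  moreover have "ln b - ln a \<le> b - a"
  proof -
    have "ln b - ln a = ln (b / a)" using assms by (simp add: ln_div)
    also have "\<dots> \<le> b / a - 1" using assms by (intro ln_le_minus_one) auto
    also have "\<dots> = (b - a) / a" using assms by (simp add: field_simps)
    also have "\<dots> \<le> (b - a) / 1" using assms by (intro divide_left_mono) auto
    finally show ?thesis by simp
  qed
  moreover have "- 1 * (ln b - ln a) \<le> \<theta> * (ln b - ln a)"
    using assms \<open>0 \<le> ln b - ln a\<close> by (intro mult_right_mono)
  ultimately show ?thesis by (simp add: algebra_simps)
qed


section \<open>Distribution of the frontier maximum\<close>

context exp_sample
begin

definition S :: "nat \<Rightarrow> 'a \<Rightarrow> real" where
  "S i \<omega> = coord_sum (X i \<omega>)"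

definition F :: "nat \<Rightarrow> 'a \<Rightarrow> real" where
  "F n \<omega> = Fplus (\<lambda>i. X i \<omega>) n"

lemma d_ge_1: "1 \<le> CARD('d)"
  by (simp add: Suc_le_eq)

lemma S_measurable: "1 \<le> i \<Longrightarrow> S i \<in> borel_measurable M"
  unfolding S_def coord_sum_def using X_measurable by (intro borel_measurable_sum borel_measurable_vec_nth)

text \<open>Measurability cannot be settled only up to a null set, so paths with nonpositive
  coordinates are covered too, through the case distinction of \<open>Fplus_eq\<close>.\<close>

lemma F_measurable [measurable]: "F n \<in> borel_measurable M"
proof (subst borel_measurable_iff_le, intro allI)
  fix x
  have [measurable]: "Measurable.pred M (\<lambda>\<omega>. \<forall>j. 0 < X i \<omega> $ j)" "Measurable.pred M (\<lambda>\<omega>. S i \<omega> \<le> x)"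
    if "i \<in> {1..n}" for i
  proof -
    have [measurable]: "X i \<in> borel_measurable M" "S i \<in> borel_measurable M"
      using that X_measurable S_measurable by auto
    show "Measurable.pred M (\<lambda>\<omega>. \<forall>j. 0 < X i \<omega> $ j)" "Measurable.pred M (\<lambda>\<omega>. S i \<omega> \<le> x)"
      by measurable
  qed
  have "F n \<omega> \<le> x \<longleftrightarrow> (\<forall>i\<in>{1..n}. \<not> (\<forall>j. 0 < X i \<omega> $ j)) \<and> Sup {} \<le> x
     \<or> (\<exists>i\<in>{1..n}. \<forall>j. 0 < X i \<omega> $ j) \<and> (\<forall>i\<in>{1..n}. (\<forall>j. 0 < X i \<omega> $ j) \<longrightarrow> S i \<omega> \<le> x)" for \<omega>
  proof (cases "{i \<in> {1..n}. \<forall>j. 0 < X i \<omega> $ j} = {}")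
    case True
    then show ?thesis unfolding F_def Fplus_eq by auto
  next
    case False
    then show ?thesis unfolding F_def Fplus_eq S_def by (subst if_not_P, assumption, subst Max_le_iff) auto
  qed
  moreover have "Measurable.pred M (\<lambda>\<omega>. (\<forall>i\<in>{1..n}. \<not> (\<forall>j. 0 < X i \<omega> $ j)) \<and> Sup {} \<le> x
     \<or> (\<exists>i\<in>{1..n}. \<forall>j. 0 < X i \<omega> $ j) \<and> (\<forall>i\<in>{1..n}. (\<forall>j. 0 < X i \<omega> $ j) \<longrightarrow> S i \<omega> \<le> x))"
    by (intro pred_intros_logic pred_intros_finite; simp)
  ultimately show "{\<omega> \<in> space M. F n \<omega> \<le> x} \<in> sets M" by simp
qed

lemma record_time_measurable [measurable]:
  "(\<lambda>\<omega>. record_time (\<lambda>i. X i \<omega>) m) \<in> measurable M (count_space UNIV)"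
proof -
  have "Measurable.pred M (\<lambda>\<omega>. is_record (\<lambda>i. X i \<omega>) k \<and> rec_count (\<lambda>i. X i \<omega>) k = m)" for k
    by measurable
  then show ?thesis unfolding record_time_def rec_count_def by (rule measurable_Least)
qed

lemma Ftilde_measurable [measurable]: "(\<lambda>\<omega>. Ftilde (\<lambda>i. X i \<omega>) m) \<in> borel_measurable M"
  using measurable_compose_countable[OF F_measurable record_time_measurable]
  by (simp add: Ftilde_def F_def)

lemma AE_X_pos: "AE \<omega> in M. \<forall>i\<ge>1. \<forall>j. 0 < X i \<omega> $ j"
proof -
  have "AE \<omega> in M. 0 < X i \<omega> $ j" if i: "1 \<le> i" for i j
  proof -
    have [measurable]: "X i \<in> borel_measurable M" using i by (rule X_measurable)
    have "\<P>(\<omega> in M. X i \<omega> $ j \<le> 0) = 0"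
      using exponential_distributedD_le[OF exp_coords[OF i], of 0 j] by simp
    then have "AE \<omega> in M. \<not> X i \<omega> $ j \<le> 0"
      by (subst (asm) prob_Collect_eq_0) auto
    then show ?thesis by (simp add: not_le)
  qed
  then show ?thesis by (auto simp: AE_all_countable)
qed

lemma indep_S: "indep_vars (\<lambda>_. borel) S {1..}"
proof -
  have "coord_sum \<in> borel_measurable (borel :: (real^'d) measure)"
    unfolding coord_sum_def by (intro borel_measurable_sum borel_measurable_vec_nth) simp
  then have "indep_vars (\<lambda>_. borel) (\<lambda>i \<omega>. coord_sum (X i \<omega>)) {1..}"
    by (intro indep_vars_compose2[OF indep_X])
  then show ?thesis by (simp add: S_def[abs_def])
qed

lemma prob_S_le:
  assumes i: "1 \<le> i" and x: "0 \<le> x"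
  shows "\<P>(\<omega> in M. S i \<omega> \<le> x) = 1 - gamma_tail CARD('d) x"
proof -
  have "distributed M lborel (\<lambda>\<omega>. \<Sum>j\<in>UNIV. X i \<omega> $ j) (erlang_density (CARD('d) - 1) 1)"
    by (rule exponential_distributed_sum) (auto intro: exp_coords i indep_coord)
  from erlang_distributed_le[OF this _ x]
  have "\<P>(\<omega> in M. S i \<omega> \<le> x) = 1 - (\<Sum>n\<le>CARD('d) - 1. x ^ n * exp (- x) / fact n)"
    using x by (simp add: S_def coord_sum_def erlang_CDF_def)
  also have "(\<Sum>n\<le>CARD('d) - 1. x ^ n * exp (- x) / fact n) = gamma_tail CARD('d) x"
  proof -
    have "{..CARD('d) - 1} = {..<CARD('d)}"
      by (intro set_eqI, unfold atMost_iff lessThan_iff) (use d_ge_1 in linarith)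
    then show ?thesis by (simp add: gamma_tail_def sum_distrib_right)
  qed
  finally show ?thesis .
qed

lemma prob_S_all_le:
  assumes I: "I \<noteq> {}" "finite I" "I \<subseteq> {1..}" and x: "\<And>i. i \<in> I \<Longrightarrow> 0 \<le> x i"
  shows "\<P>(\<omega> in M. \<forall>i\<in>I. S i \<omega> \<le> x i) = (\<Prod>i\<in>I. 1 - gamma_tail CARD('d) (x i))"
proof -
  have "{\<omega> \<in> space M. \<forall>i\<in>I. S i \<omega> \<le> x i} = (\<Inter>i\<in>I. S i -` {..x i} \<inter> space M)"
    using I(1) by auto
  then have "\<P>(\<omega> in M. \<forall>i\<in>I. S i \<omega> \<le> x i) = (\<Prod>i\<in>I. prob (S i -` {..x i} \<inter> space M))"
    using indep_varsD_finite[OF indep_vars_subset[OF indep_S I(3)] I(1,2), of "\<lambda>i. {..x i}"] by simp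
  also have "\<dots> = (\<Prod>i\<in>I. 1 - gamma_tail CARD('d) (x i))"
  proof (intro prod.cong refl)
    fix i assume "i \<in> I"
    then have "\<P>(\<omega> in M. S i \<omega> \<le> x i) = 1 - gamma_tail CARD('d) (x i)"
      using I x by (intro prob_S_le) auto
    moreover have "S i -` {..x i} \<inter> space M = {\<omega> \<in> space M. S i \<omega> \<le> x i}" by auto
    ultimately show "prob (S i -` {..x i} \<inter> space M) = 1 - gamma_tail CARD('d) (x i)" by simp
  qed
  finally show ?thesis .
qed

lemma gamma_tail_le_1: "0 \<le> x \<Longrightarrow> gamma_tail CARD('d) x \<le> 1"
  using prob_S_le[of 1 x] measure_nonneg[of M "{\<omega> \<in> space M. S 1 \<omega> \<le> x}"] by simp

lemma prob_F_le:
  assumes n: "1 \<le> n" and x: "0 \<le> x"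
  shows "\<P>(\<omega> in M. F n \<omega> \<le> x) = (1 - gamma_tail CARD('d) x) ^ n"
proof -
  have "\<P>(\<omega> in M. F n \<omega> \<le> x) = \<P>(\<omega> in M. \<forall>i\<in>{1..n}. S i \<omega> \<le> x)"
  proof (rule measure_eq_AE)
    show "AE \<omega> in M. (\<omega> \<in> {\<omega> \<in> space M. F n \<omega> \<le> x}) = (\<omega> \<in> {\<omega> \<in> space M. \<forall>i\<in>{1..n}. S i \<omega> \<le> x})"
      using AE_X_pos
    proof eventually_elim
      case (elim \<omega>)
      have "F n \<omega> \<le> x \<longleftrightarrow> (\<forall>i\<in>{1..n}. S i \<omega> \<le> x)"
        unfolding F_def S_def by (rule Fplus_le_iff[OF _ n]) (use elim in auto)
      then show ?case by auto
    qed
    have [measurable]: "Measurable.pred M (\<lambda>\<omega>. S i \<omega> \<le> x)" if "i \<in> {1..n}" for i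
    proof -
      have [measurable]: "S i \<in> borel_measurable M" using that S_measurable by auto
      show ?thesis by measurable
    qed
    have "Measurable.pred M (\<lambda>\<omega>. \<forall>i\<in>{1..n}. S i \<omega> \<le> x)" by (intro pred_intros_finite) auto
    then show "{\<omega> \<in> space M. \<forall>i\<in>{1..n}. S i \<omega> \<le> x} \<in> sets M" by simp
  qed measurable
  also have "\<dots> = (1 - gamma_tail CARD('d) x) ^ n"
    using n x by (subst prob_S_all_le) auto
  finally show ?thesis .
qed

lemma prob_F_tendsto_gumbel:
  assumes n: "filterlim n at_top G"
    and x: "((\<lambda>m. x m - (ln (real (n m)) + real (CARD('d) - 1) * ln (ln (real (n m))) - ln (fact (CARD('d) - 1)))) \<longlongrightarrow> y) G"
  shows "((\<lambda>m. \<P>(\<omega> in M. F (n m) \<omega> \<le> x m)) \<longlongrightarrow> exp (- exp (- y))) G"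
proof -
  note l = gamma_tail_gumbel[OF d_ge_1 n x]
  have "\<forall>\<^sub>F m in G. (1 - gamma_tail CARD('d) (x m)) ^ n m = \<P>(\<omega> in M. F (n m) \<omega> \<le> x m)"
    using l(2)[unfolded filterlim_at_top, rule_format, of 0] n[unfolded filterlim_at_top, rule_format, of 1]
    by eventually_elim (simp add: prob_F_le)
  with l(1) show ?thesis by (simp add: tendsto_cong)
qed

text \<open>A union bound with \<open>n <= exp (harm n)\<close>: at the level
  \<open>x = harm n + t * ln (harm n)\<close> the factor \<open>exp (harm n - x)\<close> is
  \<open>harm n powr (- t)\<close>. The upper limit on \<open>t\<close> keeps \<open>x\<close> below
  \<open>(d + 2) * harm n\<close>, so the constant does not depend on \<open>t\<close>.\<close>

lemma prob_F_gt_le: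
  assumes t: "0 \<le> t" "t \<le> real CARD('d) + 1" and n: "1 \<le> n"
  shows "\<P>(\<omega> in M. harm n + t * ln (harm n) < F n \<omega>)
     \<le> real CARD('d) * (real CARD('d) + 2) ^ (CARD('d) - 1) * harm n powr (real (CARD('d) - 1) - t)"
proof -
  let ?d = "CARD('d)"
  let ?h = "harm n :: real"
  define x where "x = ?h + t * ln ?h"
  have h: "1 \<le> ?h" using n by (rule harm_ge_1)
  have ln: "0 \<le> ln ?h" "ln ?h \<le> ?h" using h n ln_le_minus_one[of ?h] by auto
  have "t * ln ?h \<le> (real ?d + 1) * ?h" using t ln by (intro mult_mono) auto
  moreover have "0 \<le> t * ln ?h" using t(1) ln(1) by (rule mult_nonneg_nonneg)
  ultimately have x: "1 \<le> x" "x \<le> (real ?d + 2) * ?h" using h by (auto simp: x_def algebra_simps)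
  have T: "0 \<le> gamma_tail ?d x" "gamma_tail ?d x \<le> 1" using x gamma_tail_nonneg gamma_tail_le_1 by auto
  have "{\<omega> \<in> space M. x < F n \<omega>} = space M - {\<omega> \<in> space M. F n \<omega> \<le> x}" by auto
  then have "\<P>(\<omega> in M. x < F n \<omega>) = 1 - (1 - gamma_tail ?d x) ^ n"
    using x prob_F_le[OF n, of x] by (simp add: prob_compl)
  also have "\<dots> \<le> real n * gamma_tail ?d x"
    using Bernoulli_inequality[of "- gamma_tail ?d x" n] T by simp
  also have "\<dots> \<le> exp ?h * (real ?d * x ^ (?d - 1) * exp (- x))"
    using x d_ge_1 T by (intro mult_mono le_exp_harm n gamma_tail_le) auto
  also have "\<dots> = real ?d * x ^ (?d - 1) * exp (?h - x)" by (simp add: exp_diff exp_minus divide_inverse)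
  also have "exp (?h - x) = ?h powr (- t)" using h by (simp add: x_def powr_def)
  also have "real ?d * x ^ (?d - 1) * ?h powr (- t) \<le> real ?d * ((real ?d + 2) * ?h) ^ (?d - 1) * ?h powr (- t)"
    using x by (intro mult_right_mono mult_left_mono power_mono) auto
  also have "\<dots> = real ?d * (real ?d + 2) ^ (?d - 1) * (?h powr real (?d - 1) * ?h powr (- t))"
  proof -
    have "?h powr real (?d - 1) = ?h ^ (?d - 1)" by (rule powr_realpow) (use n in simp)
    then show ?thesis by (simp only: power_mult_distrib mult.assoc)
  qed
  also have "?h powr real (?d - 1) * ?h powr (- t) = ?h powr (real (?d - 1) - t)"
    by (simp add: powr_add[symmetric])
  finally show ?thesis by (simp add: x_def)
qed

text \<open>The bound is \<open>(1 - T) ^ n <= exp (- n * T)\<close> for the tail \<open>T\<close>.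
  The condition on \<open>t\<close> ensures \<open>x >= harm n / 2\<close>, the source of
  \<open>2 ^ (d - 1)\<close>, and \<open>exp 1\<close> comes from
  \<open>exp (harm n) <= exp 1 * n\<close>.\<close>

lemma prob_F_le_le:
  assumes t: "-1/2 \<le> t" and n: "1 \<le> n"
  shows "\<P>(\<omega> in M. F n \<omega> \<le> harm n + t * ln (harm n))
     \<le> exp (- (1 / (exp 1 * 2 ^ (CARD('d) - 1) * fact (CARD('d) - 1)) * harm n powr (real (CARD('d) - 1) - t)))"
proof -
  let ?d = "CARD('d)"
  let ?h = "harm n :: real"
  define x where "x = ?h + t * ln ?h"
  have h: "1 \<le> ?h" using n by (rule harm_ge_1)
  have ln: "0 \<le> ln ?h" "ln ?h \<le> ?h" using h n ln_le_minus_one[of ?h] by auto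
  have "(-1/2) * ln ?h \<le> t * ln ?h" using t ln by (intro mult_right_mono) auto
  then have x: "?h / 2 \<le> x" using h t ln by (auto simp: x_def algebra_simps)
  have x0: "0 \<le> x" using x h by linarith
  have T: "0 \<le> gamma_tail ?d x" "gamma_tail ?d x \<le> 1" using x0 gamma_tail_nonneg gamma_tail_le_1 by auto
  have "\<P>(\<omega> in M. F n \<omega> \<le> x) = (1 - gamma_tail ?d x) ^ n" by (rule prob_F_le[OF n x0])
  also have "\<dots> \<le> exp (- gamma_tail ?d x) ^ n"
    using T exp_ge_add_one_self[of "- gamma_tail ?d x"] by (intro power_mono) auto
  also have "\<dots> = exp (- (real n * gamma_tail ?d x))" by (simp add: exp_of_nat_mult[symmetric])
  also have "\<dots> \<le> exp (- (1 / (exp 1 * 2 ^ (?d - 1) * fact (?d - 1)) * ?h powr (real (?d - 1) - t)))"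
  proof -
    have "1 / (exp 1 * 2 ^ (?d - 1) * fact (?d - 1)) * ?h powr (real (?d - 1) - t)
       = exp ?h / exp 1 * ((?h / 2) ^ (?d - 1) / fact (?d - 1) * exp (- x))"
    proof -
      have "?h powr (real (?d - 1) - t) = ?h powr real (?d - 1) * ?h powr (- t)"
        by (simp add: powr_add[symmetric])
      also have "?h powr (- t) = exp ?h * exp (- x)"
        using h n by (simp add: x_def powr_def exp_add[symmetric])
      also have "?h powr real (?d - 1) = ?h ^ (?d - 1)" by (rule powr_realpow) (use n in simp)
      finally show ?thesis by (simp add: power_divide mult_ac)
    qed
    also have "\<dots> \<le> real n * gamma_tail ?d x"
    proof (intro mult_mono)
      show "exp ?h / exp 1 \<le> real n" using exp_harm_le[OF n] by (simp add: divide_le_eq mult.commute)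
      have "(?h / 2) ^ (?d - 1) / fact (?d - 1) * exp (- x) \<le> x ^ (?d - 1) / fact (?d - 1) * exp (- x)"
        using x h by (intro mult_right_mono divide_right_mono power_mono) auto
      also have "\<dots> \<le> gamma_tail ?d x" by (rule gamma_tail_ge[OF x0 d_ge_1])
      finally show "(?h / 2) ^ (?d - 1) / fact (?d - 1) * exp (- x) \<le> gamma_tail ?d x" .
    qed (use h in auto)
    finally show ?thesis by simp
  qed
  finally show ?thesis by (simp add: x_def)
qed

section \<open>Almost sure bounds on the frontier maximum\<close>

lemma AE_F_mono: "AE \<omega> in M. \<forall>m n. 1 \<le> m \<longrightarrow> m \<le> n \<longrightarrow> F m \<omega> \<le> F n \<omega>"
  using AE_X_pos by eventually_elim (auto simp: F_def intro!: Fplus_mono)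

text \<open>At integer levels \<open>k\<close> of \<open>harm\<close> the exceedance probability is
  of order \<open>k powr (-1 - e)\<close>; summability over \<open>k\<close> demands the coefficient
  \<open>d\<close> instead of the typical \<open>d - 1\<close>. The shift by 2 fills the gap to the
  next sampling time.\<close>

lemma AE_F_upper:
  assumes e: "0 < e" "e \<le> 1"
  shows "AE \<omega> in M. \<forall>\<^sub>F n in sequentially. F n \<omega> \<le> harm n + 2 + (real CARD('d) + e) * ln (harm n + 2)"
proof -
  define C where "C = real CARD('d) * (real CARD('d) + 2) ^ (CARD('d) - 1)"
  define N where "N k = harm_index (real k)" for k :: nat
  define t where "t = real CARD('d) + e"
  have N1: "1 \<le> N k" for k unfolding N_def by (rule harm_index)
  have "AE \<omega> in M. \<forall>\<^sub>F k in sequentially. \<not> (harm (N k) + t * ln (harm (N k)) < F (N k) \<omega>)"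
  proof (rule borel_cantelli_AE[where f = "\<lambda>k. C * real k powr (-1 - e)"])
    show "\<forall>\<^sub>F k in sequentially. \<P>(\<omega> in M. harm (N k) + t * ln (harm (N k)) < F (N k) \<omega>) \<le> C * real k powr (-1 - e)"
      using eventually_ge_at_top[of 1]
    proof eventually_elim
      case (elim k)
      have "\<P>(\<omega> in M. harm (N k) + t * ln (harm (N k)) < F (N k) \<omega>) \<le> C * harm (N k) powr (real (CARD('d) - 1) - t)"
        unfolding C_def using e by (intro prob_F_gt_le N1) (auto simp: t_def)
      also have "real (CARD('d) - 1) - t = -1 - e" using d_ge_1 by (simp add: t_def of_nat_diff)
      also have "harm (N k) powr (-1 - e) \<le> real k powr (-1 - e)"
        using elim e harm_index(2)[of "real k"] by (intro powr_mono2') (auto simp: N_def)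
      finally show ?case by (simp add: C_def mult_left_mono)
    qed
    show "summable (\<lambda>k. C * real k powr (-1 - e))"
      using e by (intro summable_mult) (simp add: summable_real_powr_iff)
  qed measurable
  with AE_F_mono show ?thesis
  proof eventually_elim
    case (elim \<omega>)
    then obtain K where K: "\<And>k. K \<le> k \<Longrightarrow> F (N k) \<omega> \<le> harm (N k) + t * ln (harm (N k))"
      by (auto simp: eventually_sequentially not_less)
    have "\<forall>\<^sub>F n in sequentially. real K \<le> harm n"
      using harm_at_top by (simp add: filterlim_at_top)
    then show ?case using eventually_ge_at_top[of 1]
    proof eventually_elim
      case (elim n)
      define k where "k = nat \<lfloor>harm n :: real\<rfloor>"
      note k = harm_index_floor[OF elim(2), folded k_def]
      have "K \<le> k" using elim(1) k(3) by linarith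
      have h: "1 \<le> (harm (N (Suc k)) :: real)" "harm (N (Suc k)) \<le> harm n + (2::real)"
      proof -
        show "1 \<le> (harm (N (Suc k)) :: real)" by (intro harm_ge_1 N1)
        have "harm (N (Suc k)) \<le> real (Suc k) + 1" unfolding N_def by (intro harm_harm_index_le_Suc) simp
        then show "harm (N (Suc k)) \<le> harm n + (2::real)" using k by linarith
      qed
      have "F n \<omega> \<le> F (N (Suc k)) \<omega>" using \<open>\<forall>m n. _ m n\<close> elim(2) k(5) unfolding N_def by blast
      also have "\<dots> \<le> harm (N (Suc k)) + t * ln (harm (N (Suc k)))" using \<open>K \<le> k\<close> by (intro K) auto
      also have "\<dots> \<le> (harm n + 2) + t * ln (harm n + 2)"
        using h e by (intro add_ln_mono) (auto simp: t_def)
      finally show ?case by (simp add: t_def)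
    qed
  qed
qed

text \<open>Here the probabilities are at most \<open>exp (- c * k powr e)\<close>, summable for
  every \<open>e > 0\<close>, so the coefficient can approach the typical \<open>d - 1\<close>. The
  shift by 1 reaches back to the previous sampling time.\<close>

lemma AE_F_lower:
  assumes e: "0 < e" "e \<le> 1/2"
  shows "AE \<omega> in M. \<forall>\<^sub>F n in sequentially. harm n - 1 + (real (CARD('d) - 1) - e) * ln (harm n - 1) \<le> F n \<omega>"
proof -
  define c :: real where "c = 1 / (exp 1 * 2 ^ (CARD('d) - 1) * fact (CARD('d) - 1))"
  have c: "0 < c" by (simp add: c_def)
  define N where "N k = harm_index (real k)" for k :: nat
  define t where "t = real (CARD('d) - 1) - e"
  have t: "-1/2 \<le> t" using e of_nat_0_le_iff[of "CARD('d) - 1", where ?'a = real] unfolding t_def by linarith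
  have N1: "1 \<le> N k" for k unfolding N_def by (rule harm_index)
  have "AE \<omega> in M. \<forall>\<^sub>F k in sequentially. \<not> (F (N k) \<omega> \<le> harm (N k) + t * ln (harm (N k)))"
  proof (rule borel_cantelli_AE[where f = "\<lambda>k. exp (- (c * real k powr e))"])
    show "\<forall>\<^sub>F k in sequentially. \<P>(\<omega> in M. F (N k) \<omega> \<le> harm (N k) + t * ln (harm (N k))) \<le> exp (- (c * real k powr e))"
      using eventually_ge_at_top[of 1]
    proof eventually_elim
      case (elim k)
      have "\<P>(\<omega> in M. F (N k) \<omega> \<le> harm (N k) + t * ln (harm (N k))) \<le> exp (- (c * harm (N k) powr (real (CARD('d) - 1) - t)))"
        unfolding c_def by (intro prob_F_le_le N1 t)
      also have "real (CARD('d) - 1) - t = e" by (simp add: t_def)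
      also have "exp (- (c * harm (N k) powr e)) \<le> exp (- (c * real k powr e))"
        using e c harm_index(2)[of "real k"] by (simp, intro powr_mono2) (auto simp: N_def)
      finally show ?case .
    qed
    show "summable (\<lambda>k. exp (- (c * real k powr e)))" using c e(1) by (rule summable_exp_neg_powr)
  qed measurable
  with AE_F_mono show ?thesis
  proof eventually_elim
    case (elim \<omega>)
    then obtain K where "\<forall>k\<ge>K. \<not> F (N k) \<omega> \<le> harm (N k) + t * ln (harm (N k))"
      unfolding eventually_sequentially by blast
    then have K: "harm (N k) + t * ln (harm (N k)) \<le> F (N k) \<omega>" if "K \<le> k" for k
      using that by (simp add: not_le less_imp_le)
    have "\<forall>\<^sub>F n in sequentially. max (real (Suc K)) 2 \<le> harm n"
      using harm_at_top unfolding filterlim_at_top by blast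
    then show ?case using eventually_ge_at_top[of 1]
    proof eventually_elim
      case (elim n)
      define k where "k = nat \<lfloor>harm n :: real\<rfloor>"
      note k = harm_index_floor[OF elim(2), folded k_def]
      have "K \<le> k" using elim(1) k(3) by simp
      have "harm n - 1 + t * ln (harm n - 1) \<le> harm (N k) + t * ln (harm (N k))"
        using elim(1) k harm_index(2)[of "real k"] t unfolding N_def by (intro add_ln_mono) auto
      also have "\<dots> \<le> F (N k) \<omega>" using \<open>K \<le> k\<close> by (intro K) auto
      also have "\<dots> \<le> F n \<omega>" using \<open>\<forall>m n. _ m n\<close> N1[of k] k(4) unfolding N_def by blast
      finally show ?case by (simp add: t_def)
    qed
  qed
qed

text \<open>The event that all \<open>n >= m\<close> exceed the level lies in each single exceedance
  event, and the probabilities of these tend to 0.\<close>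

lemma AE_F_small_often:
  assumes e: "0 < e" "e \<le> 1"
  shows "AE \<omega> in M. \<exists>\<^sub>F n in sequentially. F n \<omega> \<le> harm n + (real (CARD('d) - 1) + e) * ln (harm n)"
proof -
  define C where "C = real CARD('d) * (real CARD('d) + 2) ^ (CARD('d) - 1)"
  define t where "t = real (CARD('d) - 1) + e"
  define A where "A n = {\<omega> \<in> space M. harm n + t * ln (harm n) < F n \<omega>}" for n
  have A[measurable]: "A n \<in> sets M" for n unfolding A_def by measurable
  have lim: "(\<lambda>n. prob (A n)) \<longlonglongrightarrow> 0"
  proof (rule tendsto_sandwich[where f = "\<lambda>_. 0" and h = "\<lambda>n. C * harm n powr (- e)"])
    show "\<forall>\<^sub>F n in sequentially. prob (A n) \<le> C * harm n powr (- e)"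
      using eventually_ge_at_top[of 1]
    proof eventually_elim
      case (elim n)
      have "prob (A n) \<le> C * harm n powr (real (CARD('d) - 1) - t)"
        unfolding A_def C_def using e elim d_ge_1 by (intro prob_F_gt_le) (auto simp: t_def)
      then show ?case by (simp add: t_def)
    qed
    have "(\<lambda>n. C * harm n powr (- e)) \<longlonglongrightarrow> C * 0"
      using e by (intro tendsto_intros tendsto_neg_powr harm_at_top) auto
    then show "(\<lambda>n. C * harm n powr (- e)) \<longlonglongrightarrow> 0" by simp
  qed auto
  have "AE \<omega> in M. \<not> (\<forall>n\<ge>m. \<omega> \<in> A n)" for m
  proof -
    have sets: "{\<omega> \<in> space M. \<forall>n\<ge>m. \<omega> \<in> A n} \<in> sets M" by measurable
    have "\<P>(\<omega> in M. \<forall>n\<ge>m. \<omega> \<in> A n) \<le> 0"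
    proof (rule tendsto_lowerbound[OF lim])
      show "\<forall>\<^sub>F n in sequentially. \<P>(\<omega> in M. \<forall>n\<ge>m. \<omega> \<in> A n) \<le> prob (A n)"
        using eventually_ge_at_top[of m]
        by eventually_elim (intro finite_measure_mono, auto)
    qed simp
    then have "\<P>(\<omega> in M. \<forall>n\<ge>m. \<omega> \<in> A n) = 0" by (simp add: measure_le_0_iff)
    then show ?thesis using sets by (subst (asm) prob_Collect_eq_0) auto
  qed
  then have "AE \<omega> in M. \<forall>m. \<not> (\<forall>n\<ge>m. \<omega> \<in> A n)" by (simp add: AE_all_countable)
  then show ?thesis
  proof (rule AE_mp, intro AE_I2 impI)
    fix \<omega> assume \<omega>: "\<omega> \<in> space M" "\<forall>m. \<not> (\<forall>n\<ge>m. \<omega> \<in> A n)"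
    show "\<exists>\<^sub>F n in sequentially. F n \<omega> \<le> harm n + (real (CARD('d) - 1) + e) * ln (harm n)"
      unfolding frequently_sequentially
    proof
      fix m
      from \<omega>(2) obtain n where "n \<ge> m" "\<omega> \<notin> A n" by auto
      then show "\<exists>n\<ge>m. F n \<omega> \<le> harm n + (real (CARD('d) - 1) + e) * ln (harm n)"
        using \<omega>(1) by (auto simp: A_def t_def not_less)
    qed
  qed
qed

text \<open>The divergence half of Borel-Cantelli for the independent sums \<open>S i\<close>: the
  tail at \<open>x i\<close> is at least a constant times \<open>1 / (i * harm i)\<close>, whose sum
  diverges, so the probability that no later \<open>S i\<close> exceeds \<open>x i\<close> is
  0.\<close>

lemma AE_F_large_often:
  "AE \<omega> in M. \<exists>\<^sub>F n in sequentially. harm n + real CARD('d) * ln (harm n) < F n \<omega>"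
proof -
  define x where "x n = harm n + real CARD('d) * ln (harm n)" for n
  define c :: real where "c = 1 / (exp 1 * fact (CARD('d) - 1))"
  have c: "0 < c" by (simp add: c_def)
  have tail: "0 \<le> x n" "c * (1 / (real n * harm n)) \<le> gamma_tail CARD('d) (x n)" if n: "1 \<le> n" for n
  proof -
    let ?d = "CARD('d)" and ?h = "harm n :: real"
    have h: "1 \<le> ?h" using n by (rule harm_ge_1)
    have hx: "?h \<le> x n" using h by (simp add: x_def)
    then show x0: "0 \<le> x n" using h by linarith
    have "exp (- x n) = exp (- ?h) / ?h ^ ?d"
    proof -
      have "exp (real ?d * ln ?h) = ?h ^ ?d" using h n by (simp only: exp_of_nat_mult) simp
      then show ?thesis by (simp add: x_def exp_diff)
    qed
    moreover have "?h ^ ?d = ?h * ?h ^ (?d - 1)" using d_ge_1 by (simp add: power_eq_if)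
    moreover have "1 / (exp 1 * real n) \<le> exp (- ?h)"
    proof -
      have "1 / (exp 1 * real n) \<le> 1 / exp ?h"
        using exp_harm_le[OF n] n by (intro divide_left_mono) auto
      then show ?thesis by (simp add: exp_minus inverse_eq_divide)
    qed
    then have "1 / (exp 1 * real n) * (1 / (fact (?d - 1) * ?h)) \<le> exp (- ?h) * (1 / (fact (?d - 1) * ?h))"
      using h by (intro mult_right_mono) auto
    ultimately have "c * (1 / (real n * ?h)) \<le> ?h ^ (?d - 1) / fact (?d - 1) * exp (- x n)"
      using h n by (simp add: c_def mult_ac)
    also have "\<dots> \<le> x n ^ (?d - 1) / fact (?d - 1) * exp (- x n)"
      using hx h by (intro mult_right_mono divide_right_mono power_mono) auto
    also have "\<dots> \<le> gamma_tail ?d (x n)" by (rule gamma_tail_ge[OF x0 d_ge_1])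
    finally show "c * (1 / (real n * ?h)) \<le> gamma_tail ?d (x n)" .
  qed
  \<comment> \<open>Since \<open>ln y <= y - 1\<close>, the increment of \<open>ln (harm i)\<close>
    is at most \<open>1 / ((i + 1) * harm i)\<close>; the series thus diverges at least like
    \<open>ln (harm n)\<close>.\<close>
  have sums: "ln (harm (Suc n)) - ln (harm (Suc m)) \<le> (\<Sum>i=Suc m..n. 1 / (real i * harm i))" if m: "m \<le> n" for m n
  proof -
    have "ln (harm (Suc n)) - ln (harm (Suc m)) = (\<Sum>i=Suc m..n. ln (harm (Suc i)) - ln (harm i :: real))"
      using m by (subst sum_Suc_diff) auto
    also have "\<dots> \<le> (\<Sum>i=Suc m..n. 1 / (real i * harm i))"
    proof (rule sum_mono)
      fix i assume i: "i \<in> {Suc m..n}"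
      then have hp: "0 < (harm i :: real)" "0 < (harm (Suc i) :: real)" by auto
      have "ln (harm (Suc i)) - ln (harm i :: real) = ln (harm (Suc i) / harm i)"
        using hp by (intro ln_divide_pos[symmetric])
      also have "\<dots> \<le> harm (Suc i) / harm i - 1" using hp by (intro ln_le_minus_one divide_pos_pos)
      also have "\<dots> = 1 / (real (Suc i) * harm i)"
      proof -
        have "harm i \<noteq> (0::real)" using hp(1) by linarith
        then show ?thesis by (simp add: harm_Suc add_divide_distrib inverse_eq_divide del: of_nat_Suc)
      qed
      also have "\<dots> \<le> 1 / (real i * harm i)"
        using i hp by (intro divide_left_mono mult_right_mono mult_pos_pos) (auto simp: harm_nonneg)
      finally show "ln (harm (Suc i)) - ln (harm i :: real) \<le> 1 / (real i * harm i)" .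
    qed
    finally show ?thesis .
  qed
  have "AE \<omega> in M. \<not> (\<forall>i>m. S i \<omega> \<le> x i)" for m
  proof -
    define P where "P = \<P>(\<omega> in M. \<forall>i>m. S i \<omega> \<le> x i)"
    have [measurable]: "Measurable.pred M (\<lambda>\<omega>. S i \<omega> \<le> x i)" if "1 \<le> i" for i
    proof -
      have [measurable]: "S i \<in> borel_measurable M" using that S_measurable by auto
      show ?thesis by measurable
    qed
    have pm: "Measurable.pred M (\<lambda>\<omega>. \<forall>i>m. S i \<omega> \<le> x i)"
    proof -
      have "Measurable.pred M (\<lambda>\<omega>. i > m \<longrightarrow> S i \<omega> \<le> x i)" for i by (cases "i > m") auto
      then show ?thesis by (intro pred_intros_countable)
    qed
    have bnd: "P \<le> exp (- (c * (ln (harm (Suc n)) - ln (harm (Suc m)))))" if n: "m < n" for n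
    proof -
      have "Measurable.pred M (\<lambda>\<omega>. \<forall>i\<in>{Suc m..n}. S i \<omega> \<le> x i)" by (intro pred_intros_finite) auto
      then have "P \<le> \<P>(\<omega> in M. \<forall>i\<in>{Suc m..n}. S i \<omega> \<le> x i)"
        unfolding P_def by (intro finite_measure_mono) auto
      also have "\<dots> = (\<Prod>i\<in>{Suc m..n}. 1 - gamma_tail CARD('d) (x i))"
        using n tail(1) by (intro prob_S_all_le) auto
      also have "\<dots> \<le> (\<Prod>i\<in>{Suc m..n}. exp (- (c * (1 / (real i * harm i)))))"
      proof (intro prod_mono conjI)
        fix i assume i: "i \<in> {Suc m..n}"
        show "0 \<le> 1 - gamma_tail CARD('d) (x i)" using gamma_tail_le_1[of "x i"] tail(1)[of i] i by simp
        show "1 - gamma_tail CARD('d) (x i) \<le> exp (- (c * (1 / (real i * harm i))))"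
          using tail(2)[of i] i exp_ge_add_one_self[of "- (c * (1 / (real i * harm i)))"] by simp
      qed
      also have "\<dots> = exp (- (c * (\<Sum>i=Suc m..n. 1 / (real i * harm i))))"
        by (simp only: exp_sum[OF finite_atLeastAtMost, symmetric] sum_negf sum_distrib_left)
      also have "\<dots> \<le> exp (- (c * (ln (harm (Suc n)) - ln (harm (Suc m)))))"
        using sums[OF less_imp_le[OF n]] c by (simp only: exp_le_cancel_iff neg_le_iff_le mult_left_mono less_imp_le)
      finally show ?thesis .
    qed
    have ev: "\<forall>\<^sub>F n in sequentially. P \<le> exp (- (c * (ln (harm (Suc n)) - ln (harm (Suc m)))))"
      using eventually_gt_at_top[of m] by eventually_elim (rule bnd)
    have "filterlim (\<lambda>n. ln (harm (Suc n) :: real)) at_top sequentially"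
      by (intro filterlim_compose[OF ln_at_top] filterlim_compose[OF harm_at_top] filterlim_Suc)
    then have "filterlim (\<lambda>n. - ln (harm (Suc m)) + ln (harm (Suc n) :: real)) at_top sequentially"
      by (rule filterlim_tendsto_add_at_top[OF tendsto_const])
    then have "filterlim (\<lambda>n. c * (- ln (harm (Suc m)) + ln (harm (Suc n) :: real))) at_top sequentially"
      by (rule filterlim_tendsto_pos_mult_at_top[OF tendsto_const c])
    then have "(\<lambda>n. exp (- (c * (- ln (harm (Suc m)) + ln (harm (Suc n) :: real))))) \<longlonglongrightarrow> 0"
      by (intro filterlim_compose[OF exp_at_bot]) (simp add: filterlim_uminus_at_bot)
    then have "(\<lambda>n. exp (- (c * (ln (harm (Suc n)) - ln (harm (Suc m)))))) \<longlonglongrightarrow> 0" by (simp add: algebra_simps)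
    from tendsto_lowerbound[OF this ev] have "P \<le> 0" by simp
    then have "P = 0" unfolding P_def by (simp add: measure_le_0_iff)
    then show ?thesis unfolding P_def using pm by (subst (asm) prob_Collect_eq_0) auto
  qed
  then have "AE \<omega> in M. \<forall>m. \<not> (\<forall>i>m. S i \<omega> \<le> x i)" by (simp add: AE_all_countable)
  then show ?thesis using AE_X_pos
  proof eventually_elim
    case (elim \<omega>)
    show ?case unfolding frequently_sequentially
    proof
      fix m
      from elim(1) obtain i where i: "m < i" "x i < S i \<omega>" by (auto simp: not_le)
      have "S i \<omega> \<le> F i \<omega>" unfolding S_def F_def
        using elim(2) i(1) by (intro coord_sum_le_Fplus) auto
      with i show "\<exists>n\<ge>m. harm n + real CARD('d) * ln (harm n) < F n \<omega>"
        by (intro exI[of _ i]) (auto simp: x_def)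
    qed
  qed
qed

end


subsection \<open>Almost sure behaviour at the record times\<close>

lemma root_scale_at_top: "0 < d \<Longrightarrow> filterlim (\<lambda>m. root_scale d (real m)) at_top sequentially"
  unfolding filterlim_at_top_ge[where c = 0]
proof safe
  fix K :: real assume d: "0 < d" and K: "0 \<le> K"
  have "\<forall>\<^sub>F m in sequentially. K ^ d \<le> real m"
    using filterlim_real_sequentially by (simp add: filterlim_at_top)
  then show "\<forall>\<^sub>F m in sequentially. K \<le> root_scale d (real m)"
  proof eventually_elim
    case (elim m)
    have "K ^ d \<le> 1 * real m" using elim by simp
    also have "\<dots> \<le> fact d * real m" by (intro mult_right_mono) (auto simp: fact_ge_1)
    also have "\<dots> = root_scale d (real m) ^ d" using d by (simp add: root_scale_power)
    finally show ?case using d root_scale_nonneg by (simp add: power_mono_iff K)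
  qed
qed

lemma ln_root_scale: "0 < d \<Longrightarrow> 0 < x \<Longrightarrow> ln (root_scale d x) = (ln (fact d) + ln x) / real d"
  by (simp add: root_scale_def ln_powr ln_mult)

text \<open>On the scale of \<open>ln h\<close> the constants \<open>a\<close> and \<open>b\<close>
  vanish; they stand for the gaps between sampling times and for the bounded deviation of
  \<open>Z\<close>.\<close>

lemma ln_shift_ratio:
  fixes h :: "'b \<Rightarrow> real"
  assumes h: "filterlim h at_top F"
  shows "((\<lambda>n. (a + t * ln (h n + b)) / ln (h n)) \<longlongrightarrow> t) F"
proof -
  have lnh: "filterlim (\<lambda>n. ln (h n)) at_top F" by (rule filterlim_compose[OF ln_at_top h])
  have i: "((\<lambda>n. inverse (ln (h n))) \<longlongrightarrow> 0) F" by (rule tendsto_inverse_0_at_top[OF lnh])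
  have ih: "((\<lambda>n. inverse (h n)) \<longlongrightarrow> 0) F" by (rule tendsto_inverse_0_at_top[OF h])
  have "((\<lambda>n. a * inverse (ln (h n)) + t * (1 + ln (1 + b * inverse (h n)) * inverse (ln (h n)))) \<longlongrightarrow> a * 0 + t * (1 + ln (1 + b * 0) * 0)) F"
    by (intro tendsto_intros i ih) simp
  moreover have "\<forall>\<^sub>F n in F. a * inverse (ln (h n)) + t * (1 + ln (1 + b * inverse (h n)) * inverse (ln (h n)))
      = (a + t * ln (h n + b)) / ln (h n)"
    using h[unfolded filterlim_at_top, rule_format, of "max 1 (1 - b)"] lnh[unfolded filterlim_at_top, rule_format, of 1]
  proof eventually_elim
    case (elim n)
    have "h n + b = h n * (1 + b * inverse (h n))" using elim by (simp add: field_simps)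
    moreover from this have "0 < h n * (1 + b * inverse (h n))" using elim by linarith
    then have "0 < 1 + b * inverse (h n)" using elim by (simp add: zero_less_mult_iff)
    ultimately have "ln (h n + b) = ln (h n) + ln (1 + b * inverse (h n))" using elim by (simp add: ln_mult_pos)
    moreover have "a * inverse L + t * (1 + y * inverse L) = (a + t * (L + y)) / L" if "1 \<le> L" for L y
      using that by (simp add: field_simps)
    ultimately show ?case using elim by simp
  qed
  ultimately show ?thesis by (simp add: tendsto_cong)
qed

lemma add_ln_shift_ratio:
  fixes h :: "'b \<Rightarrow> real"
  assumes h: "filterlim h at_top F"
  shows "((\<lambda>n. (h n + a + t * ln (h n + b)) / h n) \<longlongrightarrow> 1) F"
proof -
  have ih: "((\<lambda>n. inverse (h n)) \<longlongrightarrow> 0) F" by (rule tendsto_inverse_0_at_top[OF h])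
  have "((\<lambda>n. 1 + a * inverse (h n) + ((0 + t * ln (h n + b)) / ln (h n)) * (ln (h n) / h n)) \<longlongrightarrow> 1 + a * 0 + t * 0) F"
    by (intro tendsto_intros ih ln_shift_ratio h filterlim_compose[OF ln_x_over_x_tendsto_0 h])
  moreover have "\<forall>\<^sub>F n in F. 1 + a * inverse (h n) + ((0 + t * ln (h n + b)) / ln (h n)) * (ln (h n) / h n) = (h n + a + t * ln (h n + b)) / h n"
    using h[unfolded filterlim_at_top, rule_format, of 1]
      filterlim_compose[OF ln_at_top h, unfolded filterlim_at_top, rule_format, of 1]
  proof eventually_elim
    case (elim n)
    have "1 + a * inverse H + ((0 + t * y) / L) * (L / H) = (H + a + t * y) / H" if "1 \<le> H" "1 \<le> L" for H L y
      using that by (simp add: field_simps)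
    then show ?case using elim by blast
  qed
  ultimately have "((\<lambda>n. (h n + a + t * ln (h n + b)) / h n) \<longlongrightarrow> 1 + a * 0 + t * 0) F"
    by (rule Lim_transform_eventually)
  then show ?thesis by simp
qed

lemma frequently_imp_Limsup_ge:
  assumes "\<exists>\<^sub>F m in G. y \<le> q m" shows "ereal y \<le> Limsup G (\<lambda>m. ereal (q m))"
proof (rule ccontr)
  assume "\<not> ?thesis"
  then have "Limsup G (\<lambda>m. ereal (q m)) < ereal y" by simp
  from Limsup_lessD[OF this] have "\<forall>\<^sub>F m in G. \<not> y \<le> q m" by (auto elim: eventually_mono)
  with assms show False by (simp add: frequently_def)
qed

lemma frequently_imp_Liminf_le:
  assumes "\<exists>\<^sub>F m in G. q m \<le> y" shows "Liminf G (\<lambda>m. ereal (q m)) \<le> ereal y"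
proof (rule ccontr)
  assume "\<not> ?thesis"
  then have "ereal y < Liminf G (\<lambda>m. ereal (q m))" by simp
  from less_LiminfD[OF this] have "\<forall>\<^sub>F m in G. \<not> q m \<le> y" by (auto elim: eventually_mono)
  with assms show False by (simp add: frequently_def)
qed

lemma ereal_le_of_tendsto:
  assumes "\<And>k. 1 \<le> k \<Longrightarrow> x \<le> ereal (f (k::nat))" "f \<longlonglongrightarrow> l" shows "x \<le> ereal l"
proof (rule tendsto_lowerbound)
  show "(\<lambda>k. ereal (f k)) \<longlonglongrightarrow> ereal l" using assms(2) by simp
  show "\<forall>\<^sub>F k in sequentially. x \<le> ereal (f k)" using eventually_ge_at_top[of 1] by eventually_elim (rule assms(1))
qed simp

lemma ereal_ge_of_tendsto:
  assumes "\<And>k. 1 \<le> k \<Longrightarrow> ereal (f (k::nat)) \<le> x" "f \<longlonglongrightarrow> l" shows "ereal l \<le> x"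
proof (rule tendsto_upperbound)
  show "(\<lambda>k. ereal (f k)) \<longlonglongrightarrow> ereal l" using assms(2) by simp
  show "\<forall>\<^sub>F k in sequentially. ereal (f k) \<le> x" using eventually_ge_at_top[of 1] by eventually_elim (rule assms(1))
qed simp

context exp_sample
begin

definition FT :: "nat \<Rightarrow> 'a \<Rightarrow> real" where
  "FT m \<omega> = Ftilde (\<lambda>i. X i \<omega>) m"

definition rec_scale :: "nat \<Rightarrow> real" where
  "rec_scale m = root_scale CARD('d) (real m)"

lemma d_pos: "0 < CARD('d)"
  by simp

lemma FT_measurable [measurable]: "FT m \<in> borel_measurable M"
  unfolding FT_def by measurable

lemma Z_eq_rec_scale: "Z n \<omega> = rec_scale (rec_count (\<lambda>i. X i \<omega>) n)"
  by (simp add: Z_def rec_scale_def R_def)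

lemma rec_scale_mono: "m \<le> n \<Longrightarrow> rec_scale m \<le> rec_scale n"
  unfolding rec_scale_def by (intro root_scale_mono) auto

lemma rec_scale_at_top: "filterlim rec_scale at_top sequentially"
  unfolding rec_scale_def by (rule root_scale_at_top) simp

lemma ln_rec_scale: "1 \<le> m \<Longrightarrow> ln (rec_scale m) = (ln (fact CARD('d)) + ln (real m)) / real CARD('d)"
  unfolding rec_scale_def by (rule ln_root_scale) auto

lemma Z_at_top: "(\<lambda>n. Z n \<omega> / harm n) \<longlonglongrightarrow> 1 \<Longrightarrow> filterlim (\<lambda>n. Z n \<omega>) at_top sequentially"
proof -
  assume "(\<lambda>n. Z n \<omega> / harm n) \<longlonglongrightarrow> 1"
  then have lim: "filterlim (\<lambda>n. Z n \<omega> / harm n * harm n) at_top sequentially"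
    by (rule filterlim_tendsto_pos_mult_at_top[OF _ _ harm_at_top]) simp
  have ev: "\<forall>\<^sub>F n in sequentially. Z n \<omega> / harm n * harm n = Z n \<omega>"
    using eventually_ge_at_top[of 1]
  proof eventually_elim
    case (elim n)
    then have "harm n \<noteq> (0::real)" using harm_ge_1[of n] by linarith
    then show ?case by simp
  qed
  show ?thesis using lim unfolding filterlim_cong[OF refl refl ev] .
qed

lemma rec_count_unbounded:
  assumes "(\<lambda>n. Z n \<omega> / harm n) \<longlonglongrightarrow> 1"
  shows "\<exists>n. m \<le> rec_count (\<lambda>i. X i \<omega>) n"
proof -
  have "\<forall>\<^sub>F n in sequentially. rec_scale m + 1 \<le> Z n \<omega>"
    using Z_at_top[OF assms] unfolding filterlim_at_top by blast
  then obtain n where "rec_scale m + 1 \<le> Z n \<omega>"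
    using eventually_happens'[OF sequentially_bot] by blast
  then have "\<not> rec_count (\<lambda>i. X i \<omega>) n \<le> m"
    using rec_scale_mono[of "rec_count (\<lambda>i. X i \<omega>) n" m] by (auto simp: Z_eq_rec_scale)
  then show ?thesis by (intro exI[of _ n]) simp
qed

lemma rec_count_at_top:
  assumes "(\<lambda>n. Z n \<omega> / harm n) \<longlonglongrightarrow> 1"
  shows "filterlim (\<lambda>n. rec_count (\<lambda>i. X i \<omega>) n) at_top sequentially"
  unfolding filterlim_at_top
proof
  fix m
  obtain N where "m \<le> rec_count (\<lambda>i. X i \<omega>) N" using rec_count_unbounded[OF assms] by blast
  then have "m \<le> rec_count (\<lambda>i. X i \<omega>) n" if "N \<le> n" for n
    using rec_count_mono[OF that, of "\<lambda>i. X i \<omega>"] by linarith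
  then show "\<forall>\<^sub>F n in sequentially. m \<le> rec_count (\<lambda>i. X i \<omega>) n"
    unfolding eventually_sequentially by blast
qed

text \<open>Every \<open>m\<close> is reached because the count is unbounded, and the
  \<open>m\<close>-th record comes no earlier than time \<open>m\<close> because at most
  \<open>n\<close> records occur up to time \<open>n\<close>.\<close>

lemma record_time_facts:
  assumes "(\<lambda>n. Z n \<omega> / harm n) \<longlonglongrightarrow> 1"
  shows "1 \<le> m \<Longrightarrow> rec_count (\<lambda>i. X i \<omega>) (record_time (\<lambda>i. X i \<omega>) m) = m"
    and "filterlim (\<lambda>m. record_time (\<lambda>i. X i \<omega>) m) at_top sequentially"
proof -
  have *: "rec_count (\<lambda>i. X i \<omega>) (record_time (\<lambda>i. X i \<omega>) m) = m" if "1 \<le> m" for m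
    using rec_count_unbounded[OF assms, of m] record_time_props[OF that] by blast
  then show "1 \<le> m \<Longrightarrow> rec_count (\<lambda>i. X i \<omega>) (record_time (\<lambda>i. X i \<omega>) m) = m" .
  have le: "rec_count Y n \<le> n" for Y :: "nat \<Rightarrow> real^'d" and n
  proof -
    have "rec_count Y n \<le> card {1..n}" unfolding rec_count_def by (rule card_mono) auto
    then show ?thesis by simp
  qed
  show "filterlim (\<lambda>m. record_time (\<lambda>i. X i \<omega>) m) at_top sequentially"
  proof (rule filterlim_at_top_mono[OF filterlim_ident])
    show "\<forall>\<^sub>F m in sequentially. m \<le> record_time (\<lambda>i. X i \<omega>) m"
      using eventually_ge_at_top[of 1]
      by eventually_elim (metis * le)
  qed
qed

lemma FT_eq_F: "FT m \<omega> = F (record_time (\<lambda>i. X i \<omega>) m) \<omega>"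
  by (simp add: FT_def F_def Ftilde_def)

lemma AE_F_asymp: "AE \<omega> in M. (\<lambda>n. F n \<omega> / harm n) \<longlonglongrightarrow> 1"
proof -
  have "AE \<omega> in M. \<forall>\<^sub>F n in sequentially. harm n - 1 + (real (CARD('d) - 1) - 1/2) * ln (harm n - 1) \<le> F n \<omega>"
    by (rule AE_F_lower) auto
  with AE_F_upper[of 1, OF zero_less_one order.refl] show ?thesis
  proof eventually_elim
    case (elim \<omega>)
    have h: "\<forall>\<^sub>F n in sequentially. 0 < (harm n :: real)"
      using eventually_ge_at_top[of 1] by eventually_elim simp
    show ?case
    proof (rule tendsto_sandwich)
      show "\<forall>\<^sub>F n in sequentially. (harm n + (- 1) + (real (CARD('d) - 1) - 1/2) * ln (harm n + (- 1))) / harm n \<le> F n \<omega> / harm n"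
        using elim(2) h by eventually_elim (auto intro!: divide_right_mono harm_nonneg)
      show "\<forall>\<^sub>F n in sequentially. F n \<omega> / harm n \<le> (harm n + 2 + (real CARD('d) + 1) * ln (harm n + 2)) / harm n"
        using elim(1) h by eventually_elim (auto intro!: divide_right_mono harm_nonneg)
    qed (intro add_ln_shift_ratio harm_at_top)+
  qed
qed

text \<open>\<open>F\<close> and \<open>Z\<close> are both asymptotic to \<open>harm\<close>, and at
  the \<open>m\<close>-th record time \<open>Z\<close> equals \<open>rec_scale m\<close>.\<close>

lemma AE_FT_asymp_equiv: "AE \<omega> in M. (\<lambda>m. FT m \<omega>) \<sim>[sequentially] rec_scale"
  using AE_F_asymp AE_Z_asymp
proof eventually_elim
  case (elim \<omega>)
  let ?T = "\<lambda>m. record_time (\<lambda>i. X i \<omega>) m"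
  have "(\<lambda>n. (F n \<omega> / harm n) / (Z n \<omega> / harm n)) \<longlonglongrightarrow> 1 / 1"
    by (intro tendsto_divide elim) simp
  from filterlim_compose[OF this record_time_facts(2)[OF elim(2)]]
  have "(\<lambda>m. (F (?T m) \<omega> / harm (?T m)) / (Z (?T m) \<omega> / harm (?T m))) \<longlonglongrightarrow> 1" by simp
  moreover have "\<forall>\<^sub>F m in sequentially. (F (?T m) \<omega> / harm (?T m)) / (Z (?T m) \<omega> / harm (?T m)) = FT m \<omega> / rec_scale m"
    using eventually_ge_at_top[of 1] record_time_facts(2)[OF elim(2), unfolded filterlim_at_top, rule_format, of 1]
  proof eventually_elim
    case (elim m)
    then have "harm (?T m) \<noteq> (0::real)" using harm_ge_1[of "?T m"] by linarith
    then show ?case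
      using record_time_facts(1)[OF \<open>(\<lambda>n. Z n \<omega> / harm n) \<longlonglongrightarrow> 1\<close> elim(1)]
      by (simp add: FT_eq_F Z_eq_rec_scale)
  qed
  ultimately have "(\<lambda>m. FT m \<omega> / rec_scale m) \<longlonglongrightarrow> 1" by (simp add: tendsto_cong)
  then show ?case by (rule asymp_equivI')
qed

text \<open>\<open>Z = (d! * R) powr (1 / d)\<close> is asymptotic to \<open>harm\<close>, so
  \<open>ln R\<close> is asymptotic to \<open>d * ln harm\<close>. This factor turns the
  coefficients \<open>d - 1\<close> and \<open>d\<close> of the frontier bounds into
  \<open>1 - 1 / d\<close> and 1.\<close>

lemma ln_R_ratio:
  assumes "(\<lambda>n. Z n \<omega> / harm n) \<longlonglongrightarrow> 1"
  shows "(\<lambda>n. ln (harm n) / ln (R n \<omega>)) \<longlonglongrightarrow> 1 / real CARD('d)"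
proof -
  let ?d = "real CARD('d)"
  have lnh: "filterlim (\<lambda>n. ln (harm n :: real)) at_top sequentially"
    by (intro filterlim_compose[OF ln_at_top harm_at_top])
  have i: "(\<lambda>n. inverse (ln (harm n :: real))) \<longlonglongrightarrow> 0" by (rule tendsto_inverse_0_at_top[OF lnh])
  have "(\<lambda>n. ?d * (1 + ln (Z n \<omega> / harm n) * inverse (ln (harm n))) - ln (fact CARD('d)) * inverse (ln (harm n)))
     \<longlonglongrightarrow> ?d * (1 + ln 1 * 0) - ln (fact CARD('d)) * 0"
    by (intro tendsto_intros i assms) simp
  moreover have "\<forall>\<^sub>F n in sequentially. ?d * (1 + ln (Z n \<omega> / harm n) * inverse (ln (harm n))) - ln (fact CARD('d)) * inverse (ln (harm n))
     = ln (R n \<omega>) / ln (harm n)"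
    using eventually_ge_at_top[of 1] lnh[unfolded filterlim_at_top, rule_format, of 1]
      rec_count_at_top[OF assms, unfolded filterlim_at_top, rule_format, of 1]
      Z_at_top[OF assms, unfolded filterlim_at_top, rule_format, of 1]
  proof eventually_elim
    case (elim n)
    have h: "0 < (harm n :: real)" using elim(1) by simp
    have "ln (Z n \<omega>) = (ln (fact CARD('d)) + ln (R n \<omega>)) / ?d"
      using elim(3) unfolding Z_eq_rec_scale R_def by (rule ln_rec_scale)
    then have "ln (R n \<omega>) = ?d * ln (Z n \<omega>) - ln (fact CARD('d))" by simp
    moreover have "ln (Z n \<omega> / harm n) = ln (Z n \<omega>) - ln (harm n)"
      using elim(4) h by (intro ln_divide_pos) auto
    ultimately show ?case using elim(2) by (simp add: field_simps)
  qed
  ultimately have "(\<lambda>n. ln (R n \<omega>) / ln (harm n)) \<longlonglongrightarrow> ?d" by (simp add: tendsto_cong)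
  then have "(\<lambda>n. inverse (ln (R n \<omega>) / ln (harm n))) \<longlonglongrightarrow> inverse ?d" by (rule tendsto_inverse) simp
  then show ?thesis by (simp add: inverse_eq_divide)
qed

lemma ln_shift_R_ratio:
  assumes "(\<lambda>n. Z n \<omega> / harm n) \<longlonglongrightarrow> 1"
  shows "(\<lambda>n. (a + t * ln (harm n + b)) / ln (R n \<omega>)) \<longlonglongrightarrow> t / real CARD('d)"
proof -
  have "(\<lambda>n. ((a + t * ln (harm n + b)) / ln (harm n)) * (ln (harm n) / ln (R n \<omega>))) \<longlonglongrightarrow> t * (1 / real CARD('d))"
    by (intro tendsto_mult ln_shift_ratio harm_at_top ln_R_ratio assms)
  moreover have "\<forall>\<^sub>F n in sequentially. ((a + t * ln (harm n + b)) / ln (harm n)) * (ln (harm n) / ln (R n \<omega>)) = (a + t * ln (harm n + b)) / ln (R n \<omega>)"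
    using filterlim_compose[OF ln_at_top harm_at_top, unfolded filterlim_at_top, rule_format, of 1]
  proof eventually_elim
    case (elim n)
    then have "ln (harm n :: real) \<noteq> 0" by linarith
    moreover have "x / l * (l / y) = x / y" if "l \<noteq> 0" for x l y :: real using that by simp
    ultimately show ?case by blast
  qed
  ultimately have "(\<lambda>n. (a + t * ln (harm n + b)) / ln (R n \<omega>)) \<longlonglongrightarrow> t * (1 / real CARD('d))"
    by (rule Lim_transform_eventually)
  then show ?thesis by simp
qed

text \<open>The bounded deviation of \<open>Z\<close> from \<open>harm\<close> is negligible against
  \<open>ln R\<close>, so the fluctuations are those of \<open>F\<close> around \<open>harm\<close>.
  They are passed between times (\<open>Q\<close>) and record numbers (\<open>q\<close>).\<close>

lemma AE_FT_liminf_limsup: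
  assumes d: "4 \<le> CARD('d)"
  shows "AE \<omega> in M. liminf (\<lambda>m. ereal ((FT m \<omega> - rec_scale m) / ln (real m))) = ereal (1 - 1 / real CARD('d))
     \<and> limsup (\<lambda>m. ereal ((FT m \<omega> - rec_scale m) / ln (real m))) = ereal 1"
proof -
  let ?d = "real CARD('d)"
  \<comment> \<open>Tolerances \<open>1 / k\<close> keep the exceptional null sets countable. The
    lower bound starts at \<open>k = 2\<close> because \<open>AE_F_lower\<close> asks for a
    tolerance of at most 1/2.\<close>
  have "AE \<omega> in M. \<forall>k\<ge>1. \<forall>\<^sub>F n in sequentially. F n \<omega> \<le> harm n + 2 + (?d + 1 / real k) * ln (harm n + 2)"
    unfolding AE_all_countable by (intro allI AE_impI AE_F_upper) auto
  moreover have "AE \<omega> in M. \<forall>k\<ge>2. \<forall>\<^sub>F n in sequentially. harm n - 1 + (real (CARD('d) - 1) - 1 / real k) * ln (harm n - 1) \<le> F n \<omega>"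
    unfolding AE_all_countable by (intro allI AE_impI AE_F_lower) (auto simp: field_simps)
  moreover have "AE \<omega> in M. \<forall>k\<ge>1. \<exists>\<^sub>F n in sequentially. F n \<omega> \<le> harm n + (real (CARD('d) - 1) + 1 / real k) * ln (harm n)"
    unfolding AE_all_countable by (intro allI AE_impI AE_F_small_often) auto
  ultimately show ?thesis
    using AE_F_large_often AE_Z_asymp AE_Z_bounded_deviation[OF d] AE_X_pos
  proof eventually_elim
    case (elim \<omega>)
    note upper = elim(1) and lower = elim(2) and small = elim(3) and large = elim(4) and Z1 = elim(5) and dev = elim(6)
    let ?T = "\<lambda>m. record_time (\<lambda>i. X i \<omega>) m" and ?r = "\<lambda>n. rec_count (\<lambda>i. X i \<omega>) n"
    define q where "q m = (FT m \<omega> - rec_scale m) / ln (real m)" for m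
    define Q where "Q n = (F n \<omega> - Z n \<omega>) / ln (R n \<omega>)" for n
    have qQ: "q m = Q (?T m)" if "1 \<le> m" for m
      using record_time_facts(1)[OF Z1 that] by (simp add: q_def Q_def FT_eq_F Z_eq_rec_scale R_def)
    have Qq: "Q n = q (?r n)" if "1 \<le> n" for n
      using Ftilde_rec_count[of "\<lambda>i. X i \<omega>" n] elim(7) that
      by (simp add: q_def Q_def FT_def F_def Z_eq_rec_scale R_def)
    have lnR: "\<forall>\<^sub>F n in sequentially. 0 < ln (R n \<omega>)"
      using rec_count_at_top[OF Z1, unfolded filterlim_at_top, rule_format, of 2]
      by eventually_elim (auto simp: R_def)
    \<comment> \<open>Eventual properties pass from times to record numbers because the record times
      tend to infinity.\<close>
    have transfer_ev: "\<forall>\<^sub>F m in sequentially. P (q m) (?T m)" if "\<forall>\<^sub>F n in sequentially. P (Q n) n" for P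
    proof -
      have "\<forall>\<^sub>F m in sequentially. P (Q (?T m)) (?T m)"
        using record_time_facts(2)[OF Z1] that unfolding filterlim_iff by blast
      then show ?thesis using eventually_ge_at_top[of 1] by eventually_elim (simp add: qQ)
    qed
    \<comment> \<open>A property may occur at times that are not record times, so frequent
      properties pass through \<open>Q n = q (?r n)\<close> and the divergence of the count, by
      contraposition.\<close>
    have transfer_freq: "\<exists>\<^sub>F m in sequentially. P (q m)" if "\<exists>\<^sub>F n in sequentially. P (Q n)" for P
    proof (rule ccontr)
      assume "\<not> (\<exists>\<^sub>F m in sequentially. P (q m))"
      then have "\<forall>\<^sub>F m in sequentially. \<not> P (q m)" by (simp add: not_frequently)
      then have "\<forall>\<^sub>F n in sequentially. \<not> P (q (?r n))"
        using rec_count_at_top[OF Z1] unfolding filterlim_iff by blast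
      then have "\<forall>\<^sub>F n in sequentially. \<not> P (Q n)"
        using eventually_ge_at_top[of 1] by eventually_elim (simp add: Qq)
      with that show False by (simp add: frequently_def)
    qed
    have k0: "(\<lambda>k. 1 / real k) \<longlonglongrightarrow> 0" by (rule lim_1_over_n)
    have "limsup q \<le> ereal ((?d + 1 / real k) / ?d)" if k: "1 \<le> k" for k
    proof -
      \<comment> \<open>The 5 is the shift 2 of \<open>AE_F_upper\<close> plus the deviation bound 3
        of \<open>Z\<close>.\<close>
      define u where "u n = (5 + (?d + 1 / real k) * ln (harm n + 2)) / ln (R n \<omega>)" for n
      have "\<forall>\<^sub>F n in sequentially. Q n \<le> u n"
        using upper[rule_format, OF k] dev lnR
        by eventually_elim (auto simp: Q_def u_def intro!: divide_right_mono)
      then have "\<forall>\<^sub>F m in sequentially. q m \<le> u (?T m)" by (rule transfer_ev)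
      then have "limsup q \<le> limsup (\<lambda>m. ereal (u (?T m)))" by (intro Limsup_mono) simp
      also have "u \<longlonglongrightarrow> (?d + 1 / real k) / ?d" unfolding u_def by (rule ln_shift_R_ratio[OF Z1])
      from filterlim_compose[OF this record_time_facts(2)[OF Z1]]
      have "limsup (\<lambda>m. ereal (u (?T m))) = ereal ((?d + 1 / real k) / ?d)"
        by (intro lim_imp_Limsup) auto
      finally show ?thesis .
    qed
    moreover have "(\<lambda>k. (?d + 1 / real k) / ?d) \<longlonglongrightarrow> (?d + 0) / ?d" by (intro tendsto_intros k0) simp
    then have "(\<lambda>k. (?d + 1 / real k) / ?d) \<longlonglongrightarrow> 1" by simp
    ultimately have sup_le: "limsup q \<le> ereal 1" by (rule ereal_le_of_tendsto)
    have sup_ge: "ereal 1 \<le> limsup q"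
    proof (rule ereal_ge_of_tendsto)
      fix k :: nat assume k: "1 \<le> k"
      have "(\<lambda>n. (-3 + ?d * ln (harm n + 0)) / ln (R n \<omega>)) \<longlonglongrightarrow> ?d / ?d" by (rule ln_shift_R_ratio[OF Z1])
      then have "\<forall>\<^sub>F n in sequentially. 1 - 1 / real k < (-3 + ?d * ln (harm n + 0)) / ln (R n \<omega>)"
        by (rule order_tendstoD) (use k in simp)
      then have "\<forall>\<^sub>F n in sequentially. harm n + ?d * ln (harm n) < F n \<omega> \<longrightarrow> 1 - 1 / real k \<le> Q n"
        using dev lnR
      proof eventually_elim
        case (elim n)
        show ?case
        proof
          assume "harm n + ?d * ln (harm n) < F n \<omega>"
          then have "(-3 + ?d * ln (harm n + 0)) / ln (R n \<omega>) \<le> Q n"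
            unfolding Q_def using elim by (intro divide_right_mono) auto
          then show "1 - 1 / real k \<le> Q n" using elim(1) by linarith
        qed
      qed
      with large have "\<exists>\<^sub>F n in sequentially. 1 - 1 / real k \<le> Q n" by (rule frequently_mp[rotated])
      then have "\<exists>\<^sub>F m in sequentially. 1 - 1 / real k \<le> q m" by (rule transfer_freq)
      then show "ereal (1 - 1 / real k) \<le> limsup q" by (rule frequently_imp_Limsup_ge)
    next
      have "(\<lambda>k. 1 - 1 / real k) \<longlonglongrightarrow> 1 - 0" by (intro tendsto_intros k0)
      then show "(\<lambda>k. 1 - 1 / real k) \<longlonglongrightarrow> 1" by simp
    qed
    have d1: "real (CARD('d) - 1) / ?d = 1 - 1 / ?d" using d by (simp add: of_nat_diff field_simps)
    have inf_ge: "ereal (1 - 1 / ?d) \<le> liminf q"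
    proof (rule ereal_ge_of_tendsto)
      fix k :: nat assume k: "1 \<le> k"
      \<comment> \<open>The -4 is the shift -1 of \<open>AE_F_lower\<close> minus the deviation
        bound 3; \<open>Suc k\<close> keeps the tolerance at most 1/2.\<close>
      define u where "u n = (-4 + (real (CARD('d) - 1) - 1 / real (Suc k)) * ln (harm n + (-1))) / ln (R n \<omega>)" for n
      have "\<forall>\<^sub>F n in sequentially. harm n - 1 + (real (CARD('d) - 1) - 1 / real (Suc k)) * ln (harm n - 1) \<le> F n \<omega>"
        by (rule lower[rule_format]) (use k in simp)
      then have "\<forall>\<^sub>F n in sequentially. u n \<le> Q n"
        using dev lnR by eventually_elim (auto simp: Q_def u_def intro!: divide_right_mono)
      then have "\<forall>\<^sub>F m in sequentially. u (?T m) \<le> q m" by (rule transfer_ev)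
      then have "liminf (\<lambda>m. ereal (u (?T m))) \<le> liminf q" by (intro Liminf_mono) simp
      moreover have "u \<longlonglongrightarrow> (real (CARD('d) - 1) - 1 / real (Suc k)) / ?d" unfolding u_def by (rule ln_shift_R_ratio[OF Z1])
      from filterlim_compose[OF this record_time_facts(2)[OF Z1]]
      have "liminf (\<lambda>m. ereal (u (?T m))) = ereal ((real (CARD('d) - 1) - 1 / real (Suc k)) / ?d)"
        by (intro lim_imp_Liminf) auto
      ultimately show "ereal ((real (CARD('d) - 1) - 1 / real (Suc k)) / ?d) \<le> liminf q" by simp
    next
      have "(\<lambda>k. (real (CARD('d) - 1) - 1 / real (Suc k)) / ?d) \<longlonglongrightarrow> (real (CARD('d) - 1) - 0) / ?d"
        by (intro tendsto_intros LIMSEQ_Suc[OF k0]) simp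
      then show "(\<lambda>k. (real (CARD('d) - 1) - 1 / real (Suc k)) / ?d) \<longlonglongrightarrow> 1 - 1 / ?d" by (simp only: diff_0_right d1)
    qed
    have inf_le: "liminf q \<le> ereal (1 - 1 / ?d)"
    proof (rule ereal_le_of_tendsto)
      fix k :: nat assume k: "1 \<le> k"
      define t where "t = real (CARD('d) - 1) + 1 / real k"
      have "(\<lambda>n. (3 + t * ln (harm n + 0)) / ln (R n \<omega>)) \<longlonglongrightarrow> t / ?d" by (rule ln_shift_R_ratio[OF Z1])
      then have "\<forall>\<^sub>F n in sequentially. (3 + t * ln (harm n + 0)) / ln (R n \<omega>) < t / ?d + 1 / real k"
        by (rule order_tendstoD) (use k in simp)
      then have "\<forall>\<^sub>F n in sequentially. F n \<omega> \<le> harm n + t * ln (harm n) \<longrightarrow> Q n \<le> t / ?d + 1 / real k"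
        using dev lnR
      proof eventually_elim
        case (elim n)
        show ?case
        proof
          assume "F n \<omega> \<le> harm n + t * ln (harm n)"
          then have "Q n \<le> (3 + t * ln (harm n + 0)) / ln (R n \<omega>)"
            unfolding Q_def using elim by (intro divide_right_mono) auto
          then show "Q n \<le> t / ?d + 1 / real k" using elim(1) by linarith
        qed
      qed
      with small[rule_format, OF k] have "\<exists>\<^sub>F n in sequentially. Q n \<le> t / ?d + 1 / real k"
        unfolding t_def by (rule frequently_mp[rotated])
      then have "\<exists>\<^sub>F m in sequentially. q m \<le> t / ?d + 1 / real k" by (rule transfer_freq)
      then show "liminf q \<le> ereal ((real (CARD('d) - 1) + 1 / real k) / ?d + 1 / real k)"
        unfolding t_def by (rule frequently_imp_Liminf_le)
    next
      have "(\<lambda>k. (real (CARD('d) - 1) + 1 / real k) / ?d + 1 / real k) \<longlonglongrightarrow> (real (CARD('d) - 1) + 0) / ?d + 0"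
        by (intro tendsto_intros k0) simp
      then show "(\<lambda>k. (real (CARD('d) - 1) + 1 / real k) / ?d + 1 / real k) \<longlonglongrightarrow> 1 - 1 / ?d" by (simp only: add_0_right d1)
    qed
    show ?case using sup_le sup_ge inf_le inf_ge by (auto simp: q_def intro: antisym)
  qed
qed


subsection \<open>Limit laws at the record times\<close>

definition centre :: "nat \<Rightarrow> real" where
  "centre m = rec_scale m + (1 - 1 / real CARD('d)) * ln (real m) + ln (real CARD('d))
     - ln (fact CARD('d)) / real CARD('d) - euler_mascheroni"

text \<open>A deterministic substitute for the \<open>m\<close>-th record time: for
  \<open>w > 0\<close> the count there tends to exceed \<open>m\<close>, for \<open>w < 0\<close> it
  tends to stay below.\<close>

definition level_index :: "real \<Rightarrow> nat \<Rightarrow> nat" where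
  "level_index w m = harm_index (rec_scale m + w)"

lemma level_index_shift_at_top: "filterlim (\<lambda>m. rec_scale m + w) at_top sequentially"
  using filterlim_tendsto_add_at_top[OF tendsto_const rec_scale_at_top, of w] by (simp add: add.commute)

lemma level_index_at_top: "filterlim (level_index w) at_top sequentially"
  unfolding level_index_def[abs_def] by (rule filterlim_harm_index[OF level_index_shift_at_top])

lemma harm_level_index:
  shows "rec_scale m + w \<le> harm (level_index w m)"
    and "(\<lambda>m. harm (level_index w m) - rec_scale m) \<longlonglongrightarrow> w"
proof -
  show *: "rec_scale m + w \<le> harm (level_index w m)" for m
    unfolding level_index_def by (rule harm_index)
  show "(\<lambda>m. harm (level_index w m) - rec_scale m) \<longlonglongrightarrow> w"
  proof (rule tendsto_sandwich)
    show "\<forall>\<^sub>F m in sequentially. w \<le> harm (level_index w m) - rec_scale m"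
      using *[of] by (intro always_eventually allI) (simp add: le_diff_eq add.commute)
    show "\<forall>\<^sub>F m in sequentially. harm (level_index w m) - rec_scale m \<le> w + inverse (rec_scale m + w)"
      using level_index_shift_at_top[of w, unfolded filterlim_at_top, rule_format, of 1]
    proof eventually_elim
      case (elim m)
      show ?case using harm_harm_index_le[OF elim] by (simp add: level_index_def inverse_eq_divide)
    qed
    have "(\<lambda>m. w + inverse (rec_scale m + w)) \<longlonglongrightarrow> w + 0"
      by (intro tendsto_intros tendsto_inverse_0_at_top level_index_shift_at_top)
    then show "(\<lambda>m. w + inverse (rec_scale m + w)) \<longlonglongrightarrow> w" by simp
  qed simp
qed

text \<open>At this time \<open>n\<close>, \<open>ln n\<close> is \<open>rec_scale m + w\<close>
  minus Euler's constant plus a null sequence, and \<open>ln (ln n)\<close> differs from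
  \<open>ln (rec_scale m)\<close> by a null sequence. The shift \<open>w\<close> of the time
  therefore only shifts the Gumbel argument.\<close>

lemma prob_F_level_index_tendsto:
  "(\<lambda>m. \<P>(\<omega> in M. F (level_index w m) \<omega> \<le> centre m + y)) \<longlonglongrightarrow> exp (- exp (- (y - w)))"
proof (rule prob_F_tendsto_gumbel[OF level_index_at_top])
  let ?d = "CARD('d)"
  define L where "L m = ln (real (level_index w m))" for m
  have "(\<lambda>m. harm (level_index w m) - L m) \<longlonglongrightarrow> euler_mascheroni"
    unfolding L_def by (rule filterlim_compose[OF euler_mascheroni_LIMSEQ level_index_at_top])
  from tendsto_diff[OF harm_level_index(2)[of w] this]
  have Lc: "(\<lambda>m. L m - rec_scale m) \<longlonglongrightarrow> w - euler_mascheroni" by (simp add: algebra_simps)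
  have ic: "(\<lambda>m. inverse (rec_scale m)) \<longlonglongrightarrow> 0" by (rule tendsto_inverse_0_at_top[OF rec_scale_at_top])
  have "(\<lambda>m. ln (1 + (L m - rec_scale m) * inverse (rec_scale m))) \<longlonglongrightarrow> ln (1 + (w - euler_mascheroni) * 0)"
    by (intro tendsto_intros Lc ic) simp
  then have lnL0: "(\<lambda>m. ln (1 + (L m - rec_scale m) * inverse (rec_scale m))) \<longlonglongrightarrow> 0" by simp
  have L_top: "filterlim L at_top sequentially"
    unfolding L_def by (intro filterlim_compose[OF ln_at_top] filterlim_compose[OF filterlim_real_sequentially level_index_at_top])
  have "\<forall>\<^sub>F m in sequentially. ln (1 + (L m - rec_scale m) * inverse (rec_scale m)) = ln (L m) - ln (rec_scale m)"
    using L_top[unfolded filterlim_at_top, rule_format, of 1] rec_scale_at_top[unfolded filterlim_at_top, rule_format, of 1]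
  proof eventually_elim
    case (elim m)
    have "1 + (L m - rec_scale m) * inverse (rec_scale m) = L m / rec_scale m"
      using elim by (simp add: field_simps)
    then show ?case using elim by (simp add: ln_divide_pos)
  qed
  with lnL0 have lnL: "(\<lambda>m. ln (L m) - ln (rec_scale m)) \<longlonglongrightarrow> 0" by (rule Lim_transform_eventually)
  have "(\<lambda>m. y - euler_mascheroni - (L m - rec_scale m) - real (?d - 1) * (ln (L m) - ln (rec_scale m)))
     \<longlonglongrightarrow> y - euler_mascheroni - (w - euler_mascheroni) - real (?d - 1) * 0"
    by (intro tendsto_intros Lc lnL)
  then have lim: "(\<lambda>m. y - euler_mascheroni - (L m - rec_scale m) - real (?d - 1) * (ln (L m) - ln (rec_scale m)))
     \<longlonglongrightarrow> y - w" by simp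
  have ev: "\<forall>\<^sub>F m in sequentially. y - euler_mascheroni - (L m - rec_scale m) - real (?d - 1) * (ln (L m) - ln (rec_scale m))
     = centre m + y - (L m + real (?d - 1) * ln (L m) - ln (fact (?d - 1)))"
    using eventually_ge_at_top[of 1]
  proof eventually_elim
    case (elim m)
    obtain e where e: "?d = Suc e" using d_pos by (cases "?d") auto
    have f: "ln (fact (Suc e) :: real) = ln (real (Suc e)) + ln (fact e)"
      by (simp add: ln_mult del: of_nat_Suc)
    \<comment> \<open>The term \<open>(d - 1) * ln (rec_scale m)\<close> yields the coefficient of
      \<open>ln m\<close> in \<open>centre\<close>; splitting \<open>ln (d!)\<close> as
      \<open>ln d + ln ((d - 1)!)\<close> then produces the remaining constants.\<close>
    have "real e * ln (rec_scale m) = (1 - 1 / real (Suc e)) * (ln (fact (Suc e)) + ln (real m))"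
      unfolding ln_rec_scale[OF elim] e by (simp add: field_simps)
    then have "(1 - 1 / real (Suc e)) * ln (real m) = real e * ln (rec_scale m) - ln (fact (Suc e)) + ln (fact (Suc e)) / real (Suc e)"
      by (simp add: algebra_simps)
    then show ?case unfolding centre_def e diff_Suc_1 f by (simp add: algebra_simps)
  qed
  show "(\<lambda>m. centre m + y - (ln (real (level_index w m)) + real (?d - 1) * ln (ln (real (level_index w m))) - ln (fact (?d - 1)))) \<longlonglongrightarrow> y - w"
    using Lim_transform_eventually[OF lim ev] unfolding L_def .
qed

lemma rec_count_le_imp_Z: "rec_count (\<lambda>i. X i \<omega>) n \<le> m \<Longrightarrow> Z n \<omega> \<le> rec_scale m"
  and rec_count_ge_imp_Z: "m \<le> rec_count (\<lambda>i. X i \<omega>) n \<Longrightarrow> rec_scale m \<le> Z n \<omega>"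
  by (auto simp: Z_eq_rec_scale intro: rec_scale_mono)

lemma AE_FT_sandwich:
  "AE \<omega> in M. \<forall>m n. 1 \<le> m \<longrightarrow> 1 \<le> n \<longrightarrow>
     (m \<le> rec_count (\<lambda>i. X i \<omega>) n \<longrightarrow> FT m \<omega> \<le> F n \<omega>) \<and>
     (rec_count (\<lambda>i. X i \<omega>) n \<le> m \<longrightarrow> F n \<omega> \<le> FT m \<omega>)"
  using AE_X_pos AE_Z_asymp
proof eventually_elim
  case (elim \<omega>)
  have pos: "\<And>i j. 1 \<le> i \<Longrightarrow> 0 < X i \<omega> $ j" using elim(1) by blast
  show ?case
    using Ftilde_le[of "\<lambda>i. X i \<omega>", OF pos] Ftilde_ge[of "\<lambda>i. X i \<omega>", OF pos] rec_count_unbounded[OF elim(2)]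
    unfolding FT_def F_def by blast
qed

text \<open>If the count at the upper level has not reached \<open>m\<close>, then \<open>Z\<close>
  there is at most \<open>rec_scale m\<close>, which is at least \<open>w\<close> below
  \<open>harm\<close>.\<close>

lemma prob_F_level_index_le:
  assumes m: "1 \<le> m" and w: "0 < w"
  shows "\<P>(\<omega> in M. F (level_index w m) \<omega> \<le> x)
      \<le> \<P>(\<omega> in M. FT m \<omega> \<le> x) + \<P>(\<omega> in M. w \<le> \<bar>Z (level_index w m) \<omega> - harm (level_index w m)\<bar>)"
proof -
  let ?n = "level_index w m"
  have n1: "1 \<le> ?n" unfolding level_index_def by (rule harm_index)
  let ?A = "{\<omega> \<in> space M. FT m \<omega> \<le> x}" and ?B = "{\<omega> \<in> space M. w \<le> \<bar>Z ?n \<omega> - harm ?n\<bar>}"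
  have "\<P>(\<omega> in M. F ?n \<omega> \<le> x) \<le> prob (?A \<union> ?B)"
  proof (rule finite_measure_mono_AE)
    show "AE \<omega> in M. \<omega> \<in> {\<omega> \<in> space M. F ?n \<omega> \<le> x} \<longrightarrow> \<omega> \<in> ?A \<union> ?B"
      using AE_FT_sandwich
    proof eventually_elim
      case (elim \<omega>)
      show ?case
      proof (cases "m \<le> rec_count (\<lambda>i. X i \<omega>) ?n")
        case True
        then have "FT m \<omega> \<le> F ?n \<omega>" using elim m n1 by auto
        then show ?thesis by auto
      next
        case False
        then have "Z ?n \<omega> \<le> rec_scale m" by (intro rec_count_le_imp_Z) auto
        then have "w \<le> \<bar>Z ?n \<omega> - harm ?n\<bar>" using harm_level_index(1)[of m w] by linarith
        then show ?thesis by auto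
      qed
    qed
  qed measurable
  also have "\<dots> \<le> prob ?A + prob ?B" by (intro measure_Un_le) measurable
  finally show ?thesis .
qed

text \<open>If the count at \<open>n\<close> is at most \<open>m\<close>, then \<open>n\<close>
  precedes the next record after the \<open>m\<close>-th, so \<open>F n\<close> is no larger than
  \<open>FT m\<close>. The error event is kept in terms of \<open>Z\<close>, because at the lower
  level the overshoot of \<open>harm\<close> still has to be subtracted.\<close>

lemma prob_FT_le:
  assumes m: "1 \<le> m" and n: "1 \<le> n"
  shows "\<P>(\<omega> in M. FT m \<omega> \<le> x)
      \<le> \<P>(\<omega> in M. F n \<omega> \<le> x) + \<P>(\<omega> in M. rec_scale m \<le> Z n \<omega>)"
proof -
  let ?A = "{\<omega> \<in> space M. FT m \<omega> \<le> x}"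
  let ?C = "{\<omega> \<in> space M. F n \<omega> \<le> x}" and ?D = "{\<omega> \<in> space M. rec_scale m \<le> Z n \<omega>}"
  have "prob ?A \<le> prob (?C \<union> ?D)"
  proof (rule finite_measure_mono_AE)
    show "AE \<omega> in M. \<omega> \<in> ?A \<longrightarrow> \<omega> \<in> ?C \<union> ?D"
      using AE_FT_sandwich
    proof eventually_elim
      case (elim \<omega>)
      show ?case
      proof (cases "rec_count (\<lambda>i. X i \<omega>) n \<le> m")
        case True
        then have "F n \<omega> \<le> FT m \<omega>" using elim m n by auto
        then show ?thesis by auto
      next
        case False
        then have "rec_scale m \<le> Z n \<omega>" by (intro rec_count_ge_imp_Z) auto
        then show ?thesis by auto
      qed
    qed
  qed measurable
  also have "\<dots> \<le> prob ?C + prob ?D" by (intro measure_Un_le) measurable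
  finally show ?thesis .
qed

text \<open>The factor \<open>0 ^ e\<close> is 1 for \<open>e = 0\<close>, which is all that \<open>d = 2\<close> allows, and 0 otherwise.\<close>

lemma FT_cdf_eventual_bounds:
  assumes e: "max CARD('d) (2 * CARD('d) - 4) + e \<le> 2 * CARD('d) - 2"
  shows "\<exists>C. \<forall>w>0. \<forall>\<eta>>0. \<forall>y. \<forall>\<^sub>F m in sequentially.
       exp (- exp (- (y - w))) - \<eta> - C / w\<^sup>2 * 0 ^ e \<le> \<P>(\<omega> in M. FT m \<omega> \<le> centre m + y) \<and>
       \<P>(\<omega> in M. FT m \<omega> \<le> centre m + y) \<le> exp (- exp (- (y + w))) + \<eta> + C / w\<^sup>2 * 0 ^ e"
proof -
  obtain C0 where C0: "0 < C0" "\<And>n w. 1 \<le> n \<Longrightarrow> 0 < w \<Longrightarrow>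
      \<P>(\<omega> in M. w \<le> \<bar>Z n \<omega> - harm n\<bar>) \<le> C0 / (w\<^sup>2 * harm n ^ e)"
    using prob_Z_deviation_inverse_power[OF e] by blast
  have li1: "1 \<le> level_index w m" for w m unfolding level_index_def by (rule harm_index)
  have small: "\<forall>\<^sub>F m in sequentially. C0 / (v\<^sup>2 * harm (level_index w m) ^ e) \<le> C0 / v\<^sup>2 * 0 ^ e + \<eta>"
    if v: "0 < v" and eta: "0 < \<eta>" for v w \<eta>
  proof (cases "e = 0")
    case True
    then show ?thesis using eta by (intro always_eventually) auto
  next
    case False
    have "(\<lambda>m. C0 / v\<^sup>2 * (inverse (harm (level_index w m))) ^ e) \<longlonglongrightarrow> C0 / v\<^sup>2 * 0 ^ e"
      by (intro tendsto_intros tendsto_inverse_0_at_top filterlim_compose[OF harm_at_top level_index_at_top])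
    then have "\<forall>\<^sub>F m in sequentially. C0 / v\<^sup>2 * (inverse (harm (level_index w m))) ^ e < C0 / v\<^sup>2 * 0 ^ e + \<eta>"
      by (rule order_tendstoD) (use eta in simp)
    then show ?thesis by eventually_elim (simp add: power_inverse field_simps)
  qed
  have main: "\<forall>\<^sub>F m in sequentially.
       exp (- exp (- (y - w))) - \<eta> - (4 * C0) / w\<^sup>2 * 0 ^ e \<le> \<P>(\<omega> in M. FT m \<omega> \<le> centre m + y) \<and>
       \<P>(\<omega> in M. FT m \<omega> \<le> centre m + y) \<le> exp (- exp (- (y + w))) + \<eta> + (4 * C0) / w\<^sup>2 * 0 ^ e"
    if w: "0 < w" and eta: "0 < \<eta>" for w y \<eta> :: real
  proof -
    have lim1: "\<forall>\<^sub>F m in sequentially. exp (- exp (- (y - w))) - \<eta> / 2 < \<P>(\<omega> in M. F (level_index w m) \<omega> \<le> centre m + y)"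
      by (rule order_tendstoD[OF prob_F_level_index_tendsto]) (use eta in simp)
    have lim2: "\<forall>\<^sub>F m in sequentially. \<P>(\<omega> in M. F (level_index (- w) m) \<omega> \<le> centre m + y) < exp (- exp (- (y + w))) + \<eta> / 2"
      using prob_F_level_index_tendsto[of "- w" y] by (rule order_tendstoD) (use eta in simp)
    \<comment> \<open>The lower level may be overshot, so only a distance \<open>w / 2\<close> from
      \<open>rec_scale m\<close> is retained; squaring it gives the factor 4 in the
      constant.\<close>
    have close: "\<forall>\<^sub>F m in sequentially. harm (level_index (- w) m) - rec_scale m < - (w / 2)"
      by (rule order_tendstoD[OF harm_level_index(2)]) (use w in simp)
    have "0 < w / 2" "0 < \<eta> / 2" using w eta by auto
    show ?thesis
      using lim1 lim2 close small[OF w \<open>0 < \<eta> / 2\<close>, of w] small[OF \<open>0 < w / 2\<close> \<open>0 < \<eta> / 2\<close>, of "- w"]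
        eventually_ge_at_top[of 1]
    proof eventually_elim
      case (elim m)
      have le4: "C0 / w\<^sup>2 * 0 ^ e \<le> (4 * C0) / w\<^sup>2 * 0 ^ e"
        using C0(1) w by (intro mult_right_mono divide_right_mono) auto
      have eq4: "C0 / (w / 2)\<^sup>2 * 0 ^ e = (4 * C0) / w\<^sup>2 * 0 ^ e"
        by (simp add: power_divide)
      have "\<P>(\<omega> in M. w \<le> \<bar>Z (level_index w m) \<omega> - harm (level_index w m)\<bar>) \<le> C0 / w\<^sup>2 * 0 ^ e + \<eta> / 2"
        using C0(2)[OF li1 w, of w m] elim(4) by linarith
      then have 1: "exp (- exp (- (y - w))) - \<eta> - (4 * C0) / w\<^sup>2 * 0 ^ e \<le> \<P>(\<omega> in M. FT m \<omega> \<le> centre m + y)"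
        using prob_F_level_index_le[OF elim(6) w, of "centre m + y"] elim(1) le4 li1[of "-w" m] by linarith
      have "\<P>(\<omega> in M. rec_scale m \<le> Z (level_index (- w) m) \<omega>)
         \<le> \<P>(\<omega> in M. w / 2 \<le> \<bar>Z (level_index (- w) m) \<omega> - harm (level_index (- w) m)\<bar>)"
      proof (intro finite_measure_mono subsetI)
        fix \<omega> assume "\<omega> \<in> {\<omega> \<in> space M. rec_scale m \<le> Z (level_index (- w) m) \<omega>}"
        then have \<omega>: "\<omega> \<in> space M" "rec_scale m \<le> Z (level_index (- w) m) \<omega>" by auto
        then have "w / 2 \<le> \<bar>Z (level_index (- w) m) \<omega> - harm (level_index (- w) m)\<bar>"
          using elim(3) by linarith
        with \<omega>(1) show "\<omega> \<in> {\<omega> \<in> space M. w / 2 \<le> \<bar>Z (level_index (- w) m) \<omega> - harm (level_index (- w) m)\<bar>}"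
          by blast
      qed measurable
      also have "\<dots> \<le> (4 * C0) / w\<^sup>2 * 0 ^ e + \<eta> / 2"
        using C0(2)[OF li1 \<open>0 < w / 2\<close>, of "- w" m] elim(5) unfolding eq4 by linarith
      finally show ?case
        using 1 prob_FT_le[OF elim(6) li1, of "centre m + y" "- w" m] elim(2) by linarith
    qed
  qed
  show ?thesis by (intro exI[of _ "4 * C0"] allI impI main)
qed

text \<open>For \<open>d >= 3\<close> the choice \<open>e = 1\<close> removes the term
  \<open>C / w\<^sup>2\<close>, so \<open>w\<close> can tend to 0, and continuity of the Gumbel
  distribution function closes the gap.\<close>

lemma FT_gumbel:
  assumes d: "3 \<le> CARD('d)"
  shows "(\<lambda>m. \<P>(\<omega> in M. FT m \<omega> \<le> centre m + y)) \<longlonglongrightarrow> exp (- exp (- y))"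
proof -
  have "max CARD('d) (2 * CARD('d) - 4) + 1 \<le> 2 * CARD('d) - 2" using d by auto
  from FT_cdf_eventual_bounds[OF this] obtain C where
    C: "\<forall>w>0. \<forall>\<eta>>0. \<forall>y. \<forall>\<^sub>F m in sequentially.
       exp (- exp (- (y - w))) - \<eta> - C / w\<^sup>2 * 0 ^ 1 \<le> \<P>(\<omega> in M. FT m \<omega> \<le> centre m + y) \<and>
       \<P>(\<omega> in M. FT m \<omega> \<le> centre m + y) \<le> exp (- exp (- (y + w))) + \<eta> + C / w\<^sup>2 * 0 ^ 1"
    by (rule exE)
  have b: "\<forall>\<^sub>F m in sequentially.
       exp (- exp (- (y - w))) - \<eta> \<le> \<P>(\<omega> in M. FT m \<omega> \<le> centre m + y) \<and>
       \<P>(\<omega> in M. FT m \<omega> \<le> centre m + y) \<le> exp (- exp (- (y + w))) + \<eta>"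
    if "0 < w" "0 < \<eta>" for w \<eta>
    using C[rule_format, OF that, of y] by simp
  have cont: "isCont (\<lambda>w. exp (- exp (- (y - w)))) 0" "isCont (\<lambda>w. exp (- exp (- (y + w)))) 0"
    by (intro continuous_intros)+
  show ?thesis
  proof (rule tendstoI)
    fix \<epsilon> :: real assume "0 < \<epsilon>"
    then have e2: "0 < \<epsilon> / 2" by simp
    have "((\<lambda>w. exp (- exp (- (y - w)))) \<longlongrightarrow> exp (- exp (- y))) (at_right 0)"
      "((\<lambda>w. exp (- exp (- (y + w)))) \<longlongrightarrow> exp (- exp (- y))) (at_right 0)"
      using cont by (auto simp: isCont_def intro: tendsto_within_subset)
    from tendstoD[OF this(1) e2] tendstoD[OF this(2) e2]
    have "\<forall>\<^sub>F w in at_right 0. 0 < w \<and> dist (exp (- exp (- (y - w)))) (exp (- exp (- y))) < \<epsilon> / 2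
       \<and> dist (exp (- exp (- (y + w)))) (exp (- exp (- y))) < \<epsilon> / 2"
      using eventually_at_right_less[of 0] by eventually_elim auto
    then obtain w where w: "0 < w" "dist (exp (- exp (- (y - w)))) (exp (- exp (- y))) < \<epsilon> / 2"
       "dist (exp (- exp (- (y + w)))) (exp (- exp (- y))) < \<epsilon> / 2"
      using eventually_happens'[OF trivial_limit_at_right_real] by blast
    show "\<forall>\<^sub>F m in sequentially. dist (\<P>(\<omega> in M. FT m \<omega> \<le> centre m + y)) (exp (- exp (- y))) < \<epsilon>"
      using b[OF w(1) e2]
    proof eventually_elim
      case (elim m)
      then show ?case using w(2,3) unfolding dist_real_def by linarith
    qed
  qed
qed

text \<open>With \<open>e = 0\<close> the term \<open>C / w\<^sup>2\<close> stays, so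
  \<open>w\<close> cannot be small. Division by \<open>ln m\<close> makes any fixed window around
  \<open>centre m\<close> negligible, so \<open>w\<close> can be taken large instead.\<close>

lemma FT_in_probability:
  assumes d: "2 \<le> CARD('d)" and eps: "0 < \<epsilon>"
  shows "(\<lambda>m. \<P>(\<omega> in M. \<epsilon> < \<bar>(FT m \<omega> - rec_scale m) / ln (real m) - (1 - 1 / real CARD('d))\<bar>)) \<longlonglongrightarrow> 0"
proof -
  have "max CARD('d) (2 * CARD('d) - 4) + 0 \<le> 2 * CARD('d) - 2" using d by auto
  from FT_cdf_eventual_bounds[OF this] obtain C where
    C: "\<forall>w>0. \<forall>\<eta>>0. \<forall>y. \<forall>\<^sub>F m in sequentially.
       exp (- exp (- (y - w))) - \<eta> - C / w\<^sup>2 * 0 ^ 0 \<le> \<P>(\<omega> in M. FT m \<omega> \<le> centre m + y) \<and>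
       \<P>(\<omega> in M. FT m \<omega> \<le> centre m + y) \<le> exp (- exp (- (y + w))) + \<eta> + C / w\<^sup>2 * 0 ^ 0"
    by (rule exE)
  define \<kappa> where "\<kappa> = ln (real CARD('d)) - ln (fact CARD('d)) / real CARD('d) - euler_mascheroni"
  define A where "A m = {\<omega> \<in> space M. \<epsilon> < \<bar>(FT m \<omega> - rec_scale m) / ln (real m) - (1 - 1 / real CARD('d))\<bar>}" for m
  \<comment> \<open>\<open>\<kappa>\<close> collects the constants of \<open>centre\<close>. Once
    \<open>\<epsilon> * ln m\<close> exceeds \<open>\<bar>y\<bar> + \<bar>\<kappa>\<bar>\<close>,
    the deviation event lies outside the window of half-width \<open>y\<close> around
    \<open>centre m\<close>.\<close>
  have event: "\<forall>\<^sub>F m in sequentially. prob (A m) \<le> 1 - \<P>(\<omega> in M. FT m \<omega> \<le> centre m + y)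
       + \<P>(\<omega> in M. FT m \<omega> \<le> centre m + - y)" for y
  proof -
    have "filterlim (\<lambda>m. ln (real m)) at_top sequentially"
      by (rule filterlim_compose[OF ln_at_top filterlim_real_sequentially])
    then have "\<forall>\<^sub>F m in sequentially. max 1 ((\<bar>y\<bar> + \<bar>\<kappa>\<bar>) / \<epsilon>) \<le> ln (real m)"
      unfolding filterlim_at_top by blast
    then show ?thesis
    proof eventually_elim
      case (elim m)
      let ?l = "ln (real m)"
      have l: "1 \<le> ?l" "\<bar>y\<bar> + \<bar>\<kappa>\<bar> \<le> \<epsilon> * ?l" using elim eps by (auto simp: field_simps)
      have "A m \<subseteq> (space M - {\<omega> \<in> space M. FT m \<omega> \<le> centre m + y}) \<union> {\<omega> \<in> space M. FT m \<omega> \<le> centre m + - y}"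
      proof
        fix \<omega> assume \<omega>: "\<omega> \<in> A m"
        then have "\<epsilon> < \<bar>(FT m \<omega> - rec_scale m) / ?l - (1 - 1 / real CARD('d))\<bar>" by (simp add: A_def)
        also have "(FT m \<omega> - rec_scale m) / ?l - (1 - 1 / real CARD('d)) = (FT m \<omega> - centre m + \<kappa>) / ?l"
          using l(1) by (simp add: centre_def \<kappa>_def field_simps)
        also have "\<bar>\<dots>\<bar> = \<bar>FT m \<omega> - centre m + \<kappa>\<bar> / ?l" using l(1) by (simp add: abs_divide)
        finally have "\<epsilon> * ?l < \<bar>FT m \<omega> - centre m + \<kappa>\<bar>" using l(1) by (simp add: less_divide_eq)
        with l(2) have "centre m + y < FT m \<omega> \<or> FT m \<omega> \<le> centre m + - y" by linarith
        then show "\<omega> \<in> (space M - {\<omega> \<in> space M. FT m \<omega> \<le> centre m + y}) \<union> {\<omega> \<in> space M. FT m \<omega> \<le> centre m + - y}"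
          using \<omega> by (auto simp: A_def)
      qed
      then have "prob (A m) \<le> prob ((space M - {\<omega> \<in> space M. FT m \<omega> \<le> centre m + y}) \<union> {\<omega> \<in> space M. FT m \<omega> \<le> centre m + - y})"
        by (intro finite_measure_mono) measurable
      also have "\<dots> \<le> prob (space M - {\<omega> \<in> space M. FT m \<omega> \<le> centre m + y}) + \<P>(\<omega> in M. FT m \<omega> \<le> centre m + - y)"
        by (intro measure_Un_le) measurable
      also have "prob (space M - {\<omega> \<in> space M. FT m \<omega> \<le> centre m + y}) = 1 - \<P>(\<omega> in M. FT m \<omega> \<le> centre m + y)"
        by (rule prob_compl) measurable
      finally show ?case .
    qed
  qed
  show ?thesis
  proof (rule tendstoI)
    fix r :: real assume r: "0 < r"
    have "((\<lambda>w. 1 - exp (- exp (- w)) + exp (- exp w) + 2 * C * (inverse w)\<^sup>2) \<longlongrightarrow> 1 - exp (- 0) + 0 + 2 * C * 0\<^sup>2) at_top"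
      by (intro tendsto_intros tendsto_inverse_0_at_top filterlim_ident
            filterlim_compose[OF exp_at_bot] filterlim_compose[OF filterlim_uminus_at_bot_at_top] exp_at_top)
    then have "\<forall>\<^sub>F w in at_top. 1 - exp (- exp (- w)) + exp (- exp w) + 2 * C * (inverse w)\<^sup>2 < r / 2"
      by (rule order_tendstoD) (use r in simp)
    then have "\<forall>\<^sub>F w in at_top. 0 < w \<and> 1 - exp (- exp (- w)) + exp (- exp w) + 2 * C * (inverse w)\<^sup>2 < r / 2"
      using eventually_gt_at_top[of 0] by eventually_elim auto
    then obtain w :: real where w: "0 < w" "1 - exp (- exp (- w)) + exp (- exp w) + 2 * C * (inverse w)\<^sup>2 < r / 2"
      using eventually_happens'[OF trivial_limit_at_top_linorder] by blast
    have r8: "0 < r / 8" using r by simp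
    show "\<forall>\<^sub>F m in sequentially. dist (\<P>(\<omega> in M. \<epsilon> < \<bar>(FT m \<omega> - rec_scale m) / ln (real m) - (1 - 1 / real CARD('d))\<bar>)) 0 < r"
      \<comment> \<open>With the window \<open>2 * w\<close> the slack \<open>w\<close> leaves
        Gumbel arguments \<open>w\<close> and \<open>- w\<close>. The two errors
        \<open>r / 8\<close> and the bound \<open>r / 2\<close> add up to less than
        \<open>r\<close>.\<close>
      using event[of "2 * w"] C[rule_format, OF w(1) r8, of "2 * w"] C[rule_format, OF w(1) r8, of "- (2 * w)"]
    proof eventually_elim
      case (elim m)
      have "2 * C * (inverse w)\<^sup>2 = C / w\<^sup>2 + C / w\<^sup>2" by (simp add: power_inverse divide_inverse)
      moreover have "2 * w - w = w" "- (- (2 * w) + w) = w" by auto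
      ultimately have "prob (A m) < r" using elim w(2) r by simp
      then show ?case by (simp add: A_def[symmetric] dist_real_def)
    qed
  qed
qed

end

theorem theorem5p3:
  fixes M :: "'a measure" and X :: "nat \<Rightarrow> 'a \<Rightarrow> real^'d"
  assumes "prob_space M"
    and "prob_space.indep_vars M (\<lambda>_. borel) (\<lambda>p \<omega>. X (fst p) \<omega> $ snd p) ({1..} \<times> UNIV)"
    and "\<And>i j. 1 \<le> i \<Longrightarrow> distributed M lborel (\<lambda>\<omega>. X i \<omega> $ j) (exponential_density 1)"
  shows
    \<comment> \<open>(a1)\<close>
    "(CARD('d) \<ge> 2 \<longrightarrow>
       (\<forall>\<epsilon>>0. (\<lambda>m. measure M {\<omega> \<in> space M.
          \<epsilon> < \<bar>(Ftilde (\<lambda>i. X i \<omega>) m - (fact CARD('d) * real m) powr (1 / real CARD('d))) / ln (real m)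
                - (1 - 1 / real CARD('d))\<bar>}) \<longlonglongrightarrow> 0))
   \<and> \<comment> \<open>(a2)\<close>
    (CARD('d) \<ge> 3 \<longrightarrow>
       weak_conv
         (\<lambda>m. cdf (distr M borel (\<lambda>\<omega>. Ftilde (\<lambda>i. X i \<omega>) m
             - ((fact CARD('d) * real m) powr (1 / real CARD('d))
                + (1 - 1 / real CARD('d)) * ln (real m) + ln (real CARD('d))
                - ln (fact CARD('d)) / real CARD('d) - euler_mascheroni))))
         (\<lambda>x. exp (- exp (- x))))
   \<and> \<comment> \<open>(b1)\<close>
    (AE \<omega> in M. (\<lambda>m. Ftilde (\<lambda>i. X i \<omega>) m)
        \<sim>[sequentially] (\<lambda>m. (fact CARD('d) * real m) powr (1 / real CARD('d))))
   \<and> \<comment> \<open>(b2)\<close>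
    (CARD('d) \<ge> 5 \<longrightarrow>
       (AE \<omega> in M.
          liminf (\<lambda>m. ereal ((Ftilde (\<lambda>i. X i \<omega>) m - (fact CARD('d) * real m) powr (1 / real CARD('d)))
                     / ln (real m))) = ereal (1 - 1 / real CARD('d))
        \<and> limsup (\<lambda>m. ereal ((Ftilde (\<lambda>i. X i \<omega>) m - (fact CARD('d) * real m) powr (1 / real CARD('d)))
                     / ln (real m))) = ereal 1))"
proof -
  interpret exp_sample M X
    using assms by (intro exp_sample.intro exp_sample_axioms.intro)
  have FT: "Ftilde (\<lambda>i. X i \<omega>) m = FT m \<omega>" for \<omega> m by (simp add: FT_def)
  have sc: "(fact CARD('d) * real m) powr (1 / real CARD('d)) = rec_scale m" for m
    by (simp add: rec_scale_def root_scale_def)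
  have a2: "weak_conv (\<lambda>m. cdf (distr M borel (\<lambda>\<omega>. FT m \<omega> - centre m))) (\<lambda>x. exp (- exp (- x)))" if "3 \<le> CARD('d)"
    unfolding weak_conv_def
  proof (intro allI impI)
    fix y
    have "cdf (distr M borel (\<lambda>\<omega>. FT m \<omega> - centre m)) y = \<P>(\<omega> in M. FT m \<omega> \<le> centre m + y)" for m
      unfolding cdf_def
      by (subst measure_distr) (auto intro!: arg_cong[where f = prob] simp: algebra_simps)
    then show "(\<lambda>m. cdf (distr M borel (\<lambda>\<omega>. FT m \<omega> - centre m)) y) \<longlonglongrightarrow> exp (- exp (- y))"
      using FT_gumbel[OF that] by simp
  qed
  show ?thesis
    unfolding FT sc
  proof (intro conjI impI allI)
    show "(\<lambda>m. \<P>(\<omega> in M. \<epsilon> < \<bar>(FT m \<omega> - rec_scale m) / ln (real m) - (1 - 1 / real CARD('d))\<bar>)) \<longlonglongrightarrow> 0"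
      if "2 \<le> CARD('d)" "0 < \<epsilon>" for \<epsilon> using that by (rule FT_in_probability)
    show "AE \<omega> in M. (\<lambda>m. FT m \<omega>) \<sim>[sequentially] rec_scale" by (rule AE_FT_asymp_equiv)
    show "AE \<omega> in M. liminf (\<lambda>m. ereal ((FT m \<omega> - rec_scale m) / ln (real m))) = ereal (1 - 1 / real CARD('d))
        \<and> limsup (\<lambda>m. ereal ((FT m \<omega> - rec_scale m) / ln (real m))) = ereal 1" if "5 \<le> CARD('d)"
      by (rule AE_FT_liminf_limsup) (use that in linarith)
  qed (rule a2[unfolded centre_def])
qed

end
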